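(* Let $1<p<\infty$, $\alpha>-p$, and let $u\in W^{1,p}(\Omega)$ be a non-negative weak solution of $$\Delta_pu=|x|^\alpha u^{p-1}(x)\quad\text{in }\Omega.$$ Suppose that there exists an interior vanishing point $x_0\in\Omega$, i.e. $u(x_0)=0$. Then $u\equiv0$ in $\Omega$.
   Context: $\Omega\subset\mathbb R^n$ ($n\ge2$) is a bounded domain (open and connected), and $\Delta_pu=\operatorname{div}(|\nabla u|^{p-2}\nabla u)$. Weak solution means $\int_\Omega|\nabla u|^{p-2}\nabla u\cdot\nabla\Psi\,dx=-\int_\Omega|x|^\alpha u^{p-1}\Psi\,dx$ for every $\Psi\in W_0^{1,p}(\Omega)$. *)

theory Defs
  imports "HOL-Analysis.Analysis"
begin

definition grad :: "('a::euclidean_space \<Rightarrow> real) \<Rightarrow> 'a \<Rightarrow> 'a" where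
  "grad \<phi> x = (\<Sum>b\<in>Basis. frechet_derivative \<phi> (at x) b *\<^sub>R b)"

primrec C_class :: "nat \<Rightarrow> ('a::euclidean_space \<Rightarrow> real) \<Rightarrow> bool" where
  "C_class 0 \<phi> \<longleftrightarrow> continuous_on UNIV \<phi>"
| "C_class (Suc k) \<phi> \<longleftrightarrow> (\<forall>x. \<phi> differentiable (at x)) \<and>
     (\<forall>b\<in>Basis. C_class k (\<lambda>x. frechet_derivative \<phi> (at x) b))"

definition test_function :: "'a::euclidean_space set \<Rightarrow> ('a \<Rightarrow> real) \<Rightarrow> bool" where
  "test_function \<Omega> \<phi> \<longleftrightarrow> (\<forall>k. C_class k \<phi>) \<and>
     compact (closure (support_on UNIV \<phi>)) \<and> closure (support_on UNIV \<phi>) \<subseteq> \<Omega>"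

definition Lp_space ::
  "real \<Rightarrow> 'a::euclidean_space set \<Rightarrow> ('a \<Rightarrow> 'b::euclidean_space) set" where
  "Lp_space p \<Omega> = {f \<in> borel_measurable (lebesgue_on \<Omega>).
     integrable (lebesgue_on \<Omega>) (\<lambda>x. norm (f x) powr p)}"

definition locally_integrable ::
  "'a::euclidean_space set \<Rightarrow> ('a \<Rightarrow> 'b::euclidean_space) \<Rightarrow> bool" where
  "locally_integrable \<Omega> f \<longleftrightarrow> (\<forall>K. compact K \<and> K \<subseteq> \<Omega> \<longrightarrow> set_integrable lebesgue K f)"

definition has_weak_gradient ::
  "'a::euclidean_space set \<Rightarrow> ('a \<Rightarrow> real) \<Rightarrow> ('a \<Rightarrow> 'a) \<Rightarrow> bool" where
  "has_weak_gradient \<Omega> u g \<longleftrightarrow> locally_integrable \<Omega> u \<and> locally_integrable \<Omega> g \<and>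
     (\<forall>\<phi>. test_function \<Omega> \<phi> \<longrightarrow>
        (LINT x|lebesgue_on \<Omega>. u x *\<^sub>R grad \<phi> x) = - (LINT x|lebesgue_on \<Omega>. \<phi> x *\<^sub>R g x))"

text \<open>A weak gradient is determined only up to null sets; every use below is
  insensitive to which version is chosen.\<close>

definition weak_grad :: "'a::euclidean_space set \<Rightarrow> ('a \<Rightarrow> real) \<Rightarrow> 'a \<Rightarrow> 'a" where
  "weak_grad \<Omega> u = (SOME g. has_weak_gradient \<Omega> u g)"

definition sobolev_W1 :: "real \<Rightarrow> 'a::euclidean_space set \<Rightarrow> ('a \<Rightarrow> real) set" where
  "sobolev_W1 p \<Omega> = {u \<in> Lp_space p \<Omega>. \<exists>g \<in> Lp_space p \<Omega>. has_weak_gradient \<Omega> u g}"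

definition sobolev_norm :: "real \<Rightarrow> 'a::euclidean_space set \<Rightarrow> ('a \<Rightarrow> real) \<Rightarrow> real" where
  "sobolev_norm p \<Omega> u =
     ((LINT x|lebesgue_on \<Omega>. \<bar>u x\<bar> powr p) +
      (LINT x|lebesgue_on \<Omega>. norm (weak_grad \<Omega> u x) powr p)) powr (1 / p)"

text \<open>\<open>W\<^sub>0\<^sup>1\<^sup>,\<^sup>p\<close>: the closure of the test functions in \<open>W\<^sup>1\<^sup>,\<^sup>p\<close>.\<close>

definition sobolev_W1_0 :: "real \<Rightarrow> 'a::euclidean_space set \<Rightarrow> ('a \<Rightarrow> real) set" where
  "sobolev_W1_0 p \<Omega> = {\<psi> \<in> sobolev_W1 p \<Omega>. \<exists>\<phi>. (\<forall>k. test_function \<Omega> (\<phi> k)) \<and>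
     (\<lambda>k::nat. sobolev_norm p \<Omega> (\<lambda>x. \<phi> k x - \<psi> x)) \<longlonglongrightarrow> 0}"

text \<open>Weak solutions of \<open>\<Delta>\<^sub>p u = |x|\<^sup>\<alpha> u\<^sup>p\<^sup>-\<^sup>1\<close>.  Integrability of the right-hand integrand is
  demanded because the Bochner integral of a non-integrable function is \<open>0\<close>; on the left it
  follows from Hoelder's inequality.  Since \<open>0 powr a = 0\<close>, the flux
  \<open>|\<nabla>u|\<^sup>p\<^sup>-\<^sup>2 \<nabla>u\<close> is \<open>0\<close> where the gradient vanishes, also for \<open>p < 2\<close>.\<close>

definition weak_solution ::
  "real \<Rightarrow> real \<Rightarrow> 'a::euclidean_space set \<Rightarrow> ('a \<Rightarrow> real) \<Rightarrow> bool" where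
  "weak_solution p \<alpha> \<Omega> u \<longleftrightarrow> (\<forall>\<psi> \<in> sobolev_W1_0 p \<Omega>.
     integrable (lebesgue_on \<Omega>) (\<lambda>x. norm x powr \<alpha> * u x powr (p - 1) * \<psi> x) \<and>
     (LINT x|lebesgue_on \<Omega>.
        (norm (weak_grad \<Omega> u x) powr (p - 2) *\<^sub>R weak_grad \<Omega> u x) \<bullet> weak_grad \<Omega> \<psi> x) =
     - (LINT x|lebesgue_on \<Omega>. norm x powr \<alpha> * u x powr (p - 1) * \<psi> x))"

text \<open>The value at a point of an element of \<open>W\<^sup>1\<^sup>,\<^sup>p\<close>, which is a function up to null sets, is that
  of its continuous representative; on an open set the latter is unique if it exists.\<close>

definition continuous_representative ::
  "'a::euclidean_space set \<Rightarrow> ('a \<Rightarrow> real) \<Rightarrow> ('a \<Rightarrow> real) \<Rightarrow> bool" where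
  "continuous_representative \<Omega> u v \<longleftrightarrow>
     continuous_on \<Omega> v \<and> (AE x in lebesgue_on \<Omega>. v x = u x)"

definition vanishes_at :: "'a::euclidean_space set \<Rightarrow> ('a \<Rightarrow> real) \<Rightarrow> 'a \<Rightarrow> bool" where
  "vanishes_at \<Omega> u x0 \<longleftrightarrow> (\<exists>v. continuous_representative \<Omega> u v \<and> v x0 = 0)"

end

theory Submission
  imports Defs
begin

text \<open>
  The solution is compared with explicit radial functions.  Let \<open>v\<close> be the continuous
  representative of \<open>u\<close>, let \<open>n\<close> be the dimension, \<open>r = |x|\<close> and \<open>f = |x|\<^sup>\<alpha> v\<^sup>p\<^sup>-\<^sup>1\<close>.  Suppose that \<open>w\<close>
  is continuously differentiable on an open set \<open>B\<close> and \<open>w \<le> v\<close> off a compact subset of \<open>B\<close>.  If \<open>G\<close>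
  is \<open>C\<^sup>1\<close>, nondecreasing and zero on the negative half line, then \<open>\<psi> = G(w - v)\<close>, extended by zero, is an
  admissible test function, and monotonicity of \<open>a \<mapsto> |a|\<^sup>p\<^sup>-\<^sup>2 a\<close> yields
  \<open>0 \<le> \<integral> |\<nabla>w|\<^sup>p\<^sup>-\<^sup>2 \<nabla>w \<bullet> \<nabla>\<psi> + \<integral> f \<psi>\<close> (\<open>comparison_inequality\<close>).  When \<open>h\<close> is the divergence of the flux
  of \<open>w\<close>, this reads \<open>\<integral> h \<psi> \<le> \<integral> f \<psi>\<close>.  On the set where \<open>\<psi> > 0\<close> one has
  \<open>f \<le> |x|\<^sup>\<alpha> w\<^sup>p\<^sup>-\<^sup>1\<close>, so a strict subsolution, \<open>h > |x|\<^sup>\<alpha> w\<^sup>p\<^sup>-\<^sup>1\<close>, must lie below \<open>v\<close>.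

  Away from the origin the weight is locally bounded.  On an annulus around a point where \<open>v > 0\<close>, a
  multiple of \<open>\<rho>\<^sup>-\<^sup>k - R\<^sup>-\<^sup>k\<close>, with \<open>\<rho>\<close> the distance to the centre and \<open>k\<close> large, is such a subsolution.  On
  the outer sphere only \<open>v \<ge> 0\<close> is used, so positivity spreads from the centre of a ball to the whole
  ball (\<open>annulus_positive\<close>).  As \<open>\<Omega> - {0}\<close> is
  connected, \<open>v\<close> is either identically zero or everywhere positive there.

  It remains to exclude that \<open>v\<close> vanishes at the origin only.  If \<open>\<alpha> > - n\<close>, then \<open>w = c (N + r\<^sup>\<gamma>)\<close>
  with \<open>\<gamma> = (\<alpha> + p) / (p - 1)\<close> has a flux proportional to \<open>r\<^sup>\<alpha> x\<close>, with divergence a positive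
  multiple of \<open>r\<^sup>\<alpha>\<close>, and is a strict subsolution across the origin once \<open>N\<close> and the radius are small;
  hence \<open>v(0) \<ge> c N\<close> (\<open>positive_at_origin_subcritical\<close>).  If \<open>\<alpha> \<le> - n\<close>, then \<open>p > n\<close>, points
  have positive capacity, and \<open>w = M + c r\<^sup>\<gamma>\<close> with \<open>\<gamma> = (p - n) / (p - 1)\<close> is a shifted
  fundamental solution: the divergence of its flux is a point mass of size comparable to \<open>c\<^sup>p\<^sup>-\<^sup>1\<close>.  If \<open>v(0) = 0\<close>, then for
  \<open>M \<rightarrow> 0\<close> the comparison inequality bounds this mass by the integral of \<open>f\<close> over \<open>{v \<le> c r\<^sup>\<gamma>}\<close> in a
  ball of radius \<open>R\<close>, hence by \<open>c\<^sup>p\<^sup>-\<^sup>1\<close> times the integral of \<open>r\<^sup>\<alpha>\<^sup>+\<^sup>p\<^sup>-\<^sup>n\<close>, which tends to zero with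
  \<open>R\<close> because \<open>\<alpha> > - p\<close> (\<open>nonzero_at_origin_supercritical\<close>).  In both cases \<open>r\<^sup>2\<close> is first replaced by
  \<open>r\<^sup>2 + \<epsilon>\<^sup>2\<close>, which makes \<open>w\<close> smooth (\<open>origin_barrier\<close>).

  The facts on Sobolev functions that this needs all rest on mollification: weak gradients are unique,
  a continuous function with a weak gradient obeys the \<open>C\<^sup>1\<close> chain rule, and a compactly supported
  function of class \<open>W\<^sup>1\<^sup>,\<^sup>p\<close> is a limit of test functions.
\<close>

section \<open>Smooth functions and a bump\<close>

lemma GDERIV_imp_frechet_derivative:
  fixes f :: "'a::euclidean_space \<Rightarrow> real"
  assumes "GDERIV f x :> D"
  shows "f differentiable (at x)" "frechet_derivative f (at x) b = D \<bullet> b" "grad f x = D"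
proof -
  from assms have d: "(f has_derivative (\<lambda>h. h \<bullet> D)) (at x)" by (simp add: gderiv_def)
  then show "f differentiable (at x)" by (auto simp: differentiable_def)
  have e: "frechet_derivative f (at x) = (\<lambda>h. h \<bullet> D)"
    using frechet_derivative_at[OF d] by simp
  show "frechet_derivative f (at x) b = D \<bullet> b" by (simp add: e inner_commute)
  show "grad f x = D"
    unfolding grad_def e by (subst (2) euclidean_representation[symmetric]) (simp add: inner_commute)
qed

lemma GDERIV_grad:
  fixes f :: "'a::euclidean_space \<Rightarrow> real"
  assumes "f differentiable (at x)"
  shows "GDERIV f x :> grad f x"
proof -
  have d: "(f has_derivative frechet_derivative f (at x)) (at x)"
    using assms frechet_derivative_works by blast
  interpret bounded_linear "frechet_derivative f (at x)"
    using d by (rule has_derivative_bounded_linear)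
  have "frechet_derivative f (at x) h = h \<bullet> grad f x" for h
  proof -
    have "frechet_derivative f (at x) h = frechet_derivative f (at x) (\<Sum>b\<in>Basis. (h \<bullet> b) *\<^sub>R b)"
      by (simp add: euclidean_representation)
    also have "\<dots> = (\<Sum>b\<in>Basis. (h \<bullet> b) * frechet_derivative f (at x) b)"
      by (simp add: sum scaleR)
    also have "\<dots> = h \<bullet> grad f x"
      by (simp add: grad_def inner_sum_right mult.commute)
    finally show ?thesis .
  qed
  then have "frechet_derivative f (at x) = (\<lambda>h. h \<bullet> grad f x)" by blast
  then show ?thesis using d by (simp add: gderiv_def)
qed

lemma grad_inner_Basis: "b \<in> Basis \<Longrightarrow> grad f x \<bullet> b = frechet_derivative f (at x) b"
  by (simp add: grad_def inner_sum_left inner_Basis if_distrib cong: if_cong)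

lemma C_class_SucI:
  fixes f :: "'a::euclidean_space \<Rightarrow> real"
  assumes "\<And>x. GDERIV f x :> D x" "\<And>b. b \<in> Basis \<Longrightarrow> C_class k (\<lambda>x. D x \<bullet> b)"
  shows "C_class (Suc k) f"
  using assms GDERIV_imp_frechet_derivative[OF assms(1)] by (simp add: )

lemma C_class_Suc_iff:
  fixes f :: "'a::euclidean_space \<Rightarrow> real"
  shows "C_class (Suc k) f \<longleftrightarrow> (\<forall>x. GDERIV f x :> grad f x) \<and> (\<forall>b\<in>Basis. C_class k (\<lambda>x. grad f x \<bullet> b))"
  using GDERIV_grad[of f] GDERIV_imp_frechet_derivative(1)[of f] by (auto simp: grad_inner_Basis)

declare C_class.simps(2) [simp del]

lemma C_class_Suc_lower: "C_class (Suc k) f \<Longrightarrow> C_class k f"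
proof (induction k arbitrary: f)
  case 0
  then show ?case
    by (auto simp: C_class_Suc_iff gderiv_def intro!: continuous_at_imp_continuous_on has_derivative_continuous)
next
  case (Suc k)
  then show ?case by (subst C_class_Suc_iff) (simp add: C_class_Suc_iff[of "Suc k"])
qed

lemma C_class_const: "C_class k (\<lambda>x. c)"
proof (induction k arbitrary: c)
  case (Suc k)
  show ?case by (rule C_class_SucI[where D="\<lambda>x. 0"]) (auto simp: GDERIV_const Suc)
qed simp

lemma C_class_add: "C_class k f \<Longrightarrow> C_class k g \<Longrightarrow> C_class k (\<lambda>x. f x + g x)"
proof (induction k arbitrary: f g)
  case (Suc k)
  show ?case using Suc
    by (intro C_class_SucI[where D="\<lambda>x. grad f x + grad g x"] GDERIV_add)
       (auto simp: C_class_Suc_iff inner_add_left)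
qed (auto intro: continuous_intros)

lemma C_class_mult: "C_class k f \<Longrightarrow> C_class k g \<Longrightarrow> C_class k (\<lambda>x. f x * g x)"
proof (induction k arbitrary: f g)
  case (Suc k)
  show ?case using Suc.prems C_class_Suc_lower[OF Suc.prems(1)] C_class_Suc_lower[OF Suc.prems(2)]
    by (intro C_class_SucI[where D="\<lambda>x. f x *\<^sub>R grad g x + g x *\<^sub>R grad f x"] GDERIV_mult)
       (auto simp: C_class_Suc_iff inner_add_left intro!: C_class_add Suc.IH)
qed (auto intro: continuous_intros)

lemma C_class_inner: "C_class k (\<lambda>x. x \<bullet> b)"
proof (cases k)
  case (Suc j)
  show ?thesis unfolding Suc
    by (rule C_class_SucI[where D="\<lambda>x. b"])
      (auto simp: gderiv_def C_class_const intro!: derivative_eq_intros)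
qed (auto intro: continuous_intros)

text \<open>Needed for the reflected and translated kernels \<open>\<lambda>y. \<rho> (x - y)\<close> and for rescaling the bump.\<close>

lemma C_class_affine: "C_class k f \<Longrightarrow> C_class k (\<lambda>y. f (a + c *\<^sub>R y))"
proof (induction k arbitrary: f)
  case (Suc k)
  show ?case
  proof (rule C_class_SucI[where D="\<lambda>y. c *\<^sub>R grad f (a + c *\<^sub>R y)"])
    fix y
    have "((\<lambda>y. f (a + c *\<^sub>R y)) has_derivative (\<lambda>h. (c *\<^sub>R h) \<bullet> grad f (a + c *\<^sub>R y))) (at y)"
      by (rule has_derivative_compose[where g=f])
         (use Suc.prems in \<open>auto simp: C_class_Suc_iff gderiv_def intro!: derivative_eq_intros\<close>)
    then show "GDERIV (\<lambda>y. f (a + c *\<^sub>R y)) y :> c *\<^sub>R grad f (a + c *\<^sub>R y)"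
      by (simp add: gderiv_def)
  next
    fix b :: 'a assume "b \<in> Basis"
    then have "C_class k (\<lambda>y. grad f y \<bullet> b)" using Suc.prems by (simp add: C_class_Suc_iff)
    from Suc.IH[OF this] show "C_class k (\<lambda>x. c *\<^sub>R grad f (a + c *\<^sub>R x) \<bullet> b)"
      using C_class_mult[OF C_class_const] by fastforce
  qed
next
  case 0
  then have "continuous_on UNIV f" by simp
  then have "continuous_on UNIV (\<lambda>y. f (a + c *\<^sub>R y))"
    by (rule continuous_on_compose2) (auto intro!: continuous_intros)
  then show ?case by simp
qed

lemma C_class_continuous: "C_class k f \<Longrightarrow> continuous_on UNIV f"
  by (induction k) (auto dest: C_class_Suc_lower)

lemma C_class_1_GDERIV: "C_class (Suc 0) f \<Longrightarrow> GDERIV f x :> grad f x"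
  by (simp add: C_class_Suc_iff)

lemma C_class_1_continuous_grad: "C_class (Suc 0) f \<Longrightarrow> continuous_on UNIV (grad f)"
  by (subst continuous_on_componentwise) (auto simp: C_class_Suc_iff)

text \<open>The functions \<open>exp (- 1 / t) / t\<^sup>m\<close>, extended by zero, form a family whose span is closed under
  differentiation; carrying the exponent \<open>m\<close> makes smoothness of the bump a plain induction.\<close>

definition flat :: "nat \<Rightarrow> real \<Rightarrow> real" where
  "flat m t = (if 0 < t then exp (- (1 / t)) / t ^ m else 0)"

lemma flat_right_limit: "(flat m \<longlongrightarrow> 0) (at_right 0)"
proof -
  have "((\<lambda>s. s ^ m / exp s) \<longlongrightarrow> (0::real)) at_top" by (rule tendsto_power_div_exp_0)
  then have "((\<lambda>t. (inverse t) ^ m / exp (inverse t)) \<longlongrightarrow> (0::real)) (at_right 0)"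
    by (rule filterlim_compose) (rule filterlim_inverse_at_top_right)
  moreover have "\<forall>\<^sub>F t::real in at_right 0. (inverse t) ^ m / exp (inverse t) = flat m t"
    by (rule eventually_at_rightI[of 0 1]) (auto simp: flat_def field_simps exp_minus)
  ultimately show ?thesis by (rule Lim_transform_eventually)
qed

lemma flat_limit_0: "(flat m \<longlongrightarrow> 0) (at 0)"
proof -
  have "(flat m \<longlongrightarrow> 0) (at_left 0)"
    by (rule Lim_transform_eventually[OF tendsto_const])
       (auto simp: eventually_at_left_field flat_def intro!: exI[of _ "-1"])
  then show ?thesis using flat_right_limit by (simp add: filterlim_split_at)
qed

lemma flat_deriv: "DERIV (flat m) t :> flat (m + 2) t - real m * flat (m + 1) t"
proof -
  consider "t > 0" | "t < 0" | "t = 0" by linarith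
  then show ?thesis
  proof cases
    case 1
    have "DERIV (\<lambda>t. exp (- (1 / t)) * inverse (t ^ m)) t :>
        exp (- (1 / t)) * inverse (t ^ m) * (1 / t\<^sup>2) - exp (- (1 / t)) * (real m * t ^ (m - 1) * inverse (t ^ m) * inverse (t ^ m))"
      using 1 by (auto intro!: derivative_eq_intros simp: power2_eq_square)
    moreover have "real m * t ^ (m - 1) * inverse (t ^ m) = real m / t"
      using 1 by (cases m) (auto simp: field_simps)
    moreover have "exp (- (1 / t)) * inverse (t ^ m) * (1 / t\<^sup>2) - exp (- (1 / t)) * ((real m / t) * inverse (t ^ m))
        = flat (m + 2) t - real m * flat (m + 1) t"
      using 1 by (simp add: flat_def divide_inverse power_add power2_eq_square mult_ac)
    ultimately have "DERIV (\<lambda>t. exp (- (1 / t)) * inverse (t ^ m)) t :>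
        flat (m + 2) t - real m * flat (m + 1) t"
      by simp
    then have "DERIV (\<lambda>t. exp (- (1 / t)) / t ^ m) t :> flat (m + 2) t - real m * flat (m + 1) t"
      by (simp add: divide_inverse)
    then show ?thesis
      by (rule has_field_derivative_transform_within_open[where S="{0<..}"]) (use 1 in \<open>auto simp: flat_def\<close>)
  next
    case 2
    have "DERIV (\<lambda>t::real. 0) t :> flat (m + 2) t - real m * flat (m + 1) t"
      using 2 by (auto simp: flat_def)
    then show ?thesis
      by (rule has_field_derivative_transform_within_open[where S="{..<0}"]) (use 2 in \<open>auto simp: flat_def\<close>)
  next
    case 3
    have "flat (Suc m) h = (flat m (0 + h) - flat m 0) / h" for h
      by (simp add: flat_def)
    then have "flat (Suc m) = (\<lambda>h. (flat m (0 + h) - flat m 0) / h)" by blast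
    then have "((\<lambda>h. (flat m (0 + h) - flat m 0) / h) \<longlongrightarrow> 0) (at 0)"
      using flat_limit_0[of "Suc m"] by metis
    then show ?thesis using 3 by (simp add: DERIV_def flat_def)
  qed
qed

definition bump :: "'a::euclidean_space \<Rightarrow> real" where
  "bump x = flat 0 (1 - x \<bullet> x)"

lemma C_class_flat: "C_class k (\<lambda>x::'a::euclidean_space. flat m (1 - x \<bullet> x))"
proof (induction k arbitrary: m)
  case 0
  have "continuous_on UNIV (flat m)" by (meson DERIV_continuous_on flat_deriv has_field_derivative_at_within)
  then have "continuous_on UNIV (\<lambda>x::'a. flat m (1 - x \<bullet> x))"
    by (rule continuous_on_compose2) (auto intro!: continuous_intros)
  then show ?case by simp
next
  case (Suc k)
  show ?case
  proof (rule C_class_SucI)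
    fix x :: 'a
    have "GDERIV (\<lambda>x. 1 - x \<bullet> x) x :> (-2) *\<^sub>R x"
      unfolding gderiv_def by (auto intro!: derivative_eq_intros simp: inner_commute)
    then show "GDERIV (\<lambda>x. flat m (1 - x \<bullet> x)) x :>
        (flat (m + 2) (1 - x \<bullet> x) - real m * flat (m + 1) (1 - x \<bullet> x)) *\<^sub>R (-2) *\<^sub>R x"
      by (rule GDERIV_DERIV_compose) (rule flat_deriv)
  next
    fix b :: 'a
    have "C_class k (\<lambda>x::'a. (flat (m + 2) (1 - x \<bullet> x) + (- real m) * flat (m + 1) (1 - x \<bullet> x)) * ((-2) * (x \<bullet> b)))"
      by (intro C_class_mult C_class_add C_class_const C_class_inner Suc)
    then show "C_class k (\<lambda>x. ((flat (m + 2) (1 - x \<bullet> x) - real m * flat (m + 1) (1 - x \<bullet> x)) *\<^sub>R (-2) *\<^sub>R x) \<bullet> b)"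
      by (simp add: algebra_simps)
  qed
qed

lemma bump_nonneg: "0 \<le> bump x" by (simp add: bump_def flat_def)

lemma bump_pos_iff: "0 < bump x \<longleftrightarrow> norm x < 1"
  by (simp add: bump_def flat_def power2_norm_eq_inner[symmetric] abs_square_less_1)

lemma bump_eq_0: "1 \<le> norm x \<Longrightarrow> bump x = 0"
  using bump_pos_iff[of x] bump_nonneg[of x] by linarith

section \<open>Integration by parts and convolution\<close>

lemma integral_lborel_translation:
  fixes f :: "'a::euclidean_space \<Rightarrow> 'b::{banach, second_countable_topology}"
  assumes "f \<in> borel_measurable borel"
  shows "(LINT x|lborel. f (a + x)) = (LINT x|lborel. f x)"
proof -
  have "(LINT x|lborel. f x) = (LINT x|distr lborel borel ((+) a). f x)"
    by (simp add: lborel_distr_plus)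
  also have "\<dots> = (LINT x|lborel. f (a + x))"
    using assms by (subst integral_distr) auto
  finally show ?thesis by simp
qed

lemma lborel_distr_reflect: "distr lborel borel (\<lambda>y::'a::euclidean_space. x - y) = lborel"
  using lborel_affine[of "-1" x] by (simp add: density_1)

lemma integral_lborel_reflect:
  fixes f :: "'a::euclidean_space \<Rightarrow> 'b::{banach, second_countable_topology}"
  assumes "f \<in> borel_measurable borel"
  shows "(LINT y|lborel. f (x - y)) = (LINT y|lborel. f y)"
proof -
  have "(LINT y|lborel. f y) = (LINT y|distr lborel borel (\<lambda>y. x - y). f y)"
    by (simp add: lborel_distr_reflect)
  also have "\<dots> = (LINT y|lborel. f (x - y))"
    using assms by (subst integral_distr) auto
  finally show ?thesis by simp
qed

lemma norm_integral_le:
  fixes f :: "'a \<Rightarrow> 'b::{banach, second_countable_topology}"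
  assumes "integrable M f" "integrable M g" "\<And>x. norm (f x) \<le> g x"
  shows "norm (LINT x|M. f x) \<le> (LINT x|M. g x)"
  using assms by (intro order_trans[OF integral_norm_bound integral_mono]) auto

lemma compactly_supported_bounded:
  fixes f :: "'a::euclidean_space \<Rightarrow> 'b::real_normed_vector"
  assumes "continuous_on UNIV f" "\<And>x. norm x \<ge> R \<Longrightarrow> f x = 0"
  obtains B where "0 < B" "\<And>x. norm (f x) \<le> B"
proof -
  have "bounded (f ` cball 0 R)"
    by (intro compact_imp_bounded compact_continuous_image)
       (auto intro: continuous_on_subset[OF assms(1)])
  then obtain B where B: "0 < B" "\<forall>y \<in> f ` cball 0 R. norm y \<le> B"
    using bounded_pos by metis
  have "norm (f x) \<le> B" for x
    by (cases "norm x \<le> R") (use B assms(2)[of x] in auto)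
  with B(1) show ?thesis using that by blast
qed

lemma compactly_supported_integrable:
  fixes f :: "'a::euclidean_space \<Rightarrow> 'b::euclidean_space"
  assumes "continuous_on UNIV f" "\<And>x. norm x \<ge> R \<Longrightarrow> f x = 0"
  shows "integrable lborel f"
proof -
  have "integrable lborel (\<lambda>x. indicator (cball 0 R) x *\<^sub>R f x)"
    by (rule borel_integrable_compact) (auto intro: continuous_on_subset[OF assms(1)])
  moreover have "(\<lambda>x. indicator (cball 0 R) x *\<^sub>R f x) = f"
    using assms(2) by (auto simp: fun_eq_iff indicator_def)
  ultimately show ?thesis by simp
qed

lemma GDERIV_unique:
  fixes f :: "'a::euclidean_space \<Rightarrow> real"
  assumes "GDERIV f x :> D" "GDERIV f x :> E"
  shows "D = E"
  using assms GDERIV_imp_frechet_derivative(3) by metis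

lemma GDERIV_transform_open:
  fixes f :: "'a::euclidean_space \<Rightarrow> real"
  assumes "GDERIV f x :> D" "open S" "x \<in> S" "\<And>y. y \<in> S \<Longrightarrow> f y = g y"
  shows "GDERIV g x :> D"
  using assms unfolding gderiv_def
  by (metis has_derivative_transform_within_open)

lemma GDERIV_zero_outside:
  fixes f :: "'a::euclidean_space \<Rightarrow> real"
  assumes "\<And>x. norm x \<ge> R \<Longrightarrow> f x = 0" "norm x > R" "GDERIV f x :> D"
  shows "D = 0"
proof -
  have "GDERIV (\<lambda>x. 0) x :> D"
    by (rule GDERIV_transform_open[OF assms(3), of "- cball 0 R"])
       (use assms in \<open>auto simp: open_Compl\<close>)
  then show ?thesis using GDERIV_const GDERIV_unique by blast
qed

lemma GDERIV_Lipschitz: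
  fixes f :: "'a::euclidean_space \<Rightarrow> real"
  assumes "\<And>x. GDERIV f x :> D x" "\<And>x. norm (D x) \<le> B"
  shows "\<bar>f x - f y\<bar> \<le> B * norm (x - y)"
proof -
  have "norm (f x - f y) \<le> B * norm (x - y)"
  proof (rule differentiable_bound[where S=UNIV and f'="\<lambda>x h. h \<bullet> D x"])
    show "(f has_derivative (\<lambda>h. h \<bullet> D x)) (at x within UNIV)" for x
      using assms(1) by (simp add: gderiv_def)
    show "onorm (\<lambda>h. h \<bullet> D x) \<le> B" for x
    proof (rule onorm_le)
      fix h show "norm (h \<bullet> D x) \<le> B * norm h"
        using Cauchy_Schwarz_ineq2[of h "D x"] assms(2)[of x]
        by (smt (verit) mult.commute mult_left_mono norm_ge_zero real_norm_def)
    qed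
  qed auto
  then show ?thesis by simp
qed

lemma GDERIV_directional:
  fixes f :: "'a::euclidean_space \<Rightarrow> real"
  assumes "GDERIV f x :> D"
  shows "((\<lambda>t. (f (t *\<^sub>R b + x) - f x) / t) \<longlongrightarrow> b \<bullet> D) (at 0)"
proof -
  have "((\<lambda>t. f (t *\<^sub>R b + x)) has_derivative (\<lambda>t. (t *\<^sub>R b) \<bullet> D)) (at 0)"
    by (rule has_derivative_compose[where g=f])
       (use assms in \<open>auto simp: gderiv_def intro!: derivative_eq_intros\<close>)
  then have "DERIV (\<lambda>t. f (t *\<^sub>R b + x)) 0 :> b \<bullet> D"
    by (simp add: has_field_derivative_def mult.commute[of "b \<bullet> D"] cong: if_cong) (simp add: mult_commute_abs)
  then show ?thesis by (simp add: DERIV_def)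
qed

text \<open>The integral of \<open>f (x + t b)\<close> does not depend on \<open>t\<close>; difference quotients in direction \<open>b\<close> therefore have
  integral zero, and they converge boundedly to the directional derivative.\<close>

lemma integral_gradient_zero:
  fixes f :: "'a::euclidean_space \<Rightarrow> real"
  assumes d: "\<And>x. GDERIV f x :> D x" and c: "continuous_on UNIV D"
    and z: "\<And>x. norm x \<ge> R \<Longrightarrow> f x = 0"
  shows "(LINT x|lborel. b \<bullet> D x) = 0"
proof -
  have zD: "D x = 0" if "norm x \<ge> R + 1" for x
    by (rule GDERIV_zero_outside[OF z _ d]) (use that in auto)
  obtain B where B: "0 < B" "\<And>x. norm (D x) \<le> B"
    using compactly_supported_bounded[OF c zD] by blast
  have cf: "continuous_on UNIV f"
    using d by (auto simp: gderiv_def intro!: continuous_at_imp_continuous_on has_derivative_continuous)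
  have [measurable]: "f \<in> borel_measurable borel" by (intro borel_measurable_continuous_onI cf)
  have fi: "integrable lborel f" by (rule compactly_supported_integrable[OF cf z])
  define s where "s n x = (f ((1 / real (Suc n)) *\<^sub>R b + x) - f x) / (1 / real (Suc n))" for n :: nat and x
  have s0: "integral\<^sup>L lborel (s n) = 0" for n
  proof -
    have i: "integrable lborel (\<lambda>x. f ((1 / real (Suc n)) *\<^sub>R b + x))"
    proof (rule compactly_supported_integrable)
      show "continuous_on UNIV (\<lambda>x. f ((1 / real (Suc n)) *\<^sub>R b + x))"
        by (rule continuous_on_compose2[OF cf]) (auto intro!: continuous_intros)
      fix x :: 'a assume "norm x \<ge> R + norm ((1 / real (Suc n)) *\<^sub>R b)"
      then have "norm ((1 / real (Suc n)) *\<^sub>R b + x) \<ge> R"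
        using norm_diff_ineq[of x "(1 / real (Suc n)) *\<^sub>R b"] by (simp add: add.commute)
      then show "f ((1 / real (Suc n)) *\<^sub>R b + x) = 0" by (rule z)
    qed
    have "(LINT x|lborel. f ((1 / real (Suc n)) *\<^sub>R b + x) - f x) = 0"
      using i fi integral_lborel_translation[of f] by simp
    then show ?thesis unfolding s_def by simp
  qed
  have "(\<lambda>n. integral\<^sup>L lborel (s n)) \<longlonglongrightarrow> (LINT x|lborel. b \<bullet> D x)"
  proof (rule integral_dominated_convergence[where w="\<lambda>x. (B * norm b) * indicator (cball 0 (R + norm b)) x"])
    show "(\<lambda>x. b \<bullet> D x) \<in> borel_measurable lborel"
      using c by (auto intro!: borel_measurable_continuous_onI continuous_intros)
    show "s n \<in> borel_measurable lborel" for n unfolding s_def by measurable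
    show "integrable lborel (\<lambda>x. B * norm b * indicator (cball 0 (R + norm b)) x)"
      using emeasure_lborel_cball_finite by (auto intro!: integrable_mult_right integrable_real_indicator)
    show "AE x in lborel. (\<lambda>n. s n x) \<longlonglongrightarrow> b \<bullet> D x"
    proof (rule AE_I2)
      fix x
      have "filterlim (\<lambda>n. 1 / real (Suc n)) (at 0) sequentially"
        unfolding filterlim_at using LIMSEQ_inverse_real_of_nat by (auto simp: inverse_eq_divide)
      from filterlim_compose[OF GDERIV_directional[OF d[of x], of b] this]
      show "(\<lambda>n. s n x) \<longlonglongrightarrow> b \<bullet> D x" by (simp add: s_def)
    qed
    show "AE x in lborel. norm (s n x) \<le> B * norm b * indicator (cball 0 (R + norm b)) x" for n
    proof (rule AE_I2)
      fix x
      show "norm (s n x) \<le> B * norm b * indicator (cball 0 (R + norm b)) x"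
      proof (cases "norm x \<le> R + norm b")
        case True
        have "\<bar>f ((1 / real (Suc n)) *\<^sub>R b + x) - f x\<bar> \<le> B * norm ((1 / real (Suc n)) *\<^sub>R b)"
          using GDERIV_Lipschitz[OF d B(2), of "(1 / real (Suc n)) *\<^sub>R b + x" x] by simp
        from mult_right_mono[OF this, of "real (Suc n)"]
        have "norm (s n x) \<le> B * norm b" by (simp add: s_def abs_mult del: of_nat_Suc)
        then show ?thesis using True by simp
      next
        case False
        have "norm ((1 / real (Suc n)) *\<^sub>R b) \<le> norm b"
          by (simp add: divide_le_eq mult_le_cancel_left1)
        then have "norm ((1 / real (Suc n)) *\<^sub>R b + x) \<ge> R"
          using False norm_diff_ineq[of x "(1 / real (Suc n)) *\<^sub>R b"] by (simp add: add.commute)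
        moreover have "norm x \<ge> R" using False norm_ge_zero[of b] by linarith
        ultimately have "f ((1 / real (Suc n)) *\<^sub>R b + x) = 0" "f x = 0" by (auto intro: z)
        then show ?thesis unfolding s_def using False by simp
      qed
    qed
  qed
  then show ?thesis by (simp add: s0 LIMSEQ_const_iff)
qed

definition conv :: "('a::euclidean_space \<Rightarrow> real) \<Rightarrow> ('a \<Rightarrow> 'b::euclidean_space) \<Rightarrow> 'a \<Rightarrow> 'b" where
  "conv \<rho> f x = (LINT y|lebesgue. \<rho> (x - y) *\<^sub>R f y)"

lemma borel_measurable_lebesgue_continuous:
  "continuous_on UNIV f \<Longrightarrow> f \<in> borel_measurable (lebesgue :: 'a::euclidean_space measure)"
  by (intro measurable_completion) (simp add: borel_measurable_continuous_onI)

lemma conv_kernel_integrable: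
  fixes \<rho> :: "'a::euclidean_space \<Rightarrow> 'b::euclidean_space" and f :: "'a \<Rightarrow> real"
  assumes "continuous_on UNIV \<rho>" "\<And>x. norm (\<rho> x) \<le> B" "integrable lebesgue f"
  shows "integrable lebesgue (\<lambda>y. f y *\<^sub>R \<rho> (x - y))"
proof (rule Bochner_Integration.integrable_bound)
  show "integrable lebesgue (\<lambda>y. B * f y)" using assms(3) by simp
  have "continuous_on UNIV (\<lambda>y. \<rho> (x - y))"
    by (rule continuous_on_compose2[OF assms(1)]) (auto intro!: continuous_intros)
  then have [measurable]: "(\<lambda>y. \<rho> (x - y)) \<in> borel_measurable lebesgue"
    by (rule borel_measurable_lebesgue_continuous)
  have [measurable]: "f \<in> borel_measurable lebesgue" using assms(3) by auto
  show "(\<lambda>y. f y *\<^sub>R \<rho> (x - y)) \<in> borel_measurable lebesgue" by measurable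
  have "B \<ge> 0" using assms(2)[of 0] norm_ge_zero order_trans by blast
  then show "AE y in lebesgue. norm (f y *\<^sub>R \<rho> (x - y)) \<le> norm (B * f y)"
    using assms(2) by (auto simp: abs_mult mult.commute[of B] intro!: mult_left_mono AE_I2)
qed

lemma conv_integrable:
  fixes \<rho> :: "'a::euclidean_space \<Rightarrow> real" and f :: "'a \<Rightarrow> 'b::euclidean_space"
  assumes "continuous_on UNIV \<rho>" "\<And>x. \<bar>\<rho> x\<bar> \<le> B" "integrable lebesgue f"
  shows "integrable lebesgue (\<lambda>y. \<rho> (x - y) *\<^sub>R f y)"
proof (rule Bochner_Integration.integrable_bound)
  show "integrable lebesgue (\<lambda>y. B *\<^sub>R f y)" using assms(3) by simp
  have "continuous_on UNIV (\<lambda>y. \<rho> (x - y))"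
    by (rule continuous_on_compose2[OF assms(1)]) (auto intro!: continuous_intros)
  then have [measurable]: "(\<lambda>y. \<rho> (x - y)) \<in> borel_measurable lebesgue"
    by (rule borel_measurable_lebesgue_continuous)
  have [measurable]: "f \<in> borel_measurable lebesgue" using assms(3) by auto
  show "(\<lambda>y. \<rho> (x - y) *\<^sub>R f y) \<in> borel_measurable lebesgue" by measurable
  have "B \<ge> 0" using assms(2)[of 0] by linarith
  then show "AE y in lebesgue. norm (\<rho> (x - y) *\<^sub>R f y) \<le> norm (B *\<^sub>R f y)"
    using assms(2) by (auto intro!: mult_right_mono AE_I2)
qed

lemma compactly_supported_uniformly_continuous:
  fixes f :: "'a::euclidean_space \<Rightarrow> 'b::real_normed_vector"
  assumes "continuous_on UNIV f" "\<And>x. norm x \<ge> R \<Longrightarrow> f x = 0" "e > 0"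
  obtains d where "0 < d" "\<And>x y. norm (x - y) < d \<Longrightarrow> norm (f x - f y) < e"
proof -
  have "uniformly_continuous_on (cball 0 (R + 1)) f"
    by (rule compact_uniformly_continuous) (auto intro: continuous_on_subset[OF assms(1)])
  then obtain d where d: "d > 0" "\<And>x y. x \<in> cball 0 (R+1) \<Longrightarrow> y \<in> cball 0 (R+1) \<Longrightarrow> dist y x < d \<Longrightarrow> dist (f y) (f x) < e"
    using assms(3) unfolding uniformly_continuous_on_def by metis
  show ?thesis
  proof (rule that[of "min d 1"])
    fix x y :: 'a assume xy: "norm (x - y) < min d 1"
    show "norm (f x - f y) < e"
    proof (cases "norm x \<le> R + 1 \<and> norm y \<le> R + 1")
      case True then show ?thesis using d(2)[of y x] xy by (simp add: dist_norm)
    next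
      case False
      have "norm x \<le> norm y + norm (x - y)" "norm y \<le> norm x + norm (x - y)"
        using norm_triangle_sub[of x y] norm_triangle_sub[of y x] by (auto simp: norm_minus_commute)
      then have "norm x \<ge> R" "norm y \<ge> R" using False xy by auto
      then show ?thesis using assms by simp
    qed
  qed (use d in auto)
qed

lemma conv_continuous:
  fixes \<rho> :: "'a::euclidean_space \<Rightarrow> real" and f :: "'a \<Rightarrow> 'b::euclidean_space"
  assumes "continuous_on UNIV \<rho>" "\<And>x. norm x \<ge> R \<Longrightarrow> \<rho> x = 0" "integrable lebesgue f"
  shows "continuous_on UNIV (conv \<rho> f)"
proof -
  obtain B where B: "0 < B" "\<And>x. norm (\<rho> x) \<le> B"
    using compactly_supported_bounded[OF assms(1,2)] by blast
  define M where "M = (LINT y|lebesgue. norm (f y))"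
  have M: "M \<ge> 0" by (auto simp: M_def)
  note ci = conv_integrable[OF assms(1) B(2)[unfolded real_norm_def] assms(3)]
  show ?thesis
    unfolding continuous_on_iff
  proof (intro ballI allI impI)
    fix x :: 'a and e :: real assume e: "0 < e"
    obtain d where d: "0 < d" "\<And>x y. norm (x - y) < d \<Longrightarrow> norm (\<rho> x - \<rho> y) < e / (M + 1)"
      by (rule compactly_supported_uniformly_continuous[OF assms(1,2), of R "e / (M+1)"]) (use e M in auto)
    have "dist (conv \<rho> f x') (conv \<rho> f x) < e" if "dist x' x < d" for x'
    proof -
      have "norm (conv \<rho> f x' - conv \<rho> f x) = norm (LINT y|lebesgue. (\<rho> (x' - y) - \<rho> (x - y)) *\<^sub>R f y)"
        using ci by (simp add: conv_def scaleR_diff_left)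
      also have "\<dots> \<le> (LINT y|lebesgue. (e / (M + 1)) * norm (f y))"
      proof (rule norm_integral_le)
        show "integrable lebesgue (\<lambda>y. (\<rho> (x' - y) - \<rho> (x - y)) *\<^sub>R f y)"
          using ci by (simp add: scaleR_diff_left)
        show "integrable lebesgue (\<lambda>y. e / (M + 1) * norm (f y))" using assms(3) by simp
        fix y
        have "norm (\<rho> (x' - y) - \<rho> (x - y)) < e / (M + 1)"
          by (rule d(2)) (use that in \<open>simp add: dist_norm\<close>)
        then show "norm ((\<rho> (x' - y) - \<rho> (x - y)) *\<^sub>R f y) \<le> e / (M + 1) * norm (f y)"
          unfolding norm_scaleR real_norm_def by (intro mult_right_mono) auto
      qed
      also have "\<dots> = e * (M / (M + 1))" by (simp add: M_def[symmetric])
      also have "\<dots> < e * 1" using e M by (intro mult_strict_left_mono) auto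
      also have "\<dots> = e" by simp
      finally show ?thesis by (simp add: dist_norm)
    qed
    then show "\<exists>d>0. \<forall>x'\<in>UNIV. dist x' x < d \<longrightarrow> dist (conv \<rho> f x') (conv \<rho> f x) < e"
      using d(1) by blast
  qed
qed

text \<open>The first order Taylor remainder of the kernel is \<open>o(|h|)\<close> uniformly in its base point, because the
  gradient of a compactly supported \<open>C\<^sup>1\<close> kernel is uniformly continuous.\<close>

lemma conv_GDERIV:
  fixes \<rho> :: "'a::euclidean_space \<Rightarrow> real" and f :: "'a \<Rightarrow> real"
  assumes d: "\<And>x. GDERIV \<rho> x :> D x" and c: "continuous_on UNIV D"
    and z: "\<And>x. norm x \<ge> R \<Longrightarrow> \<rho> x = 0" and f: "integrable lebesgue f"
  shows "GDERIV (conv \<rho> f) x :> (LINT y|lebesgue. f y *\<^sub>R D (x - y))"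
proof -
  have zD: "D x = 0" if "norm x \<ge> R + 1" for x
    by (rule GDERIV_zero_outside[OF z _ d]) (use that in auto)
  obtain B where B: "0 < B" "\<And>x. norm (D x) \<le> B"
    using compactly_supported_bounded[OF c zD] by blast
  have cr: "continuous_on UNIV \<rho>"
    using d by (auto simp: gderiv_def intro!: continuous_at_imp_continuous_on has_derivative_continuous)
  obtain B' where B': "0 < B'" "\<And>x. norm (\<rho> x) \<le> B'"
    using compactly_supported_bounded[OF cr z] by blast
  note ci = conv_integrable[OF cr B'(2)[unfolded real_norm_def] f]
  note di = conv_kernel_integrable[OF c B(2) f]
  define M where "M = (LINT y|lebesgue. norm (f y))"
  have M: "M \<ge> 0" by (auto simp: M_def)
  have taylor: "\<bar>\<rho> (w + h) - \<rho> w - h \<bullet> D w\<bar> \<le> norm h * e"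
    if dl: "\<And>x y. norm (x - y) < \<delta> \<Longrightarrow> norm (D x - D y) < e" and h: "norm h < \<delta>" for w h e \<delta>
  proof -
    have "norm (\<rho> (w + h) - \<rho> w - (\<lambda>h. h \<bullet> D w) ((w + h) - w)) \<le> norm ((w + h) - w) * e"
    proof (rule differentiable_bound_linearization[where S="ball w \<delta>" and f'="\<lambda>x h. h \<bullet> D x"])
      fix t :: real assume "t \<in> {0..1}"
      then have "norm (t *\<^sub>R h) \<le> norm h" by (auto intro: mult_left_le_one_le)
      then show "w + t *\<^sub>R (w + h - w) \<in> ball w \<delta>" using h by (simp add: dist_norm)
    next
      fix x show "(\<rho> has_derivative (\<lambda>h. h \<bullet> D x)) (at x within ball w \<delta>)"
        using d[of x] by (simp add: gderiv_def has_derivative_at_withinI)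
    next
      fix x assume "x \<in> ball w \<delta>"
      then have l: "norm (D x - D w) < e" by (intro dl) (simp add: dist_norm norm_minus_commute)
      show "onorm ((\<lambda>h. h \<bullet> D x) - (\<lambda>h. h \<bullet> D w)) \<le> e"
      proof (rule onorm_le)
        fix k
        have "\<bar>k \<bullet> (D x - D w)\<bar> \<le> norm k * norm (D x - D w)" by (rule Cauchy_Schwarz_ineq2)
        also have "\<dots> \<le> norm k * e" using l by (intro mult_left_mono) auto
        finally show "norm (((\<lambda>h. h \<bullet> D x) - (\<lambda>h. h \<bullet> D w)) k) \<le> e * norm k"
          by (simp add: inner_diff_right mult.commute)
      qed
    next
      show "w \<in> ball w \<delta>" using h norm_ge_zero[of h] by (simp only: centre_in_ball)
    qed
    then show ?thesis by simp
  qed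
  have "(conv \<rho> f has_derivative (\<lambda>h. h \<bullet> (LINT y|lebesgue. f y *\<^sub>R D (x - y)))) (at x)"
    unfolding has_derivative_at_alt
  proof (intro conjI allI impI)
    show "bounded_linear (\<lambda>h. h \<bullet> (LINT y|lebesgue. f y *\<^sub>R D (x - y)))"
      by (rule bounded_linear_inner_left)
    fix e :: real assume e: "0 < e"
    obtain \<delta> where \<delta>: "0 < \<delta>" "\<And>x y. norm (x - y) < \<delta> \<Longrightarrow> norm (D x - D y) < e / (M + 1)"
      by (rule compactly_supported_uniformly_continuous[OF c zD, where e="e / (M+1)"]) (use e M in auto)
    have "norm (conv \<rho> f x' - conv \<rho> f x - (x' - x) \<bullet> (LINT y|lebesgue. f y *\<^sub>R D (x - y))) \<le> e * norm (x' - x)"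
      if "norm (x' - x) < \<delta>" for x'
    proof -
      let ?r = "\<lambda>y. (\<rho> (x' - y) - \<rho> (x - y) - (x' - x) \<bullet> D (x - y)) * f y"
      have i2: "integrable lebesgue (\<lambda>y. (x' - x) \<bullet> (f y *\<^sub>R D (x - y)))"
        using di by (intro integrable_inner_right) auto
      have eq: "?r = (\<lambda>y. \<rho> (x' - y) *\<^sub>R f y - \<rho> (x - y) *\<^sub>R f y - (x' - x) \<bullet> (f y *\<^sub>R D (x - y)))"
        by (auto simp: fun_eq_iff algebra_simps)
      have ir: "integrable lebesgue ?r" unfolding eq by (intro Bochner_Integration.integrable_diff ci i2)
      have "(LINT y|lebesgue. (x' - x) \<bullet> (f y *\<^sub>R D (x - y))) = (x' - x) \<bullet> (LINT y|lebesgue. f y *\<^sub>R D (x - y))"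
        using di by (intro integral_inner_right) auto
      moreover have "(LINT y|lebesgue. ?r y) = conv \<rho> f x' - conv \<rho> f x - (LINT y|lebesgue. (x' - x) \<bullet> (f y *\<^sub>R D (x - y)))"
        unfolding eq conv_def
        by (subst Bochner_Integration.integral_diff; (intro Bochner_Integration.integrable_diff ci i2)?)
           (subst Bochner_Integration.integral_diff; (intro ci)?; simp)
      ultimately have "norm (conv \<rho> f x' - conv \<rho> f x - (x' - x) \<bullet> (LINT y|lebesgue. f y *\<^sub>R D (x - y))) = norm (LINT y|lebesgue. ?r y)"
        by simp
      also have "\<dots> \<le> (LINT y|lebesgue. (norm (x' - x) * (e / (M + 1))) * norm (f y))"
      proof (rule norm_integral_le[OF ir])
        show "integrable lebesgue (\<lambda>y. norm (x' - x) * (e / (M + 1)) * norm (f y))" using f by simp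
        fix y
        have "\<bar>\<rho> (x' - y) - \<rho> (x - y) - (x' - x) \<bullet> D (x - y)\<bar> \<le> norm (x' - x) * (e / (M + 1))"
          using taylor[OF \<delta>(2) that, of "x - y"] by (simp add: algebra_simps)
        then show "norm (?r y) \<le> norm (x' - x) * (e / (M + 1)) * norm (f y)"
          unfolding real_norm_def abs_mult by (intro mult_right_mono) auto
      qed
      also have "\<dots> = (norm (x' - x) * e) * (M / (M + 1))" by (simp add: M_def)
      also have "\<dots> \<le> (norm (x' - x) * e) * 1" using e M by (intro mult_left_mono) auto
      finally show ?thesis by (simp add: mult.commute)
    qed
    then show "\<exists>d>0. \<forall>y. norm (y - x) < d \<longrightarrow> norm (conv \<rho> f y - conv \<rho> f x - (y - x) \<bullet> (LINT y|lebesgue. f y *\<^sub>R D (x - y))) \<le> e * norm (y - x)"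
      using \<delta>(1) by blast
  qed
  then show ?thesis by (simp add: gderiv_def)
qed

lemma conv_grad_inner:
  fixes D :: "'a::euclidean_space \<Rightarrow> 'a" and f :: "'a \<Rightarrow> real"
  assumes "continuous_on UNIV D" "\<And>x. norm (D x) \<le> B" "integrable lebesgue f"
  shows "(LINT y|lebesgue. f y *\<^sub>R D (x - y)) \<bullet> b = conv (\<lambda>z. D z \<bullet> b) f x"
proof -
  have "integrable lebesgue (\<lambda>y. f y *\<^sub>R D (x - y))" by (rule conv_kernel_integrable[OF assms])
  then have "(LINT y|lebesgue. f y *\<^sub>R D (x - y)) \<bullet> b = (LINT y|lebesgue. (f y *\<^sub>R D (x - y)) \<bullet> b)"
    by (intro integral_inner_left[symmetric]) auto
  then show ?thesis by (simp add: conv_def mult.commute)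
qed

lemma C_class_conv:
  fixes \<rho> :: "'a::euclidean_space \<Rightarrow> real" and f :: "'a \<Rightarrow> real"
  assumes "C_class k \<rho>" "\<And>x. norm x \<ge> R \<Longrightarrow> \<rho> x = 0" "integrable lebesgue f"
  shows "C_class k (conv \<rho> f)"
  using assms(1,2)
proof (induction k arbitrary: \<rho> R)
  case 0
  then show ?case using conv_continuous[OF _ 0(2) assms(3)] by simp
next
  case (Suc k)
  have g: "\<And>x. GDERIV \<rho> x :> grad \<rho> x" using Suc.prems(1) by (simp add: C_class_Suc_iff)
  have cg: "continuous_on UNIV (grad \<rho>)"
    by (subst continuous_on_componentwise) (use Suc.prems(1) in \<open>auto simp: C_class_Suc_iff dest: C_class_continuous\<close>)
  have zD: "grad \<rho> x = 0" if "norm x \<ge> R + 1" for x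
    by (rule GDERIV_zero_outside[OF Suc.prems(2) _ g]) (use that in auto)
  obtain B where B: "0 < B" "\<And>x. norm (grad \<rho> x) \<le> B"
    using compactly_supported_bounded[OF cg zD] by blast
  show ?case
  proof (rule C_class_SucI)
    show "GDERIV (conv \<rho> f) x :> (LINT y|lebesgue. f y *\<^sub>R grad \<rho> (x - y))" for x
      by (rule conv_GDERIV[OF g cg Suc.prems(2) assms(3)])
    fix b :: 'a assume b: "b \<in> Basis"
    have "C_class k (conv (\<lambda>z. grad \<rho> z \<bullet> b) f)"
      using Suc.prems(1) b zD by (intro Suc.IH[of _ "R + 1"]) (auto simp: C_class_Suc_iff)
    then show "C_class k (\<lambda>x. (LINT y|lebesgue. f y *\<^sub>R grad \<rho> (x - y)) \<bullet> b)"
      by (simp add: conv_grad_inner[OF cg B(2) assms(3)])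
  qed
qed

section \<open>Mollification\<close>

text \<open>Dividing by the integral of the rescaled bump, rather than by a power of \<open>e\<close>, avoids a change of
  variables.\<close>

definition moll :: "real \<Rightarrow> 'a::euclidean_space \<Rightarrow> real" where
  "moll e z = bump ((1 / e) *\<^sub>R z) / (LINT y|lborel. bump ((1 / e) *\<^sub>R (y :: 'a)))"

lemma C_class_bump_scaled: "C_class k (\<lambda>y::'a::euclidean_space. bump ((1 / e) *\<^sub>R y))"
proof -
  have "C_class k (bump :: 'a \<Rightarrow> real)"
    using C_class_flat[of k 0] by (simp add: bump_def[abs_def])
  from C_class_affine[OF this, of 0 "1 / e"] show ?thesis by simp
qed

lemma bump_scaled_eq_0: "0 < e \<Longrightarrow> norm z \<ge> e \<Longrightarrow> bump ((1 / e) *\<^sub>R z) = 0"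
  by (rule bump_eq_0) simp

lemma bump_scaled_integrable: "0 < e \<Longrightarrow> integrable lborel (\<lambda>y::'a::euclidean_space. bump ((1 / e) *\<^sub>R y))"
  by (rule compactly_supported_integrable[where R=e])
     (auto intro: C_class_continuous[OF C_class_bump_scaled] bump_scaled_eq_0)

lemma bump_scaled_integral_pos:
  assumes "0 < e"
  shows "0 < (LINT y|lborel. bump ((1 / e) *\<^sub>R (y :: 'a::euclidean_space)))"
proof (rule ccontr)
  let ?b = "\<lambda>y::'a. bump ((1 / e) *\<^sub>R y)"
  assume "\<not> 0 < integral\<^sup>L lborel ?b"
  moreover have "0 \<le> integral\<^sup>L lborel ?b" by (simp add: bump_nonneg)
  ultimately have "integral\<^sup>L lborel ?b = 0" by linarith
  then have "AE y in lborel. ?b y = 0"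
    using integral_nonneg_eq_0_iff_AE[OF bump_scaled_integrable[OF assms, where 'a='a]] by (simp add: bump_nonneg)
  then have "AE y in lebesgue. y \<in> {y. ?b y = 0}" by (simp add: AE_completion)
  moreover have "closed {y. ?b y = 0}"
    by (intro closed_Collect_eq C_class_continuous[OF C_class_bump_scaled] continuous_on_const)
  ultimately have "(0::'a) \<in> {y. ?b y = 0}" by (rule mem_closed_if_AE_lebesgue[rotated])
  then show False using bump_pos_iff[of "0::'a"] by simp
qed

lemma C_class_moll: "C_class k (moll e)"
  using C_class_mult[OF C_class_bump_scaled C_class_const]
  unfolding moll_def[abs_def] divide_inverse .

lemma moll_nonneg: "0 < e \<Longrightarrow> 0 \<le> moll e z"
  using bump_scaled_integral_pos[of e, where 'a='a] by (simp add: moll_def bump_nonneg)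

lemma moll_eq_0: "0 < e \<Longrightarrow> norm z \<ge> e \<Longrightarrow> moll e z = 0"
  by (simp add: moll_def bump_scaled_eq_0)

lemma moll_continuous: "continuous_on UNIV (moll e)"
  by (rule C_class_continuous[OF C_class_moll])

lemma moll_bounded:
  assumes "0 < e" obtains B where "0 < B" "\<And>z. \<bar>moll e z\<bar> \<le> B"
  by (rule compactly_supported_bounded[OF moll_continuous moll_eq_0[OF assms]]) (auto simp: real_norm_def)

lemma moll_measurable [measurable]: "moll e \<in> borel_measurable borel"
  by (intro borel_measurable_continuous_onI moll_continuous)

lemma moll_integral_lborel: "0 < e \<Longrightarrow> (LINT y|lborel. moll e (x - y)) = 1"
  using bump_scaled_integral_pos[of e, where 'a='a] integral_lborel_reflect[of "moll e" x]
  by (simp add: moll_def)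

lemma moll_reflect_continuous: "continuous_on UNIV (\<lambda>y. moll e (x - y))"
  by (rule continuous_on_compose2[OF moll_continuous]) (auto intro!: continuous_intros)

lemma moll_integral_1: "0 < e \<Longrightarrow> (LINT y|lborel. moll e (y::'a::euclidean_space)) = 1"
  using bump_scaled_integral_pos[of e, where 'a='a] by (simp add: moll_def)

lemma moll_integrable_1: "0 < e \<Longrightarrow> integrable lborel (moll e :: 'a::euclidean_space \<Rightarrow> real)"
  by (rule compactly_supported_integrable[OF moll_continuous moll_eq_0])

lemma moll_integrable_lborel:
  fixes x :: "'a::euclidean_space"
  assumes "0 < e" shows "integrable lborel (\<lambda>y. moll e (x - y))"
proof (rule compactly_supported_integrable[OF moll_reflect_continuous])
  fix y :: 'a assume "norm y \<ge> norm x + e"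
  then have "norm (x - y) \<ge> e" using norm_triangle_ineq2[of y x] by (simp add: norm_minus_commute)
  then show "moll e (x - y) = 0" by (rule moll_eq_0[OF assms])
qed

lemma moll_integrable: "0 < e \<Longrightarrow> integrable lebesgue (\<lambda>y. moll e (x - y))"
  using moll_integrable_lborel[of e x] by (subst integrable_completion) auto

lemma moll_integral: "0 < e \<Longrightarrow> (LINT y|lebesgue. moll e (x - y)) = 1"
  using moll_integral_lborel[of e x] by (subst integral_completion) auto

lemma moll_conv_integrable:
  fixes f :: "'a::euclidean_space \<Rightarrow> 'b::euclidean_space"
  assumes "0 < e" "integrable lebesgue f"
  shows "integrable lebesgue (\<lambda>y. moll e (x - y) *\<^sub>R f y)"
proof -
  obtain B where "\<And>z::'a. \<bar>moll e z\<bar> \<le> B" using moll_bounded[OF assms(1)] by blast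
  then show ?thesis by (rule conv_integrable[OF moll_continuous _ assms(2)])
qed

lemma conv_moll_continuous:
  "0 < e \<Longrightarrow> integrable lebesgue f \<Longrightarrow> continuous_on UNIV (conv (moll e) f)"
  by (rule conv_continuous[OF moll_continuous moll_eq_0])

lemma conv_eq_0:
  assumes "\<And>y. y \<notin> K \<Longrightarrow> f y = 0" "\<And>y. y \<in> K \<Longrightarrow> norm (x - y) \<ge> e" "0 < e"
  shows "conv (moll e) f x = 0"
proof -
  have "moll e (x - y) *\<^sub>R f y = 0" for y
    using assms moll_eq_0[of e "x - y"] by (cases "y \<in> K") auto
  then have "(\<lambda>y. moll e (x - y) *\<^sub>R f y) = (\<lambda>y. 0)" by blast
  then show ?thesis unfolding conv_def by simp
qed

text \<open>The graph of the convex function \<open>t \<mapsto> t\<^sup>p\<close> lies above its tangent at \<open>m\<close>; this is Young's inequality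
  for \<open>t m\<^sup>p\<^sup>-\<^sup>1\<close>.\<close>

lemma powr_tangent:
  fixes t m p :: real
  assumes "p \<ge> 1" "t \<ge> 0" "m > 0"
  shows "m powr p + p * m powr (p - 1) * (t - m) \<le> t powr p"
proof (cases "t = 0")
  case True
  have "m powr (p - 1) * m = m powr p" using assms by (simp add: powr_mult_base powr_diff)
  then have "m powr p + p * m powr (p - 1) * (t - m) = (1 - p) * m powr p"
    using True by (simp add: algebra_simps)
  also have "\<dots> \<le> 0" using assms by (simp add: mult_le_0_iff)
  finally show ?thesis using True by simp
next
  case False
  then have t: "t > 0" using assms by simp
  have "(t powr p) powr (1/p) * (m powr p) powr (1 - 1/p) \<le> (1/p) * t powr p + (1 - 1/p) * m powr p"
    by (rule Youngs_inequality_0) (use assms t in auto)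
  then have "t * m powr (p - 1) \<le> (1/p) * t powr p + (1 - 1/p) * m powr p"
    using assms t by (simp add: powr_powr right_diff_distrib)
  then have "p * (t * m powr (p - 1)) \<le> p * ((1/p) * t powr p + (1 - 1/p) * m powr p)"
    using assms by (intro mult_left_mono) auto
  also have "\<dots> = t powr p + (p - 1) * m powr p"
    using assms by (simp add: field_simps)
  finally have 1: "p * (t * m powr (p - 1)) \<le> t powr p + (p - 1) * m powr p" .
  have "m powr (p - 1) * m = m powr p" using assms by (simp add: powr_mult_base powr_diff)
  then show ?thesis using 1 by (simp add: algebra_simps)
qed

text \<open>Jensen's inequality for the probability density \<open>y \<mapsto> moll e (x - y)\<close>: integrate the tangent
  inequality at the mean of \<open>norm f\<close>.\<close>

lemma conv_moll_Jensen:
  fixes f :: "'a::euclidean_space \<Rightarrow> 'b::euclidean_space"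
  assumes p: "p \<ge> 1" and e: "0 < e" and f: "integrable lebesgue f"
    and fp: "integrable lebesgue (\<lambda>x. norm (f x) powr p)"
  shows "norm (conv (moll e) f x) powr p \<le> conv (moll e) (\<lambda>y. norm (f y) powr p) x"
proof -
  let ?w = "\<lambda>y. moll e (x - y)"
  define m where "m = (LINT y|lebesgue. ?w y * norm (f y))"
  have i1: "integrable lebesgue (\<lambda>y. ?w y * norm (f y))"
    using moll_conv_integrable[OF e, of "\<lambda>y. norm (f y)"] f by simp
  have i2: "integrable lebesgue (\<lambda>y. ?w y * norm (f y) powr p)"
    using moll_conv_integrable[OF e fp] by simp
  have n: "norm (conv (moll e) f x) \<le> m"
    unfolding conv_def m_def
    by (rule norm_integral_le[OF moll_conv_integrable[OF e f] i1]) (simp add: moll_nonneg[OF e])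
  have R0: "0 \<le> conv (moll e) (\<lambda>y. norm (f y) powr p) x"
    unfolding conv_def by (simp add: moll_nonneg[OF e])
  show ?thesis
  proof (cases "m > 0")
    case False
    then show ?thesis using n R0 p by (smt (verit) norm_ge_zero powr_eq_0_iff)
  next
    case True
    have "m powr p = (LINT y|lebesgue. (m powr p) * ?w y + p * m powr (p - 1) * (?w y * norm (f y) - m * ?w y))"
      using i1 moll_integrable[OF e, of x] moll_integral[OF e, of x] by (simp add: m_def[symmetric])
    also have "\<dots> \<le> (LINT y|lebesgue. ?w y * norm (f y) powr p)"
    proof (rule integral_mono[OF _ i2])
      show "integrable lebesgue (\<lambda>y. (m powr p) * ?w y + p * m powr (p - 1) * (?w y * norm (f y) - m * ?w y))"
        using i1 moll_integrable[OF e, of x] by simp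
      fix y
      have "?w y * (m powr p + p * m powr (p - 1) * (norm (f y) - m)) \<le> ?w y * norm (f y) powr p"
        by (intro mult_left_mono powr_tangent p moll_nonneg e True) auto
      then show "(m powr p) * ?w y + p * m powr (p - 1) * (?w y * norm (f y) - m * ?w y) \<le> ?w y * norm (f y) powr p"
        by (simp add: algebra_simps)
    qed
    finally have "m powr p \<le> conv (moll e) (\<lambda>y. norm (f y) powr p) x" by (simp add: conv_def)
    moreover have "norm (conv (moll e) f x) powr p \<le> m powr p"
      using n p by (intro powr_mono2) auto
    ultimately show ?thesis by linarith
  qed
qed

text \<open>Tonelli's theorem.  It needs Borel measurability in both variables, so the Lebesgue measurable \<open>h\<close> is first
  exchanged for a Borel function that agrees with it almost everywhere.\<close>

lemma conv_moll_nonneg_integral: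
  fixes h :: "'a::euclidean_space \<Rightarrow> real"
  assumes e: "0 < e" and h: "integrable lebesgue h" and h0: "\<And>x. 0 \<le> h x"
  shows "integrable lebesgue (conv (moll e) h)" (is ?I)
    and "(LINT x|lebesgue. conv (moll e) h x) = (LINT x|lebesgue. h x)" (is ?E)
proof -
  obtain g where gm: "g \<in> borel_measurable lborel" and gh: "AE x in lborel. h x = g x"
    using completion_ex_borel_measurable_real[of h lborel] h by auto
  have [measurable]: "g \<in> borel_measurable borel" using gm by simp
  have g0: "AE x in lborel. 0 \<le> g x" using gh by eventually_elim (use h0 in metis)
  have nn: "ennreal (conv (moll e) h x) = (\<integral>\<^sup>+y. ennreal (moll e (x - y)) * ennreal (g y) \<partial>lborel)" for x
  proof -
    have "ennreal (conv (moll e) h x) = (\<integral>\<^sup>+y. ennreal (moll e (x - y) * h y) \<partial>lebesgue)"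
      unfolding conv_def
      using moll_conv_integrable[OF e h, of x] by (subst nn_integral_eq_integral) (auto simp: h0 moll_nonneg[OF e])
    also have "\<dots> = (\<integral>\<^sup>+y. ennreal (moll e (x - y)) * ennreal (g y) \<partial>lborel)"
      unfolding nn_integral_completion
      by (rule nn_integral_cong_AE) (use gh in eventually_elim, auto simp: ennreal_mult' moll_nonneg[OF e])
    finally show ?thesis .
  qed
  have m1: "(\<integral>\<^sup>+x. ennreal (moll e (x - y)) \<partial>lborel) = 1" for y :: 'a
  proof -
    have "(\<integral>\<^sup>+x. ennreal (moll e (x::'a)) \<partial>lborel) = (\<integral>\<^sup>+x. ennreal (moll e x) \<partial>distr lborel borel ((+) (- y)))"
      unfolding lborel_distr_plus ..
    also have "\<dots> = (\<integral>\<^sup>+x. ennreal (moll e (x - y)) \<partial>lborel)"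
      by (subst nn_integral_distr) auto
    finally have "(\<integral>\<^sup>+x. ennreal (moll e (x - y)) \<partial>lborel) = (\<integral>\<^sup>+x. ennreal (moll e (x::'a)) \<partial>lborel)" by (rule sym)
    also have "\<dots> = 1"
      using moll_integrable_1[OF e, where 'a='a] moll_integral_1[OF e, where 'a='a]
      by (subst nn_integral_eq_integral) (auto simp: moll_nonneg[OF e])
    finally show ?thesis .
  qed
  have "(\<integral>\<^sup>+x. ennreal (conv (moll e) h x) \<partial>lebesgue) = (\<integral>\<^sup>+x. \<integral>\<^sup>+y. ennreal (moll e (x - y)) * ennreal (g y) \<partial>lborel \<partial>lborel)"
    unfolding nn_integral_completion by (simp add: nn)
  also have "\<dots> = (\<integral>\<^sup>+y. \<integral>\<^sup>+x. ennreal (moll e (x - y)) * ennreal (g y) \<partial>lborel \<partial>lborel)"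
    by (rule lborel_pair.Fubini'[symmetric]) measurable
  also have "\<dots> = (\<integral>\<^sup>+y. ennreal (g y) \<partial>lborel)"
    by (subst nn_integral_multc) (auto simp: m1)
  also have "\<dots> = (\<integral>\<^sup>+y. ennreal (h y) \<partial>lborel)"
    by (rule nn_integral_cong_AE) (use gh in eventually_elim, auto)
  also have "\<dots> = (\<integral>\<^sup>+y. ennreal (h y) \<partial>lebesgue)" by (simp add: nn_integral_completion)
  also have "\<dots> = ennreal (LINT x|lebesgue. h x)"
    using h h0 by (intro nn_integral_eq_integral) auto
  finally have *: "(\<integral>\<^sup>+x. ennreal (conv (moll e) h x) \<partial>lebesgue) = ennreal (LINT x|lebesgue. h x)" .
  have c0: "0 \<le> conv (moll e) h x" for x
    unfolding conv_def using h0 by (simp add: moll_nonneg[OF e])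
  have cm: "conv (moll e) h \<in> borel_measurable lebesgue"
    by (intro borel_measurable_lebesgue_continuous conv_moll_continuous e h)
  show ?I by (rule integrableI_nonneg[OF cm]) (auto simp: c0 *)
  show ?E using * integral_eq_nn_integral[OF cm] h0
    by (simp add: c0)
qed

text \<open>A crude substitute for Minkowski's inequality, sufficient for all convergence arguments below.\<close>

lemma powr_norm_add3:
  fixes a b c :: "'b::real_normed_vector"
  assumes "p > 0"
  shows "norm (a + b + c) powr p \<le> 3 powr p * (norm a powr p + norm b powr p + norm c powr p)"
proof -
  define M where "M = max (norm a) (max (norm b) (norm c))"
  have "norm (a + b + c) \<le> norm a + norm b + norm c"
    by (meson add_mono norm_triangle_ineq order_refl order_trans)
  also have "\<dots> \<le> 3 * M" by (simp add: M_def)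
  finally have "norm (a + b + c) powr p \<le> (3 * M) powr p"
    using assms by (intro powr_mono2) auto
  also have "\<dots> = 3 powr p * M powr p" by (subst powr_mult) (auto simp: M_def)
  also have "M powr p \<le> norm a powr p + norm b powr p + norm c powr p"
    by (auto simp: M_def max_def)
  finally show ?thesis by simp
qed

section \<open>Convergence of mollifications in \<open>L\<^sup>p\<close>\<close>

lemma integrable_indicator_cball: "integrable lebesgue (indicat_real (cball (c::'a::euclidean_space) R))"
  using emeasure_lborel_cball_finite[of c R] by (intro integrable_real_indicator) auto

lemma bounded_support_integrable:
  fixes f :: "'a::euclidean_space \<Rightarrow> 'b::euclidean_space"
  assumes "f \<in> borel_measurable lebesgue" "\<And>x. x \<notin> cball 0 R \<Longrightarrow> f x = 0" "\<And>x. norm (f x) \<le> B"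
  shows "integrable lebesgue f"
proof (rule Bochner_Integration.integrable_bound[OF _ assms(1)])
  show "integrable lebesgue (\<lambda>x. B * indicat_real (cball 0 R) x)"
    by (intro integrable_mult_right integrable_indicator_cball)
  show "AE x in lebesgue. norm (f x) \<le> norm (B * indicat_real (cball 0 R) x)"
  proof (rule AE_I2)
    fix x
    show "norm (f x) \<le> norm (B * indicat_real (cball 0 R) x)"
      using assms(2)[of x] assms(3)[of x] by (cases "x \<in> cball 0 R") auto
  qed
qed

lemma Lp_imp_L1:
  fixes f :: "'a::euclidean_space \<Rightarrow> 'b::euclidean_space"
  assumes m: "f \<in> borel_measurable lebesgue" and z: "\<And>x. x \<notin> cball 0 R \<Longrightarrow> f x = 0" and p: "p \<ge> 1"
    and fp: "integrable lebesgue (\<lambda>x. norm (f x) powr p)"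
  shows "integrable lebesgue f"
proof (rule Bochner_Integration.integrable_bound[OF _ m])
  show "integrable lebesgue (\<lambda>x. indicat_real (cball 0 R) x + norm (f x) powr p)"
    by (intro Bochner_Integration.integrable_add integrable_indicator_cball fp)
  show "AE x in lebesgue. norm (f x) \<le> norm (indicat_real (cball 0 R) x + norm (f x) powr p)"
  proof (rule AE_I2)
    fix x
    have "norm (f x) \<le> 1 + norm (f x) powr p"
    proof (cases "norm (f x) \<le> 1")
      case False
      then have "norm (f x) powr 1 \<le> norm (f x) powr p" using p by (intro powr_mono) auto
      then show ?thesis using False by simp
    qed (simp add: add_increasing2)
    then show "norm (f x) \<le> norm (indicat_real (cball 0 R) x + norm (f x) powr p)"
      using z[of x] by (cases "x \<in> cball 0 R") auto
  qed
qed

text \<open>A Lebesgue measurable function is an almost everywhere limit of continuous functions.  Projecting these onto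
  the ball that contains the values of \<open>f\<close>, and cutting them off outside the support, makes the
  convergence dominated.\<close>

lemma Lp_approx_continuous_bounded:
  fixes f :: "'a::euclidean_space \<Rightarrow> 'b::euclidean_space"
  assumes m: "f \<in> borel_measurable lebesgue" and z: "\<And>x. x \<notin> cball 0 R \<Longrightarrow> f x = 0"
    and p: "p \<ge> 1" and b: "\<And>x. norm (f x) \<le> N" and R: "0 \<le> R"
  shows "\<exists>h :: nat \<Rightarrow> 'a \<Rightarrow> 'b. (\<forall>n. continuous_on UNIV (h n) \<and> (\<forall>x. norm x \<ge> R + 1 \<longrightarrow> h n x = 0)) \<and>
      (\<lambda>n. LINT x|lebesgue. norm (f x - h n x) powr p) \<longlonglongrightarrow> 0"
proof -
  have N: "0 \<le> N" using b[of 0] norm_ge_zero order_trans by blast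
  have "f measurable_on UNIV"
    using lebesgue_measurable_imp_measurable_on[of f UNIV] m by simp
  then obtain N0 c where N0: "negligible N0" and c: "\<And>n::nat. continuous_on UNIV (c n)"
    and lim: "\<And>x. x \<notin> N0 \<Longrightarrow> (\<lambda>n. c n x) \<longlonglongrightarrow> f x"
    unfolding measurable_on_def by auto
  define cut where "cut x = max 0 (min 1 (R + 1 - norm x))" for x :: 'a
  let ?P = "closest_point (cball (0::'b) N)"
  define h where "h n x = cut x *\<^sub>R ?P (c n x)" for n x
  have cP: "continuous_on UNIV ?P" by (rule continuous_on_closest_point) (use N in auto)
  have Pb: "norm (?P y) \<le> N" for y
    using closest_point_in_set[of "cball (0::'b) N" y] N by auto
  have Pf: "?P (f x) = f x" for x using b[of x] by (intro closest_point_self) auto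
  have cutf: "cut x *\<^sub>R f x = f x" for x
    using z[of x] by (cases "x \<in> cball 0 R") (auto simp: cut_def)
  have c_cut: "continuous_on UNIV cut" unfolding cut_def by (intro continuous_intros)
  have ch: "continuous_on UNIV (h n)" for n
    unfolding h_def by (intro continuous_on_scaleR c_cut continuous_on_compose2[OF cP c]) auto
  have zh: "norm x \<ge> R + 1 \<Longrightarrow> h n x = 0" for n x by (simp add: h_def cut_def)
  have hb: "norm (h n x) \<le> N" for n x
  proof -
    have "\<bar>cut x\<bar> * norm (?P (c n x)) \<le> 1 * N" by (intro mult_mono Pb) (auto simp: cut_def)
    then show ?thesis by (simp add: h_def)
  qed
  have [measurable]: "f \<in> borel_measurable lebesgue" "h n \<in> borel_measurable lebesgue" for n
    using m borel_measurable_lebesgue_continuous[OF ch] by auto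
  have "(\<lambda>n. LINT x|lebesgue. norm (f x - h n x) powr p) \<longlonglongrightarrow> (LINT x|(lebesgue::'a measure). 0)"
  proof (rule integral_dominated_convergence[where w="\<lambda>x. (2 * N) powr p * indicat_real (cball 0 (R + 1)) x"])
    show "integrable lebesgue (\<lambda>x. (2 * N) powr p * indicat_real (cball (0::'a) (R + 1)) x)"
      by (intro integrable_mult_right integrable_indicator_cball)
    have "AE x in lebesgue. x \<notin> N0"
      using N0 by (simp add: negligible_iff_null_sets AE_not_in)
    then show "AE x in lebesgue. (\<lambda>n. norm (f x - h n x) powr p) \<longlonglongrightarrow> 0"
    proof eventually_elim
      case (elim x)
      have "(\<lambda>n. ?P (c n x)) \<longlonglongrightarrow> ?P (f x)"
        using cP lim[OF elim] continuous_on_tendsto_compose[of UNIV ?P] by auto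
      then have "(\<lambda>n. norm (f x - h n x)) \<longlonglongrightarrow> norm (f x - cut x *\<^sub>R ?P (f x))"
        unfolding h_def by (intro tendsto_intros)
      then have "(\<lambda>n. norm (f x - h n x)) \<longlonglongrightarrow> 0" by (simp add: Pf cutf)
      then have "(\<lambda>n. norm (f x - h n x) powr p) \<longlonglongrightarrow> 0 powr p"
        by (rule tendsto_powr') (use p in auto)
      then show ?case by simp
    qed
    show "AE x in lebesgue. norm (norm (f x - h n x) powr p) \<le> (2 * N) powr p * indicat_real (cball 0 (R + 1)) x" for n
    proof (rule AE_I2)
      fix x
      show "norm (norm (f x - h n x) powr p) \<le> (2 * N) powr p * indicat_real (cball 0 (R + 1)) x"
      proof (cases "x \<in> cball 0 (R + 1)")
        case True
        have "norm (f x - h n x) \<le> 2 * N" using b[of x] hb[of n x] norm_triangle_ineq4[of "f x" "h n x"] by linarith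
        then show ?thesis using True p by (auto intro: powr_mono2)
      next
        case False
        then show ?thesis using z[of x] zh[of x n] by auto
      qed
    qed
  qed measurable
  then have "(\<lambda>n. LINT x|lebesgue. norm (f x - h n x) powr p) \<longlonglongrightarrow> 0" by simp
  then show ?thesis using ch zh by blast
qed

lemma Lp_integrable_diff:
  fixes f g :: "'a::euclidean_space \<Rightarrow> 'b::euclidean_space"
  assumes "f \<in> borel_measurable M" "g \<in> borel_measurable M" "p > 0"
    "integrable M (\<lambda>x. norm (f x) powr p)" "integrable M (\<lambda>x. norm (g x) powr p)"
  shows "integrable M (\<lambda>x. norm (f x - g x) powr p)"
proof (rule Bochner_Integration.integrable_bound)
  show "integrable M (\<lambda>x. 3 powr p * (norm (f x) powr p + norm (g x) powr p))" using assms by simp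
  show "(\<lambda>x. norm (f x - g x) powr p) \<in> borel_measurable M" using assms(1,2) by measurable
  show "AE x in M. norm (norm (f x - g x) powr p) \<le> norm (3 powr p * (norm (f x) powr p + norm (g x) powr p))"
  proof (rule AE_I2)
    fix x
    have "norm (f x + - g x + 0) powr p \<le> 3 powr p * (norm (f x) powr p + norm (- g x) powr p + norm (0::'b) powr p)"
      by (rule powr_norm_add3[OF assms(3)])
    then have "norm (f x - g x) powr p \<le> 3 powr p * (norm (f x) powr p + norm (g x) powr p)" by simp
    then show "norm (norm (f x - g x) powr p) \<le> norm (3 powr p * (norm (f x) powr p + norm (g x) powr p))"
      by simp
  qed
qed

text \<open>Truncation at a large level reduces the density of continuous functions to the bounded case.\<close>

lemma Lp_approx_continuous:
  fixes f :: "'a::euclidean_space \<Rightarrow> 'b::euclidean_space"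
  assumes m[measurable]: "f \<in> borel_measurable lebesgue" and z: "\<And>x. x \<notin> cball 0 R \<Longrightarrow> f x = 0"
    and p: "p \<ge> 1" and fp: "integrable lebesgue (\<lambda>x. norm (f x) powr p)" and R: "0 \<le> R" and e: "0 < e"
  obtains h where "continuous_on UNIV h" "\<And>x. norm x \<ge> R + 1 \<Longrightarrow> h x = 0"
    "(LINT x|lebesgue. norm (f x - h x) powr p) < e"
proof -
  define t where "t N x = (if norm (f x) \<le> real N then f x else 0)" for N x
  have [measurable]: "t N \<in> borel_measurable lebesgue" for N unfolding t_def by measurable
  define \<eta> where "\<eta> = e / (2 * 3 powr p)"
  have \<eta>: "0 < \<eta>" using e by (simp add: \<eta>_def)
  have "(\<lambda>N. LINT x|lebesgue. norm (f x - t N x) powr p) \<longlonglongrightarrow> (LINT x|(lebesgue::'a measure). 0)"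
  proof (rule integral_dominated_convergence[OF _ _ fp])
    show "AE x in lebesgue. (\<lambda>N. norm (f x - t N x) powr p) \<longlonglongrightarrow> 0"
    proof (rule AE_I2)
      fix x
      obtain N0 :: nat where "norm (f x) \<le> real N0" using real_arch_simple by blast
      then have "\<forall>N\<ge>N0. 0 = norm (f x - t N x) powr p" using p by (auto simp: t_def)
      then have "\<forall>\<^sub>F N in sequentially. 0 = norm (f x - t N x) powr p"
        unfolding eventually_sequentially by blast
      then show "(\<lambda>N. norm (f x - t N x) powr p) \<longlonglongrightarrow> 0"
        by (rule Lim_transform_eventually[OF tendsto_const])
    qed
    show "AE x in lebesgue. norm (norm (f x - t N x) powr p) \<le> norm (f x) powr p" for N
      by (auto simp: t_def)
  qed measurable
  then have "(\<lambda>N. LINT x|lebesgue. norm (f x - t N x) powr p) \<longlonglongrightarrow> 0" by simp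
  then have "\<forall>\<^sub>F N in sequentially. (LINT x|lebesgue. norm (f x - t N x) powr p) < \<eta>"
    using \<eta> by (rule order_tendstoD)
  then obtain N where N: "(LINT x|lebesgue. norm (f x - t N x) powr p) < \<eta>"
    using eventually_happens by fastforce
  have tz: "x \<notin> cball 0 R \<Longrightarrow> t N x = 0" for x using z[of x] by (simp add: t_def)
  have tb: "norm (t N x) \<le> real N" for x by (simp add: t_def)
  obtain H where H: "\<And>n. continuous_on UNIV (H n)" "\<And>n x. norm x \<ge> R + 1 \<Longrightarrow> H n x = 0"
    "(\<lambda>n::nat. LINT x|lebesgue. norm (t N x - H n x) powr p) \<longlonglongrightarrow> 0"
    using Lp_approx_continuous_bounded[OF \<open>t N \<in> _\<close> tz p tb R] by blast
  have "\<forall>\<^sub>F n in sequentially. (LINT x|lebesgue. norm (t N x - H n x) powr p) < \<eta>"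
    using H(3) \<eta> by (rule order_tendstoD)
  then obtain n where n: "(LINT x|lebesgue. norm (t N x - H n x) powr p) < \<eta>"
    using eventually_happens by fastforce
  have [measurable]: "H n \<in> borel_measurable lebesgue" by (rule borel_measurable_lebesgue_continuous[OF H(1)])
  have tp: "integrable lebesgue (\<lambda>x. norm (t N x) powr p)"
    by (rule Bochner_Integration.integrable_bound[OF fp]) (auto simp: t_def)
  have Hp: "integrable lebesgue (\<lambda>x. norm (H n x) powr p)"
  proof -
    obtain B where B: "\<And>x. norm (H n x) \<le> B" using compactly_supported_bounded[OF H(1) H(2)] by blast
    show ?thesis
    proof (rule bounded_support_integrable[where R="R + 1" and B="B powr p"])
      show "norm (norm (H n x) powr p) \<le> B powr p" for x using B[of x] p by (auto intro: powr_mono2)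
    qed (use H(2) in auto)
  qed
  have i1: "integrable lebesgue (\<lambda>x. norm (f x - t N x) powr p)"
    by (rule Lp_integrable_diff) (use fp tp p in auto)
  have i2: "integrable lebesgue (\<lambda>x. norm (t N x - H n x) powr p)"
    by (rule Lp_integrable_diff) (use Hp tp p in auto)
  have i3: "integrable lebesgue (\<lambda>x. norm (f x - H n x) powr p)"
    by (rule Lp_integrable_diff) (use Hp fp p in auto)
  have "(LINT x|lebesgue. norm (f x - H n x) powr p) \<le>
      (LINT x|lebesgue. 3 powr p * (norm (f x - t N x) powr p + norm (t N x - H n x) powr p))"
  proof (rule integral_mono[OF i3])
    show "integrable lebesgue (\<lambda>x. 3 powr p * (norm (f x - t N x) powr p + norm (t N x - H n x) powr p))"
      using i1 i2 by simp
    show "norm (f x - H n x) powr p \<le> 3 powr p * (norm (f x - t N x) powr p + norm (t N x - H n x) powr p)" for x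
      using powr_norm_add3[of p "f x - t N x" "t N x - H n x" 0] p by simp
  qed
  also have "\<dots> = 3 powr p * ((LINT x|lebesgue. norm (f x - t N x) powr p) + (LINT x|lebesgue. norm (t N x - H n x) powr p))"
    using i1 i2 by simp
  also have "\<dots> < 3 powr p * (\<eta> + \<eta>)" using N n by (intro mult_strict_left_mono) auto
  also have "\<dots> = e" by (simp add: \<eta>_def)
  finally show ?thesis using that H(1,2) by blast
qed

lemma conv_diff:
  fixes f g :: "'a::euclidean_space \<Rightarrow> 'b::euclidean_space"
  assumes "0 < e" "integrable lebesgue f" "integrable lebesgue g"
  shows "conv (moll e) (\<lambda>x. f x - g x) x = conv (moll e) f x - conv (moll e) g x"
  using moll_conv_integrable[OF assms(1,2), of x] moll_conv_integrable[OF assms(1,3), of x]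
  by (simp add: conv_def scaleR_diff_right)

lemma conv_close:
  fixes f :: "'a::euclidean_space \<Rightarrow> 'b::euclidean_space"
  assumes e: "0 < e" and f: "integrable lebesgue f"
    and c: "\<And>y. norm (x - y) < e \<Longrightarrow> norm (f y - a) \<le> \<eta>"
  shows "norm (conv (moll e) f x - a) \<le> \<eta>"
proof -
  have ia: "integrable lebesgue (\<lambda>y. moll e (x - y) *\<^sub>R a)"
    using moll_integrable[OF e, of x] by (intro integrable_scaleR_left) auto
  have "(LINT y|lebesgue. moll e (x - y) *\<^sub>R a) = a"
    using moll_integrable[OF e, of x] moll_integral[OF e, of x] by simp
  then have "conv (moll e) f x - a = (LINT y|lebesgue. moll e (x - y) *\<^sub>R (f y - a))"
    using moll_conv_integrable[OF e f, of x] ia by (simp add: conv_def scaleR_diff_right)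
  also have "norm \<dots> \<le> (LINT y|lebesgue. moll e (x - y) * \<eta>)"
  proof (rule norm_integral_le)
    show "integrable lebesgue (\<lambda>y. moll e (x - y) *\<^sub>R (f y - a))"
      using moll_conv_integrable[OF e f, of x] ia by (simp add: scaleR_diff_right)
    show "integrable lebesgue (\<lambda>y. moll e (x - y) * \<eta>)" using moll_integrable[OF e, of x] by simp
    show "norm (moll e (x - y) *\<^sub>R (f y - a)) \<le> moll e (x - y) * \<eta>" for y
      using c[of y] moll_eq_0[OF e, of "x - y"] moll_nonneg[OF e, of "x - y"]
      by (cases "norm (x - y) < e") (auto intro: mult_left_mono)
  qed
  also have "\<dots> = \<eta>" using moll_integrable[OF e, of x] moll_integral[OF e, of x] by simp
  finally show ?thesis .
qed

text \<open>For continuous functions the convergence is uniform; the general case follows by density, because mollification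
  does not increase the \<open>L\<^sup>p\<close> norm, by Jensen's inequality.\<close>

lemma mollify_Lp:
  fixes f :: "'a::euclidean_space \<Rightarrow> 'b::euclidean_space"
  assumes m[measurable]: "f \<in> borel_measurable lebesgue" and z: "\<And>x. x \<notin> cball 0 R \<Longrightarrow> f x = 0"
    and p: "p \<ge> 1" and fp: "integrable lebesgue (\<lambda>x. norm (f x) powr p)"
    and ep: "\<And>k::nat. 0 < e k" and e0: "e \<longlonglongrightarrow> 0"
  shows "integrable lebesgue (\<lambda>x. norm (conv (moll (e k)) f x - f x) powr p)"
    and "(\<lambda>k. LINT x|lebesgue. norm (conv (moll (e k)) f x - f x) powr p) \<longlonglongrightarrow> 0"
proof -
  define R' where "R' = max R 0"
  have R': "0 \<le> R'" and z': "x \<notin> cball 0 R' \<Longrightarrow> f x = 0" for x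
    using z[of x] by (auto simp: R'_def)
  have f: "integrable lebesgue f" by (rule Lp_imp_L1[OF m z p fp])
  have conv_m[measurable]: "conv (moll (e k)) g \<in> borel_measurable lebesgue" if "integrable lebesgue g"
    for g :: "'a \<Rightarrow> 'b" and k
    by (intro borel_measurable_lebesgue_continuous conv_moll_continuous ep that)
  have convp: "integrable lebesgue (\<lambda>x. norm (conv (moll (e k)) g x) powr p)"
    and convple: "(LINT x|lebesgue. norm (conv (moll (e k)) g x) powr p) \<le> (LINT x|lebesgue. norm (g x) powr p)"
    if g: "integrable lebesgue g" and gp: "integrable lebesgue (\<lambda>x. norm (g x) powr p)" for g :: "'a \<Rightarrow> 'b" and k
  proof -
    note * = conv_moll_nonneg_integral[OF ep[of k] gp]
    show 1: "integrable lebesgue (\<lambda>x. norm (conv (moll (e k)) g x) powr p)"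
    proof (rule Bochner_Integration.integrable_bound[OF *(1)])
      show "(\<lambda>x. norm (conv (moll (e k)) g x) powr p) \<in> borel_measurable lebesgue" using conv_m[OF g] by measurable
      show "AE x in lebesgue. norm (norm (conv (moll (e k)) g x) powr p) \<le> norm (conv (moll (e k)) (\<lambda>x. norm (g x) powr p) x)"
        using conv_moll_Jensen[OF p ep g gp, of k] by (auto intro!: AE_I2 intro: order_trans abs_ge_self)
    qed auto
    show "(LINT x|lebesgue. norm (conv (moll (e k)) g x) powr p) \<le> (LINT x|lebesgue. norm (g x) powr p)"
      unfolding *(2)[OF powr_ge_zero, symmetric]
      by (rule integral_mono[OF 1 *(1)]) (auto intro: conv_moll_Jensen[OF p ep g gp])
  qed
  show intk: "integrable lebesgue (\<lambda>x. norm (conv (moll (e k)) f x - f x) powr p)" for k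
    by (rule Lp_integrable_diff) (use conv_m[OF f] convp[OF f fp] fp p in auto)
  show "(\<lambda>k. LINT x|lebesgue. norm (conv (moll (e k)) f x - f x) powr p) \<longlonglongrightarrow> 0"
  proof (rule LIMSEQ_I)
    fix r :: real assume r: "0 < r"
    define \<eta> where "\<eta> = r / (4 * 3 powr p)"
    have \<eta>: "0 < \<eta>" using r by (simp add: \<eta>_def)
    obtain h where ch: "continuous_on UNIV h" and zh: "\<And>x. norm x \<ge> R' + 1 \<Longrightarrow> h x = 0"
      and fh: "(LINT x|lebesgue. norm (f x - h x) powr p) < \<eta>"
      using Lp_approx_continuous[OF m z' p fp R' \<eta>] by blast
    have [measurable]: "h \<in> borel_measurable lebesgue" by (rule borel_measurable_lebesgue_continuous[OF ch])
    obtain B where B: "\<And>x. norm (h x) \<le> B" using compactly_supported_bounded[OF ch zh] by blast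
    have hp: "integrable lebesgue (\<lambda>x. norm (h x) powr p)"
      by (rule bounded_support_integrable[where R="R' + 1" and B="B powr p"])
         (use zh B p in \<open>auto intro: powr_mono2\<close>)
    have hi: "integrable lebesgue h"
      by (rule bounded_support_integrable[where R="R' + 1" and B="B"]) (use zh B in auto)
    define V where "V = measure lborel (cball (0::'a) (R' + 2))"
    define \<delta> where "\<delta> = (\<eta> / (V + 1)) powr (1 / p)"
    have V: "0 \<le> V" by (simp add: V_def)
    have \<delta>: "0 < \<delta>" using \<eta> V by (auto simp: \<delta>_def)
    have \<delta>p: "\<delta> powr p = \<eta> / (V + 1)" using \<eta> V p by (simp add: \<delta>_def powr_powr)
    obtain d where d: "0 < d" "\<And>x y. norm (x - y) < d \<Longrightarrow> norm (h x - h y) < \<delta>"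
      using compactly_supported_uniformly_continuous[OF ch zh \<delta>] by metis
    have "\<forall>\<^sub>F k in sequentially. e k < min d 1" using e0 d(1) by (intro order_tendstoD) auto
    then obtain k0 where k0: "\<And>k. k \<ge> k0 \<Longrightarrow> e k < min d 1" unfolding eventually_sequentially by blast
    have "norm (LINT x|lebesgue. norm (conv (moll (e k)) f x - f x) powr p) < r" if k: "k \<ge> k0" for k
    proof -
      have ek: "e k < d" "e k < 1" using k0[OF k] by auto
      define g where "g x = f x - h x" for x
      have gi: "integrable lebesgue g" unfolding g_def using f hi by simp
      have gp: "integrable lebesgue (\<lambda>x. norm (g x) powr p)"
        unfolding g_def by (rule Lp_integrable_diff) (use fp hp p in auto)
      have near: "norm (conv (moll (e k)) h x - h x) \<le> \<delta>" for x
        by (rule conv_close[OF ep hi]) (use d(2) ek in \<open>metis less_trans less_imp_le norm_minus_commute\<close>)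
      have far: "conv (moll (e k)) h x - h x = 0" if x: "norm x > R' + 2" for x
      proof -
        have "conv (moll (e k)) h x = 0"
        proof (rule conv_eq_0[where K="cball 0 (R' + 1)", OF _ _ ep])
          show "norm (x - y) \<ge> e k" if "y \<in> cball 0 (R' + 1)" for y
            using that x ek norm_triangle_ineq2[of x y] by auto
        qed (use zh in auto)
        then show ?thesis using zh[of x] x by simp
      qed
      have ih: "integrable lebesgue (\<lambda>x. norm (conv (moll (e k)) h x - h x) powr p)"
        by (rule Lp_integrable_diff) (use conv_m[OF hi] convp[OF hi hp] hp p in auto)
      have "(LINT x|lebesgue. norm (conv (moll (e k)) h x - h x) powr p) \<le> (LINT x|lebesgue. \<delta> powr p * indicat_real (cball (0::'a) (R' + 2)) x)"
      proof (rule integral_mono[OF ih])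
        show "integrable lebesgue (\<lambda>x. \<delta> powr p * indicat_real (cball (0::'a) (R' + 2)) x)"
          by (intro integrable_mult_right integrable_indicator_cball)
        show "norm (conv (moll (e k)) h x - h x) powr p \<le> \<delta> powr p * indicat_real (cball 0 (R' + 2)) x" for x
          using near[of x] far[of x] p by (cases "x \<in> cball 0 (R' + 2)") (auto intro: powr_mono2)
      qed
      also have "\<dots> = \<delta> powr p * V" by (simp add: V_def)
      also have "\<dots> \<le> \<eta>" using \<eta> V by (simp add: \<delta>p field_simps)
      finally have ih_le: "(LINT x|lebesgue. norm (conv (moll (e k)) h x - h x) powr p) \<le> \<eta>" .
      have ig_le: "(LINT x|lebesgue. norm (conv (moll (e k)) g x) powr p) < \<eta>"
        using convple[OF gi gp, of k] fh by (simp add: g_def[abs_def])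
      have "(LINT x|lebesgue. norm (conv (moll (e k)) f x - f x) powr p) \<le>
          (LINT x|lebesgue. 3 powr p * (norm (conv (moll (e k)) g x) powr p + norm (conv (moll (e k)) h x - h x) powr p + norm (g x) powr p))"
      proof (rule integral_mono[OF intk])
        show "integrable lebesgue (\<lambda>x. 3 powr p * (norm (conv (moll (e k)) g x) powr p + norm (conv (moll (e k)) h x - h x) powr p + norm (g x) powr p))"
          using convp[OF gi gp] ih gp by simp
        fix x
        have "conv (moll (e k)) f x - f x = conv (moll (e k)) g x + (conv (moll (e k)) h x - h x) + - g x"
          unfolding g_def[abs_def] by (simp add: conv_diff[OF ep f hi])
        then show "norm (conv (moll (e k)) f x - f x) powr p \<le> 3 powr p * (norm (conv (moll (e k)) g x) powr p + norm (conv (moll (e k)) h x - h x) powr p + norm (g x) powr p)"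
          using powr_norm_add3[of p "conv (moll (e k)) g x" "conv (moll (e k)) h x - h x" "- g x"] p by simp
      qed
      also have "\<dots> = 3 powr p * ((LINT x|lebesgue. norm (conv (moll (e k)) g x) powr p) + (LINT x|lebesgue. norm (conv (moll (e k)) h x - h x) powr p) + (LINT x|lebesgue. norm (g x) powr p))"
        using convp[OF gi gp] ih gp by simp
      also have "\<dots> < 3 powr p * (\<eta> + \<eta> + \<eta>)"
        using ih_le ig_le fh by (intro mult_strict_left_mono) (auto simp: g_def[abs_def])
      also have "\<dots> < r" using r by (simp add: \<eta>_def)
      finally show ?thesis by simp
    qed
    then show "\<exists>no. \<forall>n\<ge>no. norm ((LINT x|lebesgue. norm (conv (moll (e n)) f x - f x) powr p) - 0) < r"
      by auto
  qed
qed

section \<open>Weak gradients and their uniqueness\<close>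

text \<open>The closed \<open>r\<close>-neighbourhood: the room that mollification with radius at most \<open>r\<close> requires around \<open>K\<close>.\<close>

definition nbhd :: "'a::euclidean_space set \<Rightarrow> real \<Rightarrow> 'a set" where
  "nbhd K r = (\<Union>x\<in>K. cball x r)"

lemma compact_nbhd: "compact K \<Longrightarrow> compact (nbhd K r)"
  unfolding nbhd_def by (rule compact_minkowski_sum_cball)

lemma nbhd_subset_open:
  assumes "compact K" "open U" "K \<subseteq> U"
  obtains r where "0 < r" "nbhd K r \<subseteq> U"
  using compact_subset_open_imp_cball_epsilon_subset[OF assms] unfolding nbhd_def by blast

lemma cball_subset_nbhd: "x \<in> nbhd K r \<Longrightarrow> e + r \<le> s \<Longrightarrow> cball x e \<subseteq> nbhd K s"
proof
  fix y assume x: "x \<in> nbhd K r" and s: "e + r \<le> s" and y: "y \<in> cball x e"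
  then obtain z where z: "z \<in> K" "dist z x \<le> r" by (auto simp: nbhd_def)
  have "dist z y \<le> dist z x + dist x y" by (rule dist_triangle)
  also have "\<dots> \<le> s" using z y s by auto
  finally show "y \<in> nbhd K s" using z by (auto simp: nbhd_def)
qed

lemma nbhd_superset: "0 \<le> r \<Longrightarrow> K \<subseteq> nbhd K r"
  by (auto simp: nbhd_def)

lemma nbhd_mono: "r \<le> s \<Longrightarrow> nbhd K r \<subseteq> nbhd K s"
  by (auto simp: nbhd_def)

lemma nbhd_far: "x \<notin> nbhd K r \<Longrightarrow> y \<in> K \<Longrightarrow> norm (x - y) \<ge> r"
  by (auto simp: nbhd_def dist_norm norm_minus_commute not_le less_imp_le)

lemma test_function_support:
  assumes "test_function \<Omega> \<phi>"
  obtains S R where "compact S" "S \<subseteq> \<Omega>" "\<And>x. x \<notin> S \<Longrightarrow> \<phi> x = 0" "\<And>x. norm x \<ge> R \<Longrightarrow> \<phi> x = 0"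
    "\<And>x. x \<notin> S \<Longrightarrow> grad \<phi> x = 0"
proof -
  define S where "S = closure (support_on UNIV \<phi>)"
  have S: "compact S" "S \<subseteq> \<Omega>" using assms by (auto simp: test_function_def S_def)
  have "support_on UNIV \<phi> \<subseteq> S" unfolding S_def by (rule closure_subset)
  then have z: "x \<notin> S \<Longrightarrow> \<phi> x = 0" for x by (auto simp: support_on_def)
  have "bounded S" by (rule compact_imp_bounded[OF S(1)])
  then obtain R where R: "\<And>x. x \<in> S \<Longrightarrow> norm x \<le> R" unfolding bounded_iff by blast
  have R1: "norm x \<ge> R + 1 \<Longrightarrow> \<phi> x = 0" for x using z[of x] R[of x] by (cases "x \<in> S") auto
  have gz: "grad \<phi> x = 0" if "x \<notin> S" for x
  proof -
    have "GDERIV \<phi> x :> 0"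
      by (rule GDERIV_transform_open[OF GDERIV_const[of 0], of "- S"])
         (use S z that in \<open>auto dest: compact_imp_closed\<close>)
    then show ?thesis by (rule GDERIV_imp_frechet_derivative(3))
  qed
  show ?thesis by (rule that[OF S z R1 gz])
qed

lemma test_functionI:
  assumes "\<And>k. C_class k \<phi>" "compact S" "S \<subseteq> \<Omega>" "\<And>x. x \<notin> S \<Longrightarrow> \<phi> x = 0"
  shows "test_function \<Omega> \<phi>"
proof -
  have "support_on UNIV \<phi> \<subseteq> S" using assms(4) by (auto simp: support_on_def)
  then have "closure (support_on UNIV \<phi>) \<subseteq> S" by (simp add: assms(2) closure_minimal compact_imp_closed)
  then show ?thesis unfolding test_function_def
    using assms(1,3) compact_Int_closed[OF assms(2) closed_closure[of "support_on UNIV \<phi>"]]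
    by (simp add: Int_absorb1 Int_absorb2)
qed

lemma test_function_GDERIV: "test_function \<Omega> \<phi> \<Longrightarrow> GDERIV \<phi> x :> grad \<phi> x"
  by (auto simp: test_function_def intro: C_class_1_GDERIV)

lemma test_function_continuous: "test_function \<Omega> \<phi> \<Longrightarrow> continuous_on UNIV \<phi>"
  by (auto simp: test_function_def intro: C_class_continuous)

lemma test_function_continuous_grad: "test_function \<Omega> \<phi> \<Longrightarrow> continuous_on UNIV (grad \<phi>)"
  by (auto simp: test_function_def intro: C_class_1_continuous_grad)

lemma test_function_mono: "test_function \<Omega> \<phi> \<Longrightarrow> \<Omega> \<subseteq> \<Omega>' \<Longrightarrow> test_function \<Omega>' \<phi>"
  by (auto simp: test_function_def)

lemma integral_lebesgue_on_open:
  fixes f :: "'a::euclidean_space \<Rightarrow> 'b::euclidean_space"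
  assumes "open \<Omega>"
  shows "(LINT x|lebesgue_on \<Omega>. f x) = (LINT x|lebesgue. indicator \<Omega> x *\<^sub>R f x)"
  by (rule integral_restrict_space) (use assms in auto)

lemma integrable_lebesgue_on_open:
  fixes f :: "'a::euclidean_space \<Rightarrow> 'b::euclidean_space"
  assumes "open \<Omega>"
  shows "integrable (lebesgue_on \<Omega>) f \<longleftrightarrow> integrable lebesgue (\<lambda>x. indicator \<Omega> x *\<^sub>R f x)"
  by (rule integrable_restrict_space) (use assms in auto)

lemma AE_lebesgue_on_open:
  assumes "open \<Omega>"
  shows "(AE x in lebesgue_on \<Omega>. P x) \<longleftrightarrow> (AE x in lebesgue. x \<in> \<Omega> \<longrightarrow> P x)"
  by (rule AE_restrict_space_iff) (use assms in auto)

lemma integral_lebesgue_on_supported: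
  fixes f :: "'a::euclidean_space \<Rightarrow> 'b::euclidean_space"
  assumes "open \<Omega>" "\<And>x. x \<notin> \<Omega> \<Longrightarrow> f x = 0"
  shows "(LINT x|lebesgue_on \<Omega>. f x) = (LINT x|lebesgue. f x)"
proof -
  have "(\<lambda>x. indicator \<Omega> x *\<^sub>R f x) = f" using assms(2) by (auto simp: fun_eq_iff indicator_def)
  then show ?thesis by (simp add: integral_lebesgue_on_open[OF assms(1)])
qed

lemma locally_integrable_cut:
  "locally_integrable \<Omega> f \<Longrightarrow> compact K \<Longrightarrow> K \<subseteq> \<Omega> \<Longrightarrow> integrable lebesgue (\<lambda>x. indicator K x *\<^sub>R f x)"
  by (simp add: locally_integrable_def set_integrable_def)

lemma locally_integrable_measurable:
  fixes f :: "'a::euclidean_space \<Rightarrow> 'b::euclidean_space"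
  assumes "open \<Omega>" "locally_integrable \<Omega> f"
  shows "(\<lambda>x. indicator \<Omega> x *\<^sub>R f x) \<in> borel_measurable lebesgue"
proof -
  obtain C where C: "\<And>n::nat. compact (C n)" "\<And>n. C n \<subseteq> \<Omega>" "\<And>n. C n \<subseteq> interior (C (Suc n))" "\<Union> (range C) = \<Omega>"
    using open_Union_compact_subsets[OF assms(1)] by metis
  have inc: "m \<le> n \<Longrightarrow> C m \<subseteq> C n" for m n
    by (rule lift_Suc_mono_le[of C]) (use C(3) interior_subset in blast)+
  show ?thesis
  proof (rule borel_measurable_LIMSEQ_metric)
    show "(\<lambda>x. indicator (C n) x *\<^sub>R f x) \<in> borel_measurable lebesgue" for n
      using locally_integrable_cut[OF assms(2) C(1,2), of n] by auto
    fix x :: 'a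
    show "(\<lambda>n. indicator (C n) x *\<^sub>R f x) \<longlonglongrightarrow> indicator \<Omega> x *\<^sub>R f x"
    proof (cases "x \<in> \<Omega>")
      case True
      then obtain m where "x \<in> C m" using C(4) by blast
      then have "\<forall>n\<ge>m. indicator \<Omega> x *\<^sub>R f x = indicator (C n) x *\<^sub>R f x" using inc True by (auto simp: indicator_def)
      then show ?thesis
        by (intro Lim_transform_eventually[OF tendsto_const]) (auto simp: eventually_sequentially)
    next
      case False
      then have "x \<notin> C n" for n using C(2) by blast
      then show ?thesis using False by simp
    qed
  qed
qed

lemma has_weak_gradient_integral:
  fixes u :: "'a::euclidean_space \<Rightarrow> real"
  assumes "open \<Omega>" "has_weak_gradient \<Omega> u g" "test_function \<Omega> \<phi>"
    "S \<subseteq> A" "A \<subseteq> \<Omega>" "\<And>x. x \<notin> S \<Longrightarrow> \<phi> x = 0" "\<And>x. x \<notin> S \<Longrightarrow> grad \<phi> x = 0"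
  shows "(LINT x|lebesgue. (indicator A x *\<^sub>R u x) *\<^sub>R grad \<phi> x) = - (LINT x|lebesgue. \<phi> x *\<^sub>R (indicator A x *\<^sub>R g x))"
proof -
  have "(\<lambda>x. (indicator A x *\<^sub>R u x) *\<^sub>R grad \<phi> x) = (\<lambda>x. indicator \<Omega> x *\<^sub>R (u x *\<^sub>R grad \<phi> x))"
    "(\<lambda>x. \<phi> x *\<^sub>R (indicator A x *\<^sub>R g x)) = (\<lambda>x. indicator \<Omega> x *\<^sub>R (\<phi> x *\<^sub>R g x))"
    using assms(4-7) by (auto simp: fun_eq_iff indicator_def)
  then show ?thesis
    using assms(2,3) by (simp add: has_weak_gradient_def integral_lebesgue_on_open[OF assms(1)])
qed

lemma test_function_moll:
  assumes "0 < e" "cball x e \<subseteq> \<Omega>"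
  shows "test_function \<Omega> (\<lambda>y. moll e (x - y))"
    and "GDERIV (\<lambda>y. moll e (x - y)) y :> - grad (moll e) (x - y)"
    and "y \<notin> cball x e \<Longrightarrow> grad (moll e) (x - y) = 0"
proof -
  have C: "C_class k (\<lambda>y. moll e (x - y))" for k
    using C_class_affine[OF C_class_moll, of k e x "-1"] by simp
  show t: "test_function \<Omega> (\<lambda>y. moll e (x - y))"
    by (rule test_functionI[OF C compact_cball assms(2)])
       (auto simp: dist_norm intro: moll_eq_0[OF assms(1)])
  have "((\<lambda>y. moll e (x - y)) has_derivative (\<lambda>h. (- h) \<bullet> grad (moll e) (x - y))) (at y)" for y
    by (rule has_derivative_compose[where g="moll e"])
       (use C_class_1_GDERIV[OF C_class_moll, of e "x - y"] in \<open>auto simp: gderiv_def intro!: derivative_eq_intros\<close>)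
  then show d: "GDERIV (\<lambda>y. moll e (x - y)) y :> - grad (moll e) (x - y)" for y by (simp add: gderiv_def)
  show "grad (moll e) (x - y) = 0" if "y \<notin> cball x e"
  proof (rule GDERIV_zero_outside[where f="moll e" and R=e])
    show "GDERIV (moll e) (x - y) :> grad (moll e) (x - y)" by (rule C_class_1_GDERIV[OF C_class_moll])
  qed (use that moll_eq_0[OF assms(1)] in \<open>auto simp: dist_norm\<close>)
qed

text \<open>The function \<open>y \<mapsto> moll e (x - y)\<close> is itself a test function, so that the definition of the weak gradient moves
  the derivative from the kernel to the function.\<close>

lemma conv_weak_gradient:
  fixes u :: "'a::euclidean_space \<Rightarrow> real"
  assumes \<Omega>: "open \<Omega>" and w: "has_weak_gradient \<Omega> u g" and A: "compact A" "A \<subseteq> \<Omega>"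
    and e: "0 < e" and x: "cball x e \<subseteq> A"
  shows "GDERIV (conv (moll e) (\<lambda>y. indicator A y *\<^sub>R u y)) x :> conv (moll e) (\<lambda>y. indicator A y *\<^sub>R g y) x"
proof -
  have iu: "integrable lebesgue (\<lambda>y. indicator A y *\<^sub>R u y)"
    using w A by (intro locally_integrable_cut) (auto simp: has_weak_gradient_def)
  have "GDERIV (conv (moll e) (\<lambda>y. indicator A y *\<^sub>R u y)) x :>
      (LINT y|lebesgue. (indicator A y *\<^sub>R u y) *\<^sub>R grad (moll e) (x - y))"
    by (rule conv_GDERIV[OF _ _ moll_eq_0[OF e] iu])
       (use C_class_moll[of "Suc 0" e] in \<open>auto intro: C_class_1_GDERIV C_class_1_continuous_grad\<close>)
  moreover have "(LINT y|lebesgue. (indicator A y *\<^sub>R u y) *\<^sub>R grad (moll e) (x - y)) =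
      conv (moll e) (\<lambda>y. indicator A y *\<^sub>R g y) x"
  proof -
    note t = test_function_moll[OF e, of x \<Omega>]
    have g: "grad (\<lambda>y. moll e (x - y)) y = - grad (moll e) (x - y)" for y
      using t(2) x A by (intro GDERIV_imp_frechet_derivative(3)) auto
    have "(LINT y|lebesgue. (indicator A y *\<^sub>R u y) *\<^sub>R grad (\<lambda>y. moll e (x - y)) y) =
        - (LINT y|lebesgue. moll e (x - y) *\<^sub>R (indicator A y *\<^sub>R g y))"
    proof (rule has_weak_gradient_integral[OF \<Omega> w t(1) x A(2)])
      show "cball x e \<subseteq> \<Omega>" using x A by blast
      show "y \<notin> cball x e \<Longrightarrow> moll e (x - y) = 0" for y by (rule moll_eq_0[OF e]) (auto simp: dist_norm)
      show "y \<notin> cball x e \<Longrightarrow> grad (\<lambda>y. moll e (x - y)) y = 0" for y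
        using t(3)[of y] x A by (auto simp: g)
    qed
    then show ?thesis by (simp add: g conv_def)
  qed
  ultimately show ?thesis by simp
qed

text \<open>The gradient of a mollification is determined by the function alone, so the difference of two weak gradients
  has vanishing mollifications on each compact set, and these converge to the difference in \<open>L\<^sup>1\<close>.\<close>

lemma weak_gradient_unique:
  fixes u :: "'a::euclidean_space \<Rightarrow> real"
  assumes \<Omega>: "open \<Omega>" and g: "has_weak_gradient \<Omega> u g" and h: "has_weak_gradient \<Omega> u h"
  shows "AE x in lebesgue_on \<Omega>. g x = h x"
proof -
  obtain C where C: "\<And>n::nat. compact (C n)" "\<And>n. C n \<subseteq> \<Omega>" "\<Union> (range C) = \<Omega>"
    using open_Union_compact_subsets[OF \<Omega>] by metis
  have "AE x in lebesgue. x \<in> C n \<longrightarrow> g x = h x" for n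
  proof -
    obtain r where r: "0 < r" "nbhd (C n) r \<subseteq> \<Omega>" using nbhd_subset_open[OF C(1) \<Omega> C(2)] by blast
    define A where "A = nbhd (C n) r"
    have A: "compact A" "A \<subseteq> \<Omega>" using r C(1) by (auto simp: A_def compact_nbhd)
    define d where "d x = indicator A x *\<^sub>R (g x - h x)" for x
    have ig: "integrable lebesgue (\<lambda>x. indicator A x *\<^sub>R g x)" and ih: "integrable lebesgue (\<lambda>x. indicator A x *\<^sub>R h x)"
      using g h A by (auto intro!: locally_integrable_cut simp: has_weak_gradient_def)
    have d: "integrable lebesgue d" unfolding d_def using ig ih by (simp add: scaleR_diff_right)
    have "bounded A" by (rule compact_imp_bounded[OF A(1)])
    then obtain R where R: "\<And>x. x \<in> A \<Longrightarrow> norm x \<le> R" unfolding bounded_iff by blast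
    define e where "e k = r / real (Suc k)" for k
    have e: "0 < e k" "e k \<le> r" for k using r by (auto simp: e_def field_simps)
    have e0: "e \<longlonglongrightarrow> 0"
      unfolding e_def using tendsto_mult_right_zero[OF LIMSEQ_inverse_real_of_nat, of r] by (simp add: divide_inverse)
    have z: "conv (moll (e k)) d x = 0" if x: "x \<in> C n" for k x
    proof -
      have xA: "cball x (e k) \<subseteq> A"
        unfolding A_def by (rule cball_subset_nbhd[of x _ 0]) (use x e nbhd_superset[of 0] in auto)
      have "conv (moll (e k)) (\<lambda>y. indicator A y *\<^sub>R g y) x = conv (moll (e k)) (\<lambda>y. indicator A y *\<^sub>R h y) x"
        using conv_weak_gradient[OF \<Omega> g A e(1) xA] conv_weak_gradient[OF \<Omega> h A e(1) xA] by (rule GDERIV_unique)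
      then show ?thesis unfolding d_def scaleR_diff_right
        using conv_diff[OF e(1) ig ih] by simp
    qed
    have dm: "d \<in> borel_measurable lebesgue" using d by auto
    have dz: "x \<notin> cball 0 R \<Longrightarrow> d x = 0" for x using R[of x] by (auto simp: d_def indicator_def)
    have ci: "integrable lebesgue (\<lambda>x. norm (d x))" using d by simp
    then have cp: "integrable lebesgue (\<lambda>x. norm (d x) powr 1)" by simp
    have lim1: "integrable lebesgue (\<lambda>x. norm (conv (moll (e k)) d x - d x))" for k
      using mollify_Lp(1)[OF dm dz order_refl cp e(1) e0, where R=R and k=k] by simp
    have lim2: "(\<lambda>k. LINT x|lebesgue. norm (conv (moll (e k)) d x - d x)) \<longlonglongrightarrow> 0"
      using mollify_Lp(2)[OF dm dz order_refl cp e(1) e0, where R=R] by simp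
    have Cm: "C n \<in> sets lebesgue" using C(1) compact_imp_closed by (intro borel_closed[THEN sets_completionI_sets[of _ lborel, simplified]]) auto
    have iC: "integrable lebesgue (\<lambda>x. indicat_real (C n) x * norm (d x))"
      by (rule Bochner_Integration.integrable_bound[OF ci]) (use Cm dm in \<open>auto simp: indicator_def\<close>)
    have "(LINT x|lebesgue. indicat_real (C n) x * norm (d x)) \<le> 0"
    proof (rule LIMSEQ_le_const[OF lim2], intro exI allI impI)
      fix k
      show "(LINT x|lebesgue. indicat_real (C n) x * norm (d x)) \<le> (LINT x|lebesgue. norm (conv (moll (e k)) d x - d x))"
        by (rule integral_mono[OF iC lim1]) (auto simp: indicator_def z)
    qed
    then have "(LINT x|lebesgue. indicat_real (C n) x * norm (d x)) = 0"
      by (intro antisym Bochner_Integration.integral_nonneg) auto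
    then have "AE x in lebesgue. indicat_real (C n) x * norm (d x) = 0"
      using integral_nonneg_eq_0_iff_AE[OF iC] by simp
    then show ?thesis
    proof eventually_elim
      case (elim x)
      have "x \<in> C n \<Longrightarrow> x \<in> A" using nbhd_superset[of r "C n"] r by (auto simp: A_def)
      then show ?case using elim by (auto simp: d_def)
    qed
  qed
  then have "AE x in lebesgue. \<forall>n. x \<in> C n \<longrightarrow> g x = h x" unfolding AE_all_countable by blast
  then show ?thesis unfolding AE_lebesgue_on_open[OF \<Omega>]
    by eventually_elim (use C(3) in blast)
qed

section \<open>Operations on weak gradients\<close>

lemma continuous_glue:
  fixes f :: "'a::euclidean_space \<Rightarrow> 'b::real_normed_vector"
  assumes "open \<Omega>" "compact S" "S \<subseteq> \<Omega>" "continuous_on \<Omega> f" "\<And>x. x \<in> \<Omega> \<Longrightarrow> x \<notin> S \<Longrightarrow> f x = 0"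
  shows "continuous_on UNIV (\<lambda>x. indicator \<Omega> x *\<^sub>R f x)"
proof -
  have "continuous_on (\<Omega> \<union> - S) (\<lambda>x. indicator \<Omega> x *\<^sub>R f x)"
  proof (rule continuous_on_open_Un)
    show "continuous_on \<Omega> (\<lambda>x. indicator \<Omega> x *\<^sub>R f x)"
      using assms(4) by (rule continuous_on_eq) simp
    have "continuous_on (- S) (\<lambda>x. 0 :: 'b)" by simp
    then show "continuous_on (- S) (\<lambda>x. indicator \<Omega> x *\<^sub>R f x)"
      by (rule continuous_on_eq) (use assms(5) in \<open>auto simp: indicator_def\<close>)
  qed (use assms compact_imp_closed in auto)
  moreover have "\<Omega> \<union> - S = UNIV" using assms(3) by blast
  ultimately show ?thesis by simp
qed

lemma compact_norm_bound:
  assumes "compact S" obtains R where "\<And>x. x \<in> S \<Longrightarrow> norm x \<le> R"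
proof -
  have "bounded S" by (rule compact_imp_bounded[OF assms])
  then show ?thesis using that unfolding bounded_iff by blast
qed

lemma continuous_bounded_on_compact:
  fixes f :: "'a::euclidean_space \<Rightarrow> 'b::real_normed_vector"
  assumes "compact S" "continuous_on S f" obtains B where "0 \<le> B" "\<And>x. x \<in> S \<Longrightarrow> norm (f x) \<le> B"
proof -
  have "bounded (f ` S)" by (intro compact_imp_bounded compact_continuous_image assms)
  then obtain B where "\<forall>y\<in>f ` S. norm y \<le> B" unfolding bounded_iff by blast
  then show ?thesis using that[of "max B 0"] by fastforce
qed

lemma integrable_glue:
  fixes f :: "'a::euclidean_space \<Rightarrow> 'b::euclidean_space"
  assumes "open \<Omega>" "compact S" "S \<subseteq> \<Omega>" "continuous_on \<Omega> f" "\<And>x. x \<in> \<Omega> \<Longrightarrow> x \<notin> S \<Longrightarrow> f x = 0"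
  shows "integrable lborel (\<lambda>x. indicator \<Omega> x *\<^sub>R f x)" "integrable lebesgue (\<lambda>x. indicator \<Omega> x *\<^sub>R f x)"
proof -
  have c: "continuous_on UNIV (\<lambda>x. indicator \<Omega> x *\<^sub>R f x)" by (rule continuous_glue[OF assms])
  obtain R where R: "\<And>x. x \<in> S \<Longrightarrow> norm x \<le> R" using compact_norm_bound[OF assms(2)] by blast
  show 1: "integrable lborel (\<lambda>x. indicator \<Omega> x *\<^sub>R f x)"
  proof (rule compactly_supported_integrable[OF c])
    fix x :: 'a assume "R + 1 \<le> norm x"
    then have "x \<notin> S" using R[of x] by auto
    then show "indicator \<Omega> x *\<^sub>R f x = 0" using assms(5)[of x] by (auto simp: indicator_def)
  qed
  then show "integrable lebesgue (\<lambda>x. indicator \<Omega> x *\<^sub>R f x)"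
    by (subst integrable_completion) auto
qed

text \<open>The product \<open>w \<phi>\<close>, extended by zero, is \<open>C\<^sup>1\<close> on the whole space, and its gradient integrates to zero.\<close>

lemma integration_by_parts_local:
  fixes w :: "'a::euclidean_space \<Rightarrow> real"
  assumes \<Omega>: "open \<Omega>" and d: "\<And>x. x \<in> \<Omega> \<Longrightarrow> GDERIV w x :> D x" and cD: "continuous_on \<Omega> D"
    and t: "test_function \<Omega> \<phi>"
  shows "integrable lebesgue (\<lambda>x. indicator \<Omega> x *\<^sub>R (w x *\<^sub>R grad \<phi> x))"
    "integrable lebesgue (\<lambda>x. indicator \<Omega> x *\<^sub>R (\<phi> x *\<^sub>R D x))"
    "(LINT x|lebesgue. indicator \<Omega> x *\<^sub>R (w x *\<^sub>R grad \<phi> x)) = - (LINT x|lebesgue. indicator \<Omega> x *\<^sub>R (\<phi> x *\<^sub>R D x))"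
proof -
  obtain S where S: "compact S" "S \<subseteq> \<Omega>" "\<And>x. x \<notin> S \<Longrightarrow> \<phi> x = 0" "\<And>x. x \<notin> S \<Longrightarrow> grad \<phi> x = 0"
    using test_function_support[OF t] by metis
  have cw: "continuous_on \<Omega> w"
    using d by (auto simp: gderiv_def intro!: continuous_at_imp_continuous_on has_derivative_continuous)
  have c\<phi>: "continuous_on \<Omega> \<phi>" "continuous_on \<Omega> (grad \<phi>)"
    using test_function_continuous[OF t] test_function_continuous_grad[OF t] continuous_on_subset by blast+
  let ?f1 = "\<lambda>x. indicator \<Omega> x *\<^sub>R (w x *\<^sub>R grad \<phi> x)" and ?f2 = "\<lambda>x. indicator \<Omega> x *\<^sub>R (\<phi> x *\<^sub>R D x)"
  have i1: "integrable lborel ?f1" and i1': "integrable lebesgue ?f1"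
    using S by (intro integrable_glue[OF \<Omega> S(1,2)] continuous_on_scaleR cw c\<phi>; simp)+
  have i2: "integrable lborel ?f2" and i2': "integrable lebesgue ?f2"
    using S by (intro integrable_glue[OF \<Omega> S(1,2)] continuous_on_scaleR cD c\<phi>; simp)+
  show "integrable lebesgue ?f1" "integrable lebesgue ?f2" by fact+
  define P where "P x = indicator \<Omega> x *\<^sub>R (w x * \<phi> x)" for x
  define DP where "DP x = indicator \<Omega> x *\<^sub>R (w x *\<^sub>R grad \<phi> x + \<phi> x *\<^sub>R D x)" for x
  have dP: "GDERIV P x :> DP x" for x
  proof (cases "x \<in> \<Omega>")
    case True
    have "GDERIV (\<lambda>x. w x * \<phi> x) x :> DP x"
      using GDERIV_mult[OF d[OF True] test_function_GDERIV[OF t]] True by (simp add: DP_def)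
    then show ?thesis by (rule GDERIV_transform_open[OF _ \<Omega> True]) (simp add: P_def)
  next
    case False
    have "GDERIV P x :> 0"
      by (rule GDERIV_transform_open[OF GDERIV_const[of 0], of "- S"])
         (use S False in \<open>auto simp: P_def dest: compact_imp_closed\<close>)
    then show ?thesis using False by (simp add: DP_def)
  qed
  have cDP: "continuous_on UNIV DP"
    unfolding DP_def by (rule continuous_glue[OF \<Omega> S(1,2)]) (use S in \<open>auto intro!: continuous_intros cw cD c\<phi>\<close>)
  obtain R where R: "\<And>x. x \<in> S \<Longrightarrow> norm x \<le> R" using compact_norm_bound[OF S(1)] by blast
  have zP: "norm x \<ge> R + 1 \<Longrightarrow> P x = 0" for x using R[of x] S(3)[of x] by (cases "x \<in> S") (auto simp: P_def)
  have "(LINT x|lborel. DP x) = 0"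
  proof (rule euclidean_eqI)
    fix b :: 'a assume "b \<in> Basis"
    have "integrable lborel DP"
      using Bochner_Integration.integrable_add[OF i1 i2] by (simp add: DP_def[abs_def] scaleR_add_right)
    then have "(LINT x|lborel. DP x) \<bullet> b = (LINT x|lborel. b \<bullet> DP x)"
      by (simp add: inner_commute)
    then show "(LINT x|lborel. DP x) \<bullet> b = 0 \<bullet> b" using integral_gradient_zero[OF dP cDP zP] by simp
  qed
  moreover have "(LINT x|lborel. DP x) = (LINT x|lborel. ?f1 x) + (LINT x|lborel. ?f2 x)"
    using Bochner_Integration.integral_add[OF i1 i2] by (simp add: DP_def[abs_def] scaleR_add_right)
  moreover have "(LINT x|lebesgue. ?f1 x) = (LINT x|lborel. ?f1 x)" "(LINT x|lebesgue. ?f2 x) = (LINT x|lborel. ?f2 x)"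
    using i1 i2 by (auto intro!: integral_completion)
  ultimately show "(LINT x|lebesgue. ?f1 x) = - (LINT x|lebesgue. ?f2 x)" by (simp add: add_eq_0_iff2)
qed

lemma locally_integrable_continuous:
  fixes f :: "'a::euclidean_space \<Rightarrow> 'b::euclidean_space"
  assumes "continuous_on \<Omega> f" shows "locally_integrable \<Omega> f"
  unfolding locally_integrable_def set_integrable_def
proof (intro allI impI)
  fix K :: "'a set" assume K: "compact K \<and> K \<subseteq> \<Omega>"
  have "integrable lborel (\<lambda>x. indicator K x *\<^sub>R f x)"
    by (rule borel_integrable_compact) (use K assms continuous_on_subset in blast)+
  then show "integrable lebesgue (\<lambda>x. indicat_real K x *\<^sub>R f x)"
    by (subst integrable_completion) auto
qed

lemma classical_weak_gradient:
  fixes w :: "'a::euclidean_space \<Rightarrow> real"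
  assumes \<Omega>: "open \<Omega>" and d: "\<And>x. x \<in> \<Omega> \<Longrightarrow> GDERIV w x :> D x" and cD: "continuous_on \<Omega> D"
  shows "has_weak_gradient \<Omega> w D"
proof -
  have cw: "continuous_on \<Omega> w"
    using d by (auto simp: gderiv_def intro!: continuous_at_imp_continuous_on has_derivative_continuous)
  show ?thesis unfolding has_weak_gradient_def
    using integration_by_parts_local(3)[OF assms] locally_integrable_continuous[OF cw] locally_integrable_continuous[OF cD]
    by (auto simp: integral_lebesgue_on_open[OF \<Omega>])
qed

lemma locally_integrable_times:
  fixes f :: "'a::euclidean_space \<Rightarrow> 'b::euclidean_space" and h :: "'a \<Rightarrow> 'c::euclidean_space"
    and bil :: "'c \<Rightarrow> 'b \<Rightarrow> 'd::euclidean_space"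
  assumes "open \<Omega>" "locally_integrable \<Omega> f" "continuous_on UNIV h" "compact S" "S \<subseteq> \<Omega>" "\<And>x. x \<notin> S \<Longrightarrow> h x = 0"
    and bil: "bounded_bilinear bil"
  shows "integrable (lebesgue_on \<Omega>) (\<lambda>x. bil (h x) (f x))"
proof -
  interpret bounded_bilinear bil by fact
  have i: "integrable lebesgue (\<lambda>x. indicator S x *\<^sub>R f x)" by (rule locally_integrable_cut[OF assms(2,4,5)])
  obtain B where B: "0 \<le> B" "\<And>x. x \<in> S \<Longrightarrow> norm (h x) \<le> B"
    using continuous_bounded_on_compact[OF assms(4) continuous_on_subset[OF assms(3)]] by blast
  obtain C where C: "\<And>a b. norm (bil a b) \<le> norm a * norm b * C" "0 \<le> C" using nonneg_bounded by blast
  have m: "h \<in> borel_measurable lebesgue" by (rule borel_measurable_lebesgue_continuous[OF assms(3)])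
  have eq: "(\<lambda>x. indicator \<Omega> x *\<^sub>R bil (h x) (f x)) = (\<lambda>x. bil (h x) (indicator S x *\<^sub>R f x))"
    using assms(5,6) by (auto simp: fun_eq_iff indicator_def zero_left scaleR_right)
  have "integrable lebesgue (\<lambda>x. bil (h x) (indicator S x *\<^sub>R f x))"
  proof (rule Bochner_Integration.integrable_bound)
    show "integrable lebesgue (\<lambda>x. (B * C) *\<^sub>R (indicator S x *\<^sub>R f x))" by (rule integrable_scaleR_right) (rule i)
    have "(\<lambda>x. (h x, indicator S x *\<^sub>R f x)) \<in> borel_measurable lebesgue"
      using m i by (intro borel_measurable_Pair) auto
    moreover have "(\<lambda>q. bil (fst q) (snd q)) \<in> borel_measurable borel"
      by (intro borel_measurable_continuous_onI continuous_on continuous_intros)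
    ultimately have "(\<lambda>x. bil (fst (h x, indicator S x *\<^sub>R f x)) (snd (h x, indicator S x *\<^sub>R f x))) \<in> borel_measurable lebesgue"
      by (rule measurable_compose)
    then show "(\<lambda>x. bil (h x) (indicator S x *\<^sub>R f x)) \<in> borel_measurable lebesgue" by simp
    show "AE x in lebesgue. norm (bil (h x) (indicator S x *\<^sub>R f x)) \<le> norm ((B * C) *\<^sub>R (indicator S x *\<^sub>R f x))"
    proof (rule AE_I2)
      fix x
      show "norm (bil (h x) (indicator S x *\<^sub>R f x)) \<le> norm ((B * C) *\<^sub>R (indicator S x *\<^sub>R f x))"
      proof (cases "x \<in> S")
        case True
        have "norm (bil (h x) (f x)) \<le> norm (h x) * norm (f x) * C" by (rule C)
        also have "\<dots> \<le> B * norm (f x) * C" by (intro mult_right_mono B True C) auto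
        finally show ?thesis using True B C by (simp add: mult_ac)
      qed (simp add: zero_right)
    qed
  qed
  then show ?thesis by (simp add: integrable_lebesgue_on_open[OF assms(1)] eq)
qed

lemma test_function_integrable:
  fixes u :: "'a::euclidean_space \<Rightarrow> real" and g :: "'a \<Rightarrow> 'a"
  assumes "open \<Omega>" "test_function \<Omega> \<phi>"
  shows "locally_integrable \<Omega> u \<Longrightarrow> integrable (lebesgue_on \<Omega>) (\<lambda>x. u x *\<^sub>R grad \<phi> x)"
    and "locally_integrable \<Omega> g \<Longrightarrow> integrable (lebesgue_on \<Omega>) (\<lambda>x. \<phi> x *\<^sub>R g x)"
proof -
  obtain S where S: "compact S" "S \<subseteq> \<Omega>" "\<And>x. x \<notin> S \<Longrightarrow> \<phi> x = 0" "\<And>x. x \<notin> S \<Longrightarrow> grad \<phi> x = 0"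
    using test_function_support[OF assms(2)] by metis
  show "locally_integrable \<Omega> u \<Longrightarrow> integrable (lebesgue_on \<Omega>) (\<lambda>x. u x *\<^sub>R grad \<phi> x)"
    by (rule locally_integrable_times[OF assms(1) _ test_function_continuous_grad[OF assms(2)] S(1,2,4) bounded_bilinear.flip[OF bounded_bilinear_scaleR]])
  show "locally_integrable \<Omega> g \<Longrightarrow> integrable (lebesgue_on \<Omega>) (\<lambda>x. \<phi> x *\<^sub>R g x)"
    by (rule locally_integrable_times[OF assms(1) _ test_function_continuous[OF assms(2)] S(1,2,3) bounded_bilinear_scaleR])
qed

lemma locally_integrable_diff:
  "locally_integrable \<Omega> f \<Longrightarrow> locally_integrable \<Omega> g \<Longrightarrow> locally_integrable \<Omega> (\<lambda>x. f x - g x)"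
  by (auto simp: locally_integrable_def set_integrable_def scaleR_diff_right)

lemma has_weak_gradient_diff:
  fixes u v :: "'a::euclidean_space \<Rightarrow> real"
  assumes \<Omega>: "open \<Omega>" and u: "has_weak_gradient \<Omega> u g" and v: "has_weak_gradient \<Omega> v h"
  shows "has_weak_gradient \<Omega> (\<lambda>x. u x - v x) (\<lambda>x. g x - h x)"
proof -
  have l: "locally_integrable \<Omega> u" "locally_integrable \<Omega> v" "locally_integrable \<Omega> g" "locally_integrable \<Omega> h"
    using u v by (auto simp: has_weak_gradient_def)
  have "(LINT x|lebesgue_on \<Omega>. (u x - v x) *\<^sub>R grad \<phi> x) = - (LINT x|lebesgue_on \<Omega>. \<phi> x *\<^sub>R (g x - h x))"
    if t: "test_function \<Omega> \<phi>" for \<phi>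
  proof -
    note ti = test_function_integrable[OF \<Omega> t]
    have "(LINT x|lebesgue_on \<Omega>. (u x - v x) *\<^sub>R grad \<phi> x) = (LINT x|lebesgue_on \<Omega>. u x *\<^sub>R grad \<phi> x) - (LINT x|lebesgue_on \<Omega>. v x *\<^sub>R grad \<phi> x)"
      using ti(1)[OF l(1)] ti(1)[OF l(2)] by (simp add: scaleR_diff_left)
    moreover have "(LINT x|lebesgue_on \<Omega>. \<phi> x *\<^sub>R (g x - h x)) = (LINT x|lebesgue_on \<Omega>. \<phi> x *\<^sub>R g x) - (LINT x|lebesgue_on \<Omega>. \<phi> x *\<^sub>R h x)"
      using ti(2)[OF l(3)] ti(2)[OF l(4)] by (simp add: scaleR_diff_right)
    ultimately show ?thesis using u v t by (simp add: has_weak_gradient_def)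
  qed
  then show ?thesis using l by (auto simp: has_weak_gradient_def intro: locally_integrable_diff)
qed

lemma has_weak_gradient_subset:
  fixes u :: "'a::euclidean_space \<Rightarrow> real"
  assumes "open \<Omega>" "open B" "B \<subseteq> \<Omega>" "has_weak_gradient \<Omega> u g"
  shows "has_weak_gradient B u g"
proof -
  have "(LINT x|lebesgue_on B. u x *\<^sub>R grad \<phi> x) = - (LINT x|lebesgue_on B. \<phi> x *\<^sub>R g x)" if t: "test_function B \<phi>" for \<phi>
  proof -
    obtain S where S: "compact S" "S \<subseteq> B" "\<And>x. x \<notin> S \<Longrightarrow> \<phi> x = 0" "\<And>x. x \<notin> S \<Longrightarrow> grad \<phi> x = 0"
      using test_function_support[OF t] by metis
    have "(LINT x|lebesgue_on \<Omega>. u x *\<^sub>R grad \<phi> x) = - (LINT x|lebesgue_on \<Omega>. \<phi> x *\<^sub>R g x)"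
      using assms(4) test_function_mono[OF t assms(3)] by (simp add: has_weak_gradient_def)
    moreover have "x \<notin> B \<Longrightarrow> u x *\<^sub>R grad \<phi> x = 0" "x \<notin> B \<Longrightarrow> \<phi> x *\<^sub>R g x = 0"
       "x \<notin> \<Omega> \<Longrightarrow> u x *\<^sub>R grad \<phi> x = 0" "x \<notin> \<Omega> \<Longrightarrow> \<phi> x *\<^sub>R g x = 0" for x
      using S assms(3) by auto
    ultimately show ?thesis using assms(1,2) by (simp add: integral_lebesgue_on_supported)
  qed
  then show ?thesis using assms(3,4) by (auto simp: has_weak_gradient_def locally_integrable_def)
qed

text \<open>Mollify the indicator function of a neighbourhood of \<open>K\<close>.\<close>

lemma cutoff_exists:
  assumes "open B" "compact K" "K \<subseteq> B"
  obtains cut U where "test_function B cut" "open U" "K \<subseteq> U" "\<And>x. x \<in> U \<Longrightarrow> cut x = 1"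
proof -
  obtain r where r: "0 < r" "nbhd K r \<subseteq> B" using nbhd_subset_open[OF assms(2,1,3)] by blast
  define A where "A = nbhd K (r / 2)"
  define f where "f = (\<lambda>x. indicat_real A x)"
  have A: "compact A" by (simp add: A_def compact_nbhd assms(2))
  have i: "integrable lebesgue f"
    unfolding f_def using A emeasure_compact_finite[OF A] by (intro integrable_real_indicator) (auto dest: compact_imp_closed)
  define e where "e = r / 4"
  have e: "0 < e" using r by (simp add: e_def)
  define U where "U = (\<Union>x\<in>K. ball x (r / 4))"
  have t: "test_function B (conv (moll e) f)"
  proof (rule test_functionI)
    show "C_class k (conv (moll e) f)" for k by (rule C_class_conv[OF C_class_moll moll_eq_0[OF e] i])
    show "compact (nbhd K r)" by (rule compact_nbhd[OF assms(2)])
    show "nbhd K r \<subseteq> B" by fact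
    fix x assume x: "x \<notin> nbhd K r"
    show "conv (moll e) f x = 0"
    proof (rule conv_eq_0[where K=A, OF _ _ e])
      show "y \<notin> A \<Longrightarrow> f y = 0" for y by (simp add: f_def)
      fix y assume y: "y \<in> A"
      show "e \<le> norm (x - y)"
      proof (rule ccontr)
        assume "\<not> e \<le> norm (x - y)"
        then have "x \<in> cball y e" by (simp add: dist_norm norm_minus_commute)
        moreover have "cball y e \<subseteq> nbhd K r"
          using y unfolding A_def by (rule cball_subset_nbhd) (use r in \<open>simp add: e_def\<close>)
        ultimately show False using x by blast
      qed
    qed
  qed
  have one: "conv (moll e) f x = 1" if x: "x \<in> U" for x
  proof -
    have "norm (conv (moll e) f x - 1) \<le> 0"
    proof (rule conv_close[OF e i])
      fix y assume y: "norm (x - y) < e"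
      obtain z where z: "z \<in> K" "dist z x < r / 4" using x by (auto simp: U_def)
      have "dist z y \<le> dist z x + dist x y" by (rule dist_triangle)
      also have "\<dots> \<le> r / 2" using z y by (simp add: e_def dist_norm)
      finally have "y \<in> A" using z by (auto simp: A_def nbhd_def)
      then show "norm (f y - 1) \<le> 0" by (simp add: f_def)
    qed
    then show ?thesis by simp
  qed
  have "open U" "K \<subseteq> U" using r by (auto simp: U_def)
  then show ?thesis using that t one by blast
qed

lemma locally_integrable_extend:
  fixes f :: "'a::euclidean_space \<Rightarrow> 'b::euclidean_space"
  assumes "locally_integrable B f" "compact K" "K \<subseteq> B" "\<And>x. x \<notin> K \<Longrightarrow> f x = 0"
  shows "locally_integrable \<Omega> f"
  unfolding locally_integrable_def set_integrable_def
proof (intro allI impI)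
  fix C :: "'a set" assume C: "compact C \<and> C \<subseteq> \<Omega>"
  have "(\<lambda>x. indicat_real C x *\<^sub>R f x) = (\<lambda>x. indicat_real (C \<inter> K) x *\<^sub>R f x)"
    using assms(4) by (auto simp: fun_eq_iff indicator_def)
  moreover have "integrable lebesgue (\<lambda>x. indicat_real (C \<inter> K) x *\<^sub>R f x)"
    by (rule locally_integrable_cut[OF assms(1)]) (use C assms(2,3) in \<open>auto intro: compact_Int\<close>)
  ultimately show "integrable lebesgue (\<lambda>x. indicat_real C x *\<^sub>R f x)" by simp
qed

text \<open>A test function on \<open>\<Omega>\<close> becomes one on \<open>B\<close> after multiplication by a cutoff that equals \<open>1\<close> near \<open>K\<close>; this
  changes neither of the two integrals.\<close>

lemma has_weak_gradient_extend_zero: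
  fixes \<psi> :: "'a::euclidean_space \<Rightarrow> real"
  assumes \<Omega>: "open \<Omega>" and B: "open B" "B \<subseteq> \<Omega>" and w: "has_weak_gradient B \<psi> g" and K: "compact K" "K \<subseteq> B"
    and z: "\<And>x. x \<notin> K \<Longrightarrow> \<psi> x = 0" "\<And>x. x \<notin> K \<Longrightarrow> g x = 0"
  shows "has_weak_gradient \<Omega> \<psi> g"
proof -
  obtain cut U where cut: "test_function B cut" "open U" "K \<subseteq> U" "\<And>x. x \<in> U \<Longrightarrow> cut x = 1"
    using cutoff_exists[OF B(1) K] by blast
  obtain S where S: "compact S" "S \<subseteq> B" "\<And>x. x \<notin> S \<Longrightarrow> cut x = 0"
    using test_function_support[OF cut(1)] by metis
  have "(LINT x|lebesgue_on \<Omega>. \<psi> x *\<^sub>R grad \<eta> x) = - (LINT x|lebesgue_on \<Omega>. \<eta> x *\<^sub>R g x)" if t: "test_function \<Omega> \<eta>" for \<eta>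
  proof -
    let ?p = "\<lambda>x. cut x * \<eta> x"
    have C: "C_class k ?p" for k using t cut(1) by (auto simp: test_function_def intro: C_class_mult)
    have tp: "test_function B ?p" by (rule test_functionI[OF C S(1,2)]) (simp add: S(3))
    have g1: "grad ?p x = grad \<eta> x" if "x \<in> K" for x
    proof -
      have "GDERIV ?p x :> grad \<eta> x"
        by (rule GDERIV_transform_open[OF test_function_GDERIV[OF t] cut(2)]) (use cut that in auto)
      then show ?thesis by (rule GDERIV_imp_frechet_derivative(3))
    qed
    have "(LINT x|lebesgue_on B. \<psi> x *\<^sub>R grad ?p x) = - (LINT x|lebesgue_on B. ?p x *\<^sub>R g x)"
      using w tp by (simp add: has_weak_gradient_def)
    moreover have "\<psi> x *\<^sub>R grad ?p x = \<psi> x *\<^sub>R grad \<eta> x" "?p x *\<^sub>R g x = \<eta> x *\<^sub>R g x" for x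
      using z[of x] g1[of x] cut(3,4) by (cases "x \<in> K"; auto)+
    moreover have "x \<notin> B \<Longrightarrow> \<psi> x *\<^sub>R grad \<eta> x = 0" "x \<notin> B \<Longrightarrow> \<eta> x *\<^sub>R g x = 0"
       "x \<notin> \<Omega> \<Longrightarrow> \<psi> x *\<^sub>R grad \<eta> x = 0" "x \<notin> \<Omega> \<Longrightarrow> \<eta> x *\<^sub>R g x = 0" for x
      using z K B by auto
    ultimately show ?thesis using \<Omega> B by (simp add: integral_lebesgue_on_supported)
  qed
  then show ?thesis using w z locally_integrable_extend[OF _ K, of \<psi>] locally_integrable_extend[OF _ K, of g]
    by (simp add: has_weak_gradient_def)
qed

section \<open>Chain rule and approximation by test functions\<close>

lemma conv_moll_pointwise:
  fixes v :: "'a::euclidean_space \<Rightarrow> 'b::euclidean_space"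
  assumes "integrable lebesgue v" "continuous (at x) v" "\<And>k::nat. 0 < e k" "e \<longlonglongrightarrow> 0"
  shows "(\<lambda>k. conv (moll (e k)) v x) \<longlonglongrightarrow> v x"
proof (rule LIMSEQ_I)
  fix r :: real assume r: "0 < r"
  then obtain d where d: "0 < d" "\<And>y. dist y x < d \<Longrightarrow> dist (v y) (v x) < r / 2"
    using assms(2)[unfolded continuous_at_eps_delta] half_gt_zero by metis
  have "\<forall>\<^sub>F k in sequentially. e k < d" using assms(4) d(1) by (rule order_tendstoD)
  then obtain k0 where k0: "\<And>k. k \<ge> k0 \<Longrightarrow> e k < d" unfolding eventually_sequentially by blast
  have "norm (conv (moll (e k)) v x - v x) < r" if "k \<ge> k0" for k
  proof -
    have "norm (conv (moll (e k)) v x - v x) \<le> r / 2"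
    proof (rule conv_close[OF assms(3,1)])
      fix y assume "norm (x - y) < e k"
      then have "dist y x < d" using k0[OF that] by (simp add: dist_norm norm_minus_commute)
      then show "norm (v y - v x) \<le> r / 2" using d(2)[of y] by (simp add: dist_norm)
    qed
    then show ?thesis using r by linarith
  qed
  then show "\<exists>no. \<forall>k\<ge>no. norm (conv (moll (e k)) v x - v x) < r" by blast
qed

text \<open>Mollify \<open>v\<close> near the support of the test function, apply the classical chain rule and integrate by parts.
  Continuity of \<open>v\<close> gives bounded pointwise convergence of the mollifications, so that only
  the values of \<open>G\<close> and \<open>G'\<close> on a bounded interval matter; their gradients converge in \<open>L\<^sup>1\<close>.\<close>

lemma has_weak_gradient_chain:
  fixes v :: "'a::euclidean_space \<Rightarrow> real"
  assumes \<Omega>: "open \<Omega>" and w: "has_weak_gradient \<Omega> v g" and cv: "continuous_on \<Omega> v"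
    and G: "\<And>t. DERIV G t :> G' t" and cG': "continuous_on UNIV G'"
  shows "has_weak_gradient \<Omega> (\<lambda>x. G (v x)) (\<lambda>x. G' (v x) *\<^sub>R g x)"
proof -
  have cG: "continuous_on UNIV G" using G by (meson DERIV_continuous_on has_field_derivative_at_within)
  have cGv: "continuous_on \<Omega> (\<lambda>x. G (v x))" "continuous_on \<Omega> (\<lambda>x. G' (v x))"
    by (rule continuous_on_compose2[OF cG cv] continuous_on_compose2[OF cG' cv]; simp)+
  have lg: "locally_integrable \<Omega> g" "locally_integrable \<Omega> v" using w by (auto simp: has_weak_gradient_def)
  have l2: "locally_integrable \<Omega> (\<lambda>x. G' (v x) *\<^sub>R g x)"
    unfolding locally_integrable_def set_integrable_def
  proof (intro allI impI)
    fix K :: "'a set" assume "compact K \<and> K \<subseteq> \<Omega>"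
    then have K: "compact K" "K \<subseteq> \<Omega>" by auto
    obtain B where B: "0 \<le> B" "\<And>x. x \<in> K \<Longrightarrow> norm (G' (v x)) \<le> B"
      using continuous_bounded_on_compact[OF K(1) continuous_on_subset[OF cGv(2) K(2)]] by blast
    have i: "integrable lebesgue (\<lambda>x. indicator K x *\<^sub>R g x)" by (rule locally_integrable_cut[OF lg(1) K])
    have m: "(\<lambda>x. indicator K x *\<^sub>R G' (v x)) \<in> borel_measurable lebesgue"
      using locally_integrable_cut[OF locally_integrable_continuous[OF cGv(2)] K] by auto
    show "integrable lebesgue (\<lambda>x. indicat_real K x *\<^sub>R G' (v x) *\<^sub>R g x)"
    proof (rule Bochner_Integration.integrable_bound)
      show "integrable lebesgue (\<lambda>x. B *\<^sub>R (indicator K x *\<^sub>R g x))" by (rule integrable_scaleR_right) (rule i)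
      have "(\<lambda>x. (indicator K x *\<^sub>R G' (v x)) *\<^sub>R (indicator K x *\<^sub>R g x)) \<in> borel_measurable lebesgue"
        by (rule borel_measurable_scaleR[OF m borel_measurable_integrable[OF i]])
      moreover have "(\<lambda>x. (indicator K x *\<^sub>R G' (v x)) *\<^sub>R (indicator K x *\<^sub>R g x)) = (\<lambda>x. indicat_real K x *\<^sub>R G' (v x) *\<^sub>R g x)"
        by (auto simp: fun_eq_iff indicator_def)
      ultimately show "(\<lambda>x. indicat_real K x *\<^sub>R G' (v x) *\<^sub>R g x) \<in> borel_measurable lebesgue" by simp
      show "AE x in lebesgue. norm (indicat_real K x *\<^sub>R G' (v x) *\<^sub>R g x) \<le> norm (B *\<^sub>R (indicator K x *\<^sub>R g x))"
        using B by (auto intro!: AE_I2 mult_right_mono simp: indicator_def)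
    qed
  qed
  have "(LINT x|lebesgue_on \<Omega>. G (v x) *\<^sub>R grad \<eta> x) = - (LINT x|lebesgue_on \<Omega>. \<eta> x *\<^sub>R (G' (v x) *\<^sub>R g x))"
    if t: "test_function \<Omega> \<eta>" for \<eta>
  proof -
    obtain S where S: "compact S" "S \<subseteq> \<Omega>" "\<And>x. x \<notin> S \<Longrightarrow> \<eta> x = 0" "\<And>x. x \<notin> S \<Longrightarrow> grad \<eta> x = 0"
      using test_function_support[OF t] by metis
    obtain r where r: "0 < r" "nbhd S r \<subseteq> \<Omega>" using nbhd_subset_open[OF S(1) \<Omega> S(2)] by blast
    define A where "A = nbhd S r"
    have A: "compact A" "A \<subseteq> \<Omega>" using r S(1) by (auto simp: A_def compact_nbhd)
    have SA: "S \<subseteq> A" using nbhd_superset[of r S] r by (simp add: A_def)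
    define e where "e k = r / real (Suc k)" for k
    have e: "0 < e k" "e k \<le> r" for k using r by (auto simp: e_def field_simps)
    have e0: "e \<longlonglongrightarrow> 0"
      unfolding e_def using tendsto_mult_right_zero[OF LIMSEQ_inverse_real_of_nat, of r] by (simp add: divide_inverse)
    define f where "f = (\<lambda>y. indicat_real A y *\<^sub>R v y)"
    define h where "h = (\<lambda>y. indicat_real A y *\<^sub>R g y)"
    have fi: "integrable lebesgue f" and hi: "integrable lebesgue h"
      unfolding f_def h_def by (rule locally_integrable_cut[OF lg(2) A], rule locally_integrable_cut[OF lg(1) A])
    define vk where "vk k = conv (moll (e k)) f" for k
    have sub: "cball x (e k) \<subseteq> A" if "x \<in> S" for x k
      unfolding A_def by (rule cball_subset_nbhd[of x _ 0]) (use that e nbhd_superset[of 0] in auto)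
    have Cvk: "C_class (Suc 0) (vk k)" for k
      unfolding vk_def by (rule C_class_conv[OF C_class_moll moll_eq_0[OF e(1)] fi])
    have dvk: "grad (vk k) x = conv (moll (e k)) h x" if "x \<in> S" for k x
      unfolding vk_def f_def h_def
      by (rule GDERIV_imp_frechet_derivative(3)[OF conv_weak_gradient[OF \<Omega> w A e(1) sub[OF that]]])
    obtain B where B: "0 \<le> B" "\<And>x. x \<in> A \<Longrightarrow> norm (v x) \<le> B"
      using continuous_bounded_on_compact[OF A(1) continuous_on_subset[OF cv A(2)]] by blast
    have fB: "norm (f x) \<le> B" for x using B by (auto simp: f_def indicator_def)
    have vkB: "\<bar>vk k x\<bar> \<le> B" for k x
      using conv_close[OF e(1) fi, of x k 0 B] fB by (simp add: vk_def)
    have fv: "f x = v x" if "x \<in> S" for x using that SA by (auto simp: f_def)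
    have vklim: "(\<lambda>k. vk k x) \<longlonglongrightarrow> v x" if "x \<in> S" for x
    proof -
      have ball: "ball x (e 0) \<subseteq> A" using sub[OF that, of 0] ball_subset_cball by (rule subset_trans[rotated])
      have "isCont v x"
        using cv \<Omega> S(2) that continuous_on_eq_continuous_at by blast
      moreover have "\<forall>\<^sub>F y in nhds x. v y = f y"
        unfolding eventually_nhds
        by (rule exI[of _ "ball x (e 0)"]) (use ball e(1)[of 0] in \<open>auto simp: f_def subset_iff\<close>)
      ultimately have "isCont f x" by (rule iffD1[OF isCont_cong, rotated])
      then show ?thesis unfolding vk_def using conv_moll_pointwise[OF fi _ e(1) e0, of x] fv[OF that] by simp
    qed
    obtain CG where CG: "0 \<le> CG" "\<And>t. t \<in> {-B..B} \<Longrightarrow> norm (G t) \<le> CG"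
      using continuous_bounded_on_compact[of "{-B..B}" G] continuous_on_subset[OF cG] by auto
    obtain CG' where CG': "0 \<le> CG'" "\<And>t. t \<in> {-B..B} \<Longrightarrow> norm (G' t) \<le> CG'"
      using continuous_bounded_on_compact[of "{-B..B}" G'] continuous_on_subset[OF cG'] by auto
    have vB: "v x \<in> {-B..B}" if "x \<in> S" for x using B(2)[of x] SA that by auto
    have vkB': "vk k x \<in> {-B..B}" for k x using vkB[of k x] by auto
    have c\<eta>: "continuous_on UNIV \<eta>" "continuous_on UNIV (grad \<eta>)"
      by (rule test_function_continuous[OF t] test_function_continuous_grad[OF t])+
    obtain C\<eta> where C\<eta>: "0 \<le> C\<eta>" "\<And>x. x \<in> S \<Longrightarrow> norm (\<eta> x) \<le> C\<eta>"
      using continuous_bounded_on_compact[OF S(1) continuous_on_subset[OF c\<eta>(1)]] by auto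
    have [measurable]: "\<eta> \<in> borel_measurable lebesgue" "grad \<eta> \<in> borel_measurable lebesgue"
      "vk k \<in> borel_measurable lebesgue" "G \<in> borel_measurable borel" "G' \<in> borel_measurable borel"
      "h \<in> borel_measurable lebesgue" "conv (moll (e k)) h \<in> borel_measurable lebesgue" "f \<in> borel_measurable lebesgue" for k
      using c\<eta> C_class_continuous[OF Cvk] cG cG' hi fi conv_moll_continuous[OF e(1) hi]
      by (auto intro: borel_measurable_lebesgue_continuous borel_measurable_continuous_onI)
    have parts: "(LINT x|lebesgue. G (vk k x) *\<^sub>R grad \<eta> x) = - (LINT x|lebesgue. \<eta> x *\<^sub>R (G' (vk k x) *\<^sub>R conv (moll (e k)) h x))" for k
    proof -
      have d: "GDERIV (\<lambda>x. G (vk k x)) x :> G' (vk k x) *\<^sub>R grad (vk k) x" for x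
        by (rule GDERIV_DERIV_compose[OF C_class_1_GDERIV[OF Cvk] G])
      have c: "continuous_on UNIV (\<lambda>x. G' (vk k x) *\<^sub>R grad (vk k) x)"
        by (intro continuous_on_scaleR continuous_on_compose2[OF cG' C_class_continuous[OF Cvk]] C_class_1_continuous_grad[OF Cvk]) auto
      have "(LINT x|lebesgue. G (vk k x) *\<^sub>R grad \<eta> x) = - (LINT x|lebesgue. \<eta> x *\<^sub>R (G' (vk k x) *\<^sub>R grad (vk k) x))"
        using integration_by_parts_local(3)[OF open_UNIV d c test_function_mono[OF t]] by simp
      moreover have "\<eta> x *\<^sub>R (G' (vk k x) *\<^sub>R grad (vk k) x) = \<eta> x *\<^sub>R (G' (vk k x) *\<^sub>R conv (moll (e k)) h x)" for x
        using S(3)[of x] dvk[of x k] by (cases "x \<in> S") auto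
      ultimately show ?thesis by (simp only:)
    qed
    have lhs: "(\<lambda>k. LINT x|lebesgue. G (vk k x) *\<^sub>R grad \<eta> x) \<longlonglongrightarrow> (LINT x|lebesgue. G (f x) *\<^sub>R grad \<eta> x)"
    proof (rule integral_dominated_convergence[where w="\<lambda>x. CG * norm (grad \<eta> x)"])
      have "integrable lebesgue (\<lambda>x. indicator UNIV x *\<^sub>R grad \<eta> x)"
        by (rule integrable_glue(2)[OF open_UNIV S(1)]) (use c\<eta> S in auto)
      then show "integrable lebesgue (\<lambda>x. CG * norm (grad \<eta> x))" by simp
      show "AE x in lebesgue. (\<lambda>k. G (vk k x) *\<^sub>R grad \<eta> x) \<longlonglongrightarrow> G (f x) *\<^sub>R grad \<eta> x"
      proof (rule AE_I2)
        fix x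
        show "(\<lambda>k. G (vk k x) *\<^sub>R grad \<eta> x) \<longlonglongrightarrow> G (f x) *\<^sub>R grad \<eta> x"
        proof (cases "x \<in> S")
          case True
          have "(\<lambda>k. G (vk k x)) \<longlonglongrightarrow> G (f x)"
            using continuous_on_tendsto_compose[OF cG vklim[OF True]] fv[OF True] by simp
          then show ?thesis by (intro tendsto_intros)
        qed (simp add: S(4))
      qed
      show "AE x in lebesgue. norm (G (vk k x) *\<^sub>R grad \<eta> x) \<le> CG * norm (grad \<eta> x)" for k
        using CG(2)[OF vkB'] by (auto intro!: AE_I2 mult_right_mono)
    qed measurable
    have rhs: "(\<lambda>k. LINT x|lebesgue. \<eta> x *\<^sub>R (G' (vk k x) *\<^sub>R conv (moll (e k)) h x)) \<longlonglongrightarrow> (LINT x|lebesgue. \<eta> x *\<^sub>R (G' (f x) *\<^sub>R h x))"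
    proof -
      obtain R where R: "\<And>x. x \<in> A \<Longrightarrow> norm x \<le> R" using compact_norm_bound[OF A(1)] by blast
      have hz: "x \<notin> cball 0 R \<Longrightarrow> h x = 0" for x using R[of x] by (auto simp: h_def indicator_def)
      have hp: "integrable lebesgue (\<lambda>x. norm (h x) powr 1)" using hi by simp
      have m1: "integrable lebesgue (\<lambda>x. norm (conv (moll (e k)) h x - h x))" for k
        using mollify_Lp(1)[OF _ hz order_refl hp e(1) e0, where R=R and k=k] by simp
      have m2: "(\<lambda>k. LINT x|lebesgue. norm (conv (moll (e k)) h x - h x)) \<longlonglongrightarrow> 0"
        using mollify_Lp(2)[OF _ hz order_refl hp e(1) e0, where R=R] by simp
      have b1: "norm (\<eta> x *\<^sub>R (G' (vk k x) *\<^sub>R (conv (moll (e k)) h x - h x))) \<le> (C\<eta> * CG') * norm (conv (moll (e k)) h x - h x)" for k x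
      proof (cases "x \<in> S")
        case True
        have "\<bar>\<eta> x\<bar> * (\<bar>G' (vk k x)\<bar> * norm (conv (moll (e k)) h x - h x)) \<le> C\<eta> * (CG' * norm (conv (moll (e k)) h x - h x))"
          using C\<eta>(2)[OF True] CG'(2)[OF vkB', of k x] C\<eta>(1) by (intro mult_mono mult_right_mono) auto
        then show ?thesis by (simp add: mult.assoc abs_mult)
      qed (simp add: S(3) C\<eta> CG')
      have b2: "norm (\<eta> x *\<^sub>R (G' (vk k x) *\<^sub>R h x)) \<le> (C\<eta> * CG') * norm (h x)" for k x
      proof (cases "x \<in> S")
        case True
        have "\<bar>\<eta> x\<bar> * (\<bar>G' (vk k x)\<bar> * norm (h x)) \<le> C\<eta> * (CG' * norm (h x))"
          using C\<eta>(2)[OF True] CG'(2)[OF vkB', of k x] C\<eta>(1) by (intro mult_mono mult_right_mono) auto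
        then show ?thesis by (simp add: mult.assoc abs_mult)
      qed (simp add: S(3) C\<eta> CG')
      have i1: "integrable lebesgue (\<lambda>x. \<eta> x *\<^sub>R (G' (vk k x) *\<^sub>R (conv (moll (e k)) h x - h x)))" for k
        by (rule Bochner_Integration.integrable_bound[where f="\<lambda>x. (C\<eta> * CG') * norm (conv (moll (e k)) h x - h x)"])
           (use m1[of k] b1[of _ k] C\<eta> CG' in \<open>auto intro!: AE_I2\<close>)
      have i2: "integrable lebesgue (\<lambda>x. \<eta> x *\<^sub>R (G' (vk k x) *\<^sub>R h x))" for k
        by (rule Bochner_Integration.integrable_bound[where f="\<lambda>x. (C\<eta> * CG') * norm (h x)"])
           (use hi b2[of _ k] C\<eta> CG' in \<open>auto intro!: AE_I2\<close>)
      have "(\<lambda>k. LINT x|lebesgue. \<eta> x *\<^sub>R (G' (vk k x) *\<^sub>R (conv (moll (e k)) h x - h x))) \<longlonglongrightarrow> 0"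
      proof (rule Lim_null_comparison)
        show "\<forall>\<^sub>F k in sequentially. norm (LINT x|lebesgue. \<eta> x *\<^sub>R (G' (vk k x) *\<^sub>R (conv (moll (e k)) h x - h x)))
            \<le> (C\<eta> * CG') * (LINT x|lebesgue. norm (conv (moll (e k)) h x - h x))"
        proof (rule always_eventually, rule allI)
          fix k
          have "norm (LINT x|lebesgue. \<eta> x *\<^sub>R (G' (vk k x) *\<^sub>R (conv (moll (e k)) h x - h x)))
            \<le> (LINT x|lebesgue. (C\<eta> * CG') * norm (conv (moll (e k)) h x - h x))"
            by (rule norm_integral_le[OF i1 integrable_mult_right[OF m1] b1])
          then show "norm (LINT x|lebesgue. \<eta> x *\<^sub>R (G' (vk k x) *\<^sub>R (conv (moll (e k)) h x - h x)))
            \<le> (C\<eta> * CG') * (LINT x|lebesgue. norm (conv (moll (e k)) h x - h x))" by simp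
        qed
        show "(\<lambda>k. (C\<eta> * CG') * (LINT x|lebesgue. norm (conv (moll (e k)) h x - h x))) \<longlonglongrightarrow> 0"
          using tendsto_mult_right_zero[OF m2] by simp
      qed
      moreover have "(\<lambda>k. LINT x|lebesgue. \<eta> x *\<^sub>R (G' (vk k x) *\<^sub>R h x)) \<longlonglongrightarrow> (LINT x|lebesgue. \<eta> x *\<^sub>R (G' (f x) *\<^sub>R h x))"
      proof (rule integral_dominated_convergence[where w="\<lambda>x. (C\<eta> * CG') * norm (h x)"])
        show "integrable lebesgue (\<lambda>x. (C\<eta> * CG') * norm (h x))" using hi by simp
        show "AE x in lebesgue. (\<lambda>k. \<eta> x *\<^sub>R (G' (vk k x) *\<^sub>R h x)) \<longlonglongrightarrow> \<eta> x *\<^sub>R (G' (f x) *\<^sub>R h x)"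
        proof (rule AE_I2)
          fix x
          show "(\<lambda>k. \<eta> x *\<^sub>R (G' (vk k x) *\<^sub>R h x)) \<longlonglongrightarrow> \<eta> x *\<^sub>R (G' (f x) *\<^sub>R h x)"
          proof (cases "x \<in> S")
            case True
            have "(\<lambda>k. G' (vk k x)) \<longlonglongrightarrow> G' (f x)"
              using continuous_on_tendsto_compose[OF cG' vklim[OF True]] fv[OF True] by simp
            then show ?thesis by (intro tendsto_intros)
          qed (simp add: S(3))
        qed
      qed (use b2 in \<open>auto intro!: AE_I2\<close>)
      ultimately have "(\<lambda>k. (LINT x|lebesgue. \<eta> x *\<^sub>R (G' (vk k x) *\<^sub>R (conv (moll (e k)) h x - h x))) + (LINT x|lebesgue. \<eta> x *\<^sub>R (G' (vk k x) *\<^sub>R h x)))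
          \<longlonglongrightarrow> 0 + (LINT x|lebesgue. \<eta> x *\<^sub>R (G' (f x) *\<^sub>R h x))" by (rule tendsto_add)
      moreover have "(LINT x|lebesgue. \<eta> x *\<^sub>R (G' (vk k x) *\<^sub>R (conv (moll (e k)) h x - h x))) + (LINT x|lebesgue. \<eta> x *\<^sub>R (G' (vk k x) *\<^sub>R h x))
         = (LINT x|lebesgue. \<eta> x *\<^sub>R (G' (vk k x) *\<^sub>R conv (moll (e k)) h x))" for k
        by (subst Bochner_Integration.integral_add[OF i1 i2, symmetric]) (simp flip: scaleR_add_right)
      ultimately show ?thesis by simp
    qed
    have "(LINT x|lebesgue. G (f x) *\<^sub>R grad \<eta> x) = - (LINT x|lebesgue. \<eta> x *\<^sub>R (G' (f x) *\<^sub>R h x))"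
      using LIMSEQ_unique[OF lhs] tendsto_minus[OF rhs] unfolding parts by blast
    moreover have fv_eq: "G (f x) *\<^sub>R grad \<eta> x = G (v x) *\<^sub>R grad \<eta> x" "\<eta> x *\<^sub>R (G' (f x) *\<^sub>R h x) = \<eta> x *\<^sub>R (G' (v x) *\<^sub>R g x)" for x
      using S(3,4)[of x] fv[of x] SA by (cases "x \<in> S"; auto simp: h_def)+
    moreover have "(LINT x|lebesgue_on \<Omega>. G (v x) *\<^sub>R grad \<eta> x) = (LINT x|lebesgue. G (v x) *\<^sub>R grad \<eta> x)"
      "(LINT x|lebesgue_on \<Omega>. \<eta> x *\<^sub>R (G' (v x) *\<^sub>R g x)) = (LINT x|lebesgue. \<eta> x *\<^sub>R (G' (v x) *\<^sub>R g x))"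
      by (rule integral_lebesgue_on_supported[OF \<Omega>]; use S in auto)+
    ultimately show ?thesis by (simp only: fv_eq)
  qed
  then show ?thesis using l2 locally_integrable_continuous[OF cGv(1)] by (auto simp: has_weak_gradient_def)
qed

text \<open>The radii of mollification stay below half the width of a neighbourhood of \<open>K\<close> in \<open>\<Omega>\<close>.  The mollifications then
  have supports in one fixed compact set, and the gradient of a mollification is the mollification of the
  gradient everywhere.  The lemma is used with the exponent of the equation and with exponent \<open>1\<close>.\<close>

lemma mollified_approx:
  fixes \<psi> :: "'a::euclidean_space \<Rightarrow> real"
  assumes \<Omega>: "open \<Omega>" and w: "has_weak_gradient \<Omega> \<psi> g" and K: "compact K" "K \<subseteq> \<Omega>"
    and z: "\<And>x. x \<notin> K \<Longrightarrow> \<psi> x = 0" "\<And>x. x \<notin> K \<Longrightarrow> g x = 0" and p: "p \<ge> 1"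
    and ip: "integrable lebesgue (\<lambda>x. norm (\<psi> x) powr p)" "integrable lebesgue (\<lambda>x. norm (g x) powr p)"
  obtains \<phi> K' where "compact K'" "K' \<subseteq> \<Omega>" "K \<subseteq> K'" "\<And>k::nat. test_function \<Omega> (\<phi> k)"
    "\<And>k x. x \<notin> K' \<Longrightarrow> \<phi> k x = 0" "\<And>k x. x \<notin> K' \<Longrightarrow> grad (\<phi> k) x = 0"
    "\<And>k. integrable lebesgue (\<lambda>x. norm (\<phi> k x - \<psi> x) powr p)"
    "\<And>k. integrable lebesgue (\<lambda>x. norm (grad (\<phi> k) x - g x) powr p)"
    "(\<lambda>k. LINT x|lebesgue. norm (\<phi> k x - \<psi> x) powr p) \<longlonglongrightarrow> 0"
    "(\<lambda>k. LINT x|lebesgue. norm (grad (\<phi> k) x - g x) powr p) \<longlonglongrightarrow> 0"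
proof -
  obtain r where r: "0 < r" "nbhd K r \<subseteq> \<Omega>" using nbhd_subset_open[OF K(1) \<Omega> K(2)] by blast
  define A where "A = nbhd K r"
  have A: "compact A" "A \<subseteq> \<Omega>" using r K(1) by (auto simp: A_def compact_nbhd)
  have KA: "K \<subseteq> A" using nbhd_superset[of r K] r by (simp add: A_def)
  define s where "s = r / 2"
  have s: "0 < s" "s \<le> r / 2" using r by (auto simp: s_def)
  define e where "e k = s / real (Suc k)" for k
  have e_s: "0 < e k" "e k \<le> s" for k using s by (auto simp: e_def field_simps)
  then have e: "0 < e k" "e k \<le> r / 2" for k using s(2) order_trans by blast+
  have e0: "e \<longlonglongrightarrow> 0"
    unfolding e_def using tendsto_mult_right_zero[OF LIMSEQ_inverse_real_of_nat, of s] by (simp add: divide_inverse)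
  define \<phi> where "\<phi> k = conv (moll (e k)) \<psi>" for k
  define K' where "K' = nbhd K (r / 2)"
  have K': "compact K'" "K' \<subseteq> \<Omega>" "K \<subseteq> K'"
    using r K compact_nbhd nbhd_mono[of "r/2" r K] nbhd_superset[of "r/2" K] by (auto simp: K'_def)
  have eqA: "(\<lambda>x. indicat_real A x *\<^sub>R \<psi> x) = \<psi>" "(\<lambda>x. indicat_real A x *\<^sub>R g x) = g"
    using z KA by (auto simp: fun_eq_iff indicator_def)
  have l: "locally_integrable \<Omega> \<psi>" "locally_integrable \<Omega> g" using w by (auto simp: has_weak_gradient_def)
  have i: "integrable lebesgue \<psi>" "integrable lebesgue g"
    using locally_integrable_cut[OF l(1) A] locally_integrable_cut[OF l(2) A] by (simp_all only: eqA)
  have far: "conv (moll (e k)) \<psi> x = 0" "conv (moll (e k)) g x = 0" if "x \<notin> K'" for k x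
  proof -
    have "e k \<le> norm (x - y)" if y: "y \<in> K" for y
      using nbhd_far[of x K "r/2" y] \<open>x \<notin> K'\<close> y e(2)[of k] by (simp add: K'_def)
    then show "conv (moll (e k)) \<psi> x = 0" "conv (moll (e k)) g x = 0"
      using z by (auto intro!: conv_eq_0[where K=K] e(1))
  qed
  have C: "C_class n (\<phi> k)" for n k
    unfolding \<phi>_def by (rule C_class_conv[OF C_class_moll moll_eq_0[OF e(1)] i(1)])
  have t: "test_function \<Omega> (\<phi> k)" for k
    by (rule test_functionI[OF C K'(1,2)]) (simp add: \<phi>_def far)
  have gr: "grad (\<phi> k) x = conv (moll (e k)) g x" for k x
  proof (cases "x \<in> K'")
    case True
    have "cball x (e k) \<subseteq> A"
      unfolding A_def by (rule cball_subset_nbhd[OF True[unfolded K'_def]]) (use e(2)[of k] in simp)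
    from conv_weak_gradient[OF \<Omega> w A e(1) this] show ?thesis
      unfolding eqA \<phi>_def by (rule GDERIV_imp_frechet_derivative(3))
  next
    case False
    have "GDERIV (\<phi> k) x :> 0"
      by (rule GDERIV_transform_open[OF GDERIV_const[of 0], of "- K'"])
         (use K' False in \<open>auto simp: \<phi>_def far dest: compact_imp_closed\<close>)
    then show ?thesis using GDERIV_imp_frechet_derivative(3) far(2)[OF False] by metis
  qed
  obtain R where R: "\<And>x. x \<in> K \<Longrightarrow> norm x \<le> R" using compact_norm_bound[OF K(1)] by blast
  have zR: "x \<notin> cball 0 R \<Longrightarrow> \<psi> x = 0" "x \<notin> cball 0 R \<Longrightarrow> g x = 0" for x
    using R[of x] z[of x] by auto
  have m: "\<psi> \<in> borel_measurable lebesgue" "g \<in> borel_measurable lebesgue" using i by auto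
  show ?thesis
  proof (rule that[OF K' t])
    show "x \<notin> K' \<Longrightarrow> \<phi> k x = 0" "x \<notin> K' \<Longrightarrow> grad (\<phi> k) x = 0" for k x
      using far gr by (auto simp: \<phi>_def)
    show "integrable lebesgue (\<lambda>x. norm (\<phi> k x - \<psi> x) powr p)" for k
      unfolding \<phi>_def by (rule mollify_Lp(1)[OF m(1) zR(1) p ip(1) e(1) e0])
    show "integrable lebesgue (\<lambda>x. norm (grad (\<phi> k) x - g x) powr p)" for k
      unfolding gr by (rule mollify_Lp(1)[OF m(2) zR(2) p ip(2) e(1) e0])
    show "(\<lambda>k. LINT x|lebesgue. norm (\<phi> k x - \<psi> x) powr p) \<longlonglongrightarrow> 0"
      unfolding \<phi>_def by (rule mollify_Lp(2)[OF m(1) zR(1) p ip(1) e(1) e0])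
    show "(\<lambda>k. LINT x|lebesgue. norm (grad (\<phi> k) x - g x) powr p) \<longlonglongrightarrow> 0"
      unfolding gr by (rule mollify_Lp(2)[OF m(2) zR(2) p ip(2) e(1) e0])
  qed
qed

section \<open>Membership in \<open>W\<^sub>0\<^sup>1\<^sup>,\<^sup>p\<close> and the divergence theorem\<close>

lemma has_weak_gradient_measurable:
  fixes u :: "'a::euclidean_space \<Rightarrow> real"
  assumes "open \<Omega>" "has_weak_gradient \<Omega> u g"
  shows "u \<in> borel_measurable (lebesgue_on \<Omega>)" "g \<in> borel_measurable (lebesgue_on \<Omega>)"
  using locally_integrable_measurable[OF assms(1), of u] locally_integrable_measurable[OF assms(1), of g] assms
  by (auto simp: has_weak_gradient_def borel_measurable_restrict_space_iff)

lemma weak_grad_works: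
  fixes u :: "'a::euclidean_space \<Rightarrow> real"
  assumes "open \<Omega>" "has_weak_gradient \<Omega> u g"
  shows "has_weak_gradient \<Omega> u (weak_grad \<Omega> u)" "AE x in lebesgue_on \<Omega>. weak_grad \<Omega> u x = g x"
proof -
  show "has_weak_gradient \<Omega> u (weak_grad \<Omega> u)"
    unfolding weak_grad_def by (rule someI[of _ g]) (rule assms)
  from weak_gradient_unique[OF assms(1) this assms(2)] show "AE x in lebesgue_on \<Omega>. weak_grad \<Omega> u x = g x" .
qed

lemma integrable_lebesgue_on_supported:
  fixes f :: "'a::euclidean_space \<Rightarrow> 'b::euclidean_space"
  assumes "open \<Omega>" "\<And>x. x \<notin> \<Omega> \<Longrightarrow> f x = 0"
  shows "integrable (lebesgue_on \<Omega>) f \<longleftrightarrow> integrable lebesgue f"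
proof -
  have "(\<lambda>x. indicator \<Omega> x *\<^sub>R f x) = f" using assms(2) by (auto simp: fun_eq_iff indicator_def)
  then show ?thesis by (simp add: integrable_lebesgue_on_open[OF assms(1)])
qed

text \<open>The mollifications are the approximating test functions.  The norm involves a chosen weak
  gradient, which uniqueness identifies almost everywhere with the expected one.\<close>

lemma sobolev_W1_0I:
  fixes \<psi> :: "'a::euclidean_space \<Rightarrow> real"
  assumes \<Omega>: "open \<Omega>" and w: "has_weak_gradient \<Omega> \<psi> g" and K: "compact K" "K \<subseteq> \<Omega>"
    and z: "\<And>x. x \<notin> K \<Longrightarrow> \<psi> x = 0" "\<And>x. x \<notin> K \<Longrightarrow> g x = 0" and p: "p \<ge> 1"
    and ip: "integrable lebesgue (\<lambda>x. norm (\<psi> x) powr p)" "integrable lebesgue (\<lambda>x. norm (g x) powr p)"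
  shows "\<psi> \<in> sobolev_W1_0 p \<Omega>"
proof -
  have z\<Omega>: "\<psi> x = 0" "g x = 0" if "x \<notin> \<Omega>" for x using z K that by blast+
  have m: "\<psi> \<in> borel_measurable (lebesgue_on \<Omega>)" "g \<in> borel_measurable (lebesgue_on \<Omega>)"
    using has_weak_gradient_measurable[OF \<Omega> w] .
  have z0: "norm (\<psi> x) powr p = 0" "norm (g x) powr p = 0" if "x \<notin> \<Omega>" for x using z\<Omega>[OF that] by auto
  have "integrable (lebesgue_on \<Omega>) (\<lambda>x. norm (\<psi> x) powr p)"
    by (rule iffD2[OF integrable_lebesgue_on_supported[OF \<Omega>] ip(1)]) (rule z0)
  moreover have "integrable (lebesgue_on \<Omega>) (\<lambda>x. norm (g x) powr p)"
    by (rule iffD2[OF integrable_lebesgue_on_supported[OF \<Omega>] ip(2)]) (rule z0)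
  ultimately have "\<psi> \<in> Lp_space p \<Omega>" "g \<in> Lp_space p \<Omega>"
    using m unfolding Lp_space_def by blast+
  then have W: "\<psi> \<in> sobolev_W1 p \<Omega>" using w unfolding sobolev_W1_def by blast
  obtain \<phi> K' where \<phi>: "compact K'" "K' \<subseteq> \<Omega>" "K \<subseteq> K'" "\<And>k::nat. test_function \<Omega> (\<phi> k)"
    "\<And>k x. x \<notin> K' \<Longrightarrow> \<phi> k x = 0" "\<And>k x. x \<notin> K' \<Longrightarrow> grad (\<phi> k) x = 0"
    "\<And>k. integrable lebesgue (\<lambda>x. norm (\<phi> k x - \<psi> x) powr p)"
    "\<And>k. integrable lebesgue (\<lambda>x. norm (grad (\<phi> k) x - g x) powr p)"
    "(\<lambda>k. LINT x|lebesgue. norm (\<phi> k x - \<psi> x) powr p) \<longlonglongrightarrow> 0"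
    "(\<lambda>k. LINT x|lebesgue. norm (grad (\<phi> k) x - g x) powr p) \<longlonglongrightarrow> 0"
  proof (rule mollified_approx[OF \<Omega> w K _ _ p ip])
    show "x \<notin> K \<Longrightarrow> \<psi> x = 0" "x \<notin> K \<Longrightarrow> g x = 0" for x by (fact z)+
  qed (rule that; assumption)
  have zo: "\<phi> k x = 0" "grad (\<phi> k) x = 0" if "x \<notin> \<Omega>" for k x using \<phi>(2,5,6) that by blast+
  have "sobolev_norm p \<Omega> (\<lambda>x. \<phi> k x - \<psi> x) =
      ((LINT x|lebesgue. norm (\<phi> k x - \<psi> x) powr p) + (LINT x|lebesgue. norm (grad (\<phi> k) x - g x) powr p)) powr (1 / p)" for k
  proof -
    have cw: "has_weak_gradient \<Omega> (\<phi> k) (grad (\<phi> k))"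
      using test_function_GDERIV[OF \<phi>(4)] continuous_on_subset[OF test_function_continuous_grad[OF \<phi>(4)]]
      by (intro classical_weak_gradient[OF \<Omega>]) auto
    have wd: "has_weak_gradient \<Omega> (\<lambda>x. \<phi> k x - \<psi> x) (\<lambda>x. grad (\<phi> k) x - g x)"
      by (rule has_weak_gradient_diff[OF \<Omega> cw w])
    note ww = weak_grad_works[OF \<Omega> wd]
    have "(LINT x|lebesgue_on \<Omega>. norm (weak_grad \<Omega> (\<lambda>x. \<phi> k x - \<psi> x) x) powr p)
        = (LINT x|lebesgue_on \<Omega>. norm (grad (\<phi> k) x - g x) powr p)"
    proof (rule integral_cong_AE)
      show "(\<lambda>x. norm (weak_grad \<Omega> (\<lambda>x. \<phi> k x - \<psi> x) x) powr p) \<in> borel_measurable (lebesgue_on \<Omega>)"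
        using has_weak_gradient_measurable(2)[OF \<Omega> ww(1)] by measurable
      show "(\<lambda>x. norm (grad (\<phi> k) x - g x) powr p) \<in> borel_measurable (lebesgue_on \<Omega>)"
        using has_weak_gradient_measurable(2)[OF \<Omega> wd] by measurable
    qed (use ww(2) in eventually_elim, simp)
    also have "\<dots> = (LINT x|lebesgue. norm (grad (\<phi> k) x - g x) powr p)"
      by (rule integral_lebesgue_on_supported[OF \<Omega>]) (simp add: zo z\<Omega>)
    finally have 1: "(LINT x|lebesgue_on \<Omega>. norm (weak_grad \<Omega> (\<lambda>x. \<phi> k x - \<psi> x) x) powr p)
        = (LINT x|lebesgue. norm (grad (\<phi> k) x - g x) powr p)" .
    have 2: "(LINT x|lebesgue_on \<Omega>. \<bar>\<phi> k x - \<psi> x\<bar> powr p) = (LINT x|lebesgue. norm (\<phi> k x - \<psi> x) powr p)"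
      unfolding real_norm_def
      by (rule integral_lebesgue_on_supported[OF \<Omega>]) (simp add: zo z\<Omega>)
    show ?thesis unfolding sobolev_norm_def 1 2 ..
  qed
  moreover have "(\<lambda>k. ((LINT x|lebesgue. norm (\<phi> k x - \<psi> x) powr p) + (LINT x|lebesgue. norm (grad (\<phi> k) x - g x) powr p)) powr (1 / p)) \<longlonglongrightarrow> 0 powr (1 / p)"
  proof (rule tendsto_powr')
    show "(\<lambda>k. (LINT x|lebesgue. norm (\<phi> k x - \<psi> x) powr p) + (LINT x|lebesgue. norm (grad (\<phi> k) x - g x) powr p)) \<longlonglongrightarrow> 0"
      using tendsto_add[OF \<phi>(9,10)] by simp
  qed (use p in \<open>auto intro!: always_eventually add_nonneg_nonneg\<close>)
  ultimately have "(\<lambda>k. sobolev_norm p \<Omega> (\<lambda>x. \<phi> k x - \<psi> x)) \<longlonglongrightarrow> 0" by simp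
  then show ?thesis using W \<phi>(4) by (auto simp: sobolev_W1_0_def)
qed

lemma divergence_test_function:
  fixes F :: "'a::euclidean_space \<Rightarrow> 'a"
  assumes A: "open A" and d: "\<And>x b. x \<in> A \<Longrightarrow> b \<in> Basis \<Longrightarrow> GDERIV (\<lambda>x. F x \<bullet> b) x :> DF b x"
    and c: "\<And>b. b \<in> Basis \<Longrightarrow> continuous_on A (DF b)" and t: "test_function A \<phi>"
  shows "(LINT x|lebesgue. indicator A x *\<^sub>R (F x \<bullet> grad \<phi> x)) = - (LINT x|lebesgue. indicator A x *\<^sub>R (\<phi> x * (\<Sum>b\<in>Basis. DF b x \<bullet> b)))"
proof -
  note ibp = integration_by_parts_local[OF A d c t]
  have i1: "integrable lebesgue (\<lambda>x. (indicator A x *\<^sub>R ((F x \<bullet> b) *\<^sub>R grad \<phi> x)) \<bullet> b)" if "b \<in> Basis" for b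
    using ibp(1)[OF _ that] that by (intro integrable_inner_left) auto
  have i2: "integrable lebesgue (\<lambda>x. (indicator A x *\<^sub>R (\<phi> x *\<^sub>R DF b x)) \<bullet> b)" if "b \<in> Basis" for b
    using ibp(2)[OF _ that] that by (intro integrable_inner_left) auto
  have e1: "(\<lambda>x. indicator A x *\<^sub>R (F x \<bullet> grad \<phi> x)) = (\<lambda>x. \<Sum>b\<in>Basis. (indicator A x *\<^sub>R ((F x \<bullet> b) *\<^sub>R grad \<phi> x)) \<bullet> b)"
  proof (rule ext)
    fix x
    have "indicator A x *\<^sub>R (F x \<bullet> grad \<phi> x) = indicator A x *\<^sub>R (\<Sum>b\<in>Basis. (F x \<bullet> b) * (grad \<phi> x \<bullet> b))"
      by (subst euclidean_inner) (rule refl)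
    then show "indicator A x *\<^sub>R (F x \<bullet> grad \<phi> x) = (\<Sum>b\<in>Basis. (indicator A x *\<^sub>R ((F x \<bullet> b) *\<^sub>R grad \<phi> x)) \<bullet> b)"
      by (simp add: sum_distrib_left mult.assoc)
  qed
  have e2: "(\<lambda>x. indicator A x *\<^sub>R (\<phi> x * (\<Sum>b\<in>Basis. DF b x \<bullet> b))) = (\<lambda>x. \<Sum>b\<in>Basis. (indicator A x *\<^sub>R (\<phi> x *\<^sub>R DF b x)) \<bullet> b)"
    by (simp add: sum_distrib_left mult.assoc)
  have "(LINT x|lebesgue. indicator A x *\<^sub>R (F x \<bullet> grad \<phi> x)) = (\<Sum>b\<in>Basis. (LINT x|lebesgue. (indicator A x *\<^sub>R ((F x \<bullet> b) *\<^sub>R grad \<phi> x)) \<bullet> b))"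
    unfolding e1 by (rule Bochner_Integration.integral_sum) (rule i1)
  also have "\<dots> = (\<Sum>b\<in>Basis. - (LINT x|lebesgue. (indicator A x *\<^sub>R (\<phi> x *\<^sub>R DF b x)) \<bullet> b))"
  proof (rule sum.cong[OF refl])
    fix b :: 'a assume b: "b \<in> Basis"
    have "(LINT x|lebesgue. (indicator A x *\<^sub>R ((F x \<bullet> b) *\<^sub>R grad \<phi> x)) \<bullet> b) = (LINT x|lebesgue. indicator A x *\<^sub>R ((F x \<bullet> b) *\<^sub>R grad \<phi> x)) \<bullet> b"
      by (rule integral_inner_left) (use ibp(1)[OF _ b] b in auto)
    also have "\<dots> = - (LINT x|lebesgue. indicator A x *\<^sub>R (\<phi> x *\<^sub>R DF b x)) \<bullet> b"
      using ibp(3)[OF _ b] b by simp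
    also have "\<dots> = - (LINT x|lebesgue. (indicator A x *\<^sub>R (\<phi> x *\<^sub>R DF b x)) \<bullet> b)"
      unfolding inner_minus_left by (subst integral_inner_left) (use ibp(2)[OF _ b] b in auto)
    finally show "(LINT x|lebesgue. (indicator A x *\<^sub>R ((F x \<bullet> b) *\<^sub>R grad \<phi> x)) \<bullet> b) = - (LINT x|lebesgue. (indicator A x *\<^sub>R (\<phi> x *\<^sub>R DF b x)) \<bullet> b)" .
  qed
  also have "\<dots> = - (LINT x|lebesgue. indicator A x *\<^sub>R (\<phi> x * (\<Sum>b\<in>Basis. DF b x \<bullet> b)))"
    unfolding e2 sum_negf
    by (rule arg_cong[where f=uminus], rule Bochner_Integration.integral_sum[symmetric], rule i2)
  finally show ?thesis .
qed

lemma supported_inner_integrable: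
  fixes F g :: "'a::euclidean_space \<Rightarrow> 'b::euclidean_space"
  assumes A: "open A" and cF: "continuous_on A F" and K: "compact K" "K \<subseteq> A"
    and g: "integrable lebesgue g" and z: "\<And>x. x \<notin> K \<Longrightarrow> g x = 0"
  obtains B where "0 \<le> B" "\<And>x. \<bar>F x \<bullet> g x\<bar> \<le> B * norm (g x)" "integrable lebesgue (\<lambda>x. F x \<bullet> g x)"
proof -
  obtain B where B: "0 \<le> B" "\<And>x. x \<in> K \<Longrightarrow> norm (F x) \<le> B"
    using continuous_bounded_on_compact[OF K(1) continuous_on_subset[OF cF K(2)]] by blast
  have b: "\<bar>F x \<bullet> g x\<bar> \<le> B * norm (g x)" for x
  proof (cases "x \<in> K")
    case True
    have "\<bar>F x \<bullet> g x\<bar> \<le> norm (F x) * norm (g x)" by (rule Cauchy_Schwarz_ineq2)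
    also have "\<dots> \<le> B * norm (g x)" by (intro mult_right_mono B True) auto
    finally show ?thesis .
  qed (simp add: z)
  have m: "(\<lambda>x. indicator A x *\<^sub>R F x) \<in> borel_measurable lebesgue"
    by (rule locally_integrable_measurable[OF A locally_integrable_continuous[OF cF]])
  have "(\<lambda>x. (indicator A x *\<^sub>R F x) \<bullet> g x) \<in> borel_measurable lebesgue"
    by (rule borel_measurable_inner[OF m borel_measurable_integrable[OF g]])
  moreover have zA: "g x = 0" if "x \<notin> A" for x using z K that by blast
  have "(\<lambda>x. (indicator A x *\<^sub>R F x) \<bullet> g x) = (\<lambda>x. F x \<bullet> g x)"
    by (auto simp: fun_eq_iff indicator_def zA)
  with calculation have mm: "(\<lambda>x. F x \<bullet> g x) \<in> borel_measurable lebesgue" by simp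
  have "integrable lebesgue (\<lambda>x. F x \<bullet> g x)"
    by (rule Bochner_Integration.integrable_bound[where f="\<lambda>x. B * norm (g x)", OF _ mm])
       (use g b B in \<open>auto intro!: AE_I2\<close>)
  then show ?thesis using that B(1) b by blast
qed

lemma supported_inner_tendsto:
  fixes F g :: "'a::euclidean_space \<Rightarrow> 'b::euclidean_space" and gk :: "nat \<Rightarrow> 'a \<Rightarrow> 'b"
  assumes A: "open A" and cF: "continuous_on A F" and K: "compact K" "K \<subseteq> A"
    and g: "integrable lebesgue g" "\<And>k. integrable lebesgue (gk k)"
    and z: "\<And>x. x \<notin> K \<Longrightarrow> g x = 0" "\<And>k x. x \<notin> K \<Longrightarrow> gk k x = 0"
    and lim: "(\<lambda>k. LINT x|lebesgue. norm (gk k x - g x)) \<longlonglongrightarrow> 0"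
  shows "(\<lambda>k. LINT x|lebesgue. F x \<bullet> gk k x) \<longlonglongrightarrow> (LINT x|lebesgue. F x \<bullet> g x)"
proof -
  obtain B where B: "0 \<le> B" "\<And>x. x \<in> K \<Longrightarrow> norm (F x) \<le> B"
    using continuous_bounded_on_compact[OF K(1) continuous_on_subset[OF cF K(2)]] by blast
  have i: "integrable lebesgue (\<lambda>x. F x \<bullet> g x)" "integrable lebesgue (\<lambda>x. F x \<bullet> gk k x)" for k
    by (rule supported_inner_integrable[OF A cF K g(1)], use z in auto)
       (rule supported_inner_integrable[OF A cF K g(2)], use z in auto)
  have "(\<lambda>k. (LINT x|lebesgue. F x \<bullet> gk k x) - (LINT x|lebesgue. F x \<bullet> g x)) \<longlonglongrightarrow> 0"
  proof (rule Lim_null_comparison)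
    show "\<forall>\<^sub>F k in sequentially. norm ((LINT x|lebesgue. F x \<bullet> gk k x) - (LINT x|lebesgue. F x \<bullet> g x)) \<le> B * (LINT x|lebesgue. norm (gk k x - g x))"
    proof (rule always_eventually, rule allI)
      fix k
      have "norm (LINT x|lebesgue. F x \<bullet> gk k x - F x \<bullet> g x) \<le> (LINT x|lebesgue. B * norm (gk k x - g x))"
      proof (rule norm_integral_le)
        show "integrable lebesgue (\<lambda>x. F x \<bullet> gk k x - F x \<bullet> g x)" using i by simp
        show "integrable lebesgue (\<lambda>x. B * norm (gk k x - g x))" using g by simp
        fix x
        show "norm (F x \<bullet> gk k x - F x \<bullet> g x) \<le> B * norm (gk k x - g x)"
        proof (cases "x \<in> K")
          case True
          have "\<bar>F x \<bullet> (gk k x - g x)\<bar> \<le> norm (F x) * norm (gk k x - g x)" by (rule Cauchy_Schwarz_ineq2)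
          also have "\<dots> \<le> B * norm (gk k x - g x)" by (intro mult_right_mono B True) auto
          finally show ?thesis by (simp add: inner_diff_right)
        qed (simp add: z)
      qed
      then show "norm ((LINT x|lebesgue. F x \<bullet> gk k x) - (LINT x|lebesgue. F x \<bullet> g x)) \<le> B * (LINT x|lebesgue. norm (gk k x - g x))"
        using i by simp
    qed
    show "(\<lambda>k. B * (LINT x|lebesgue. norm (gk k x - g x))) \<longlonglongrightarrow> 0" using tendsto_mult_right_zero[OF lim] .
  qed
  then show ?thesis by (rule LIM_zero_cancel)
qed

text \<open>The field \<open>F\<close> is only \<open>C\<^sup>1\<close> and only defined on \<open>A\<close>, so it is not a test function.  Instead \<open>\<psi>\<close> is
  approximated by test functions, for which classical integration by parts applies.\<close>

lemma divergence_weak: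
  fixes F :: "'a::euclidean_space \<Rightarrow> 'a"
  assumes A: "open A" and d: "\<And>x b. x \<in> A \<Longrightarrow> b \<in> Basis \<Longrightarrow> GDERIV (\<lambda>x. F x \<bullet> b) x :> DF b x"
    and c: "\<And>b. b \<in> Basis \<Longrightarrow> continuous_on A (DF b)"
    and w: "has_weak_gradient A \<psi> g" and K: "compact K" "K \<subseteq> A"
    and z: "\<And>x. x \<notin> K \<Longrightarrow> \<psi> x = 0" "\<And>x. x \<notin> K \<Longrightarrow> g x = 0"
  shows "(LINT x|lebesgue. F x \<bullet> g x) = - (LINT x|lebesgue. (\<Sum>b\<in>Basis. DF b x \<bullet> b) * \<psi> x)"
proof -
  let ?D = "\<lambda>x. \<Sum>b\<in>Basis. DF b x \<bullet> b"
  have "continuous_on A (\<lambda>x. F x \<bullet> b)" if "b \<in> Basis" for b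
    using d[OF _ that] by (auto simp: gderiv_def intro!: continuous_at_imp_continuous_on has_derivative_continuous)
  then have cF: "continuous_on A F" by (subst continuous_on_componentwise) blast
  have cD: "continuous_on A ?D" by (intro continuous_intros c)
  have eq: "(\<lambda>x. indicat_real K x *\<^sub>R \<psi> x) = \<psi>" "(\<lambda>x. indicat_real K x *\<^sub>R g x) = g"
    using z by (auto simp: fun_eq_iff indicator_def)
  have l: "locally_integrable A \<psi>" "locally_integrable A g" using w by (auto simp: has_weak_gradient_def)
  have i\<psi>: "integrable lebesgue \<psi>" using locally_integrable_cut[OF l(1) K] unfolding eq(1) .
  have ig: "integrable lebesgue g" using locally_integrable_cut[OF l(2) K] unfolding eq(2) .
  have ip: "integrable lebesgue (\<lambda>x. norm (\<psi> x) powr 1)" "integrable lebesgue (\<lambda>x. norm (g x) powr 1)"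
    using i\<psi> ig by simp_all
  obtain \<phi> K' where \<phi>: "compact K'" "K' \<subseteq> A" "K \<subseteq> K'" "\<And>k::nat. test_function A (\<phi> k)"
    "\<And>k x. x \<notin> K' \<Longrightarrow> \<phi> k x = 0" "\<And>k x. x \<notin> K' \<Longrightarrow> grad (\<phi> k) x = 0"
    "(\<lambda>k. LINT x|lebesgue. norm (\<phi> k x - \<psi> x) powr 1) \<longlonglongrightarrow> 0"
    "(\<lambda>k. LINT x|lebesgue. norm (grad (\<phi> k) x - g x) powr 1) \<longlonglongrightarrow> 0"
  proof (rule mollified_approx[OF A w K _ _ order_refl ip])
    show "x \<notin> K \<Longrightarrow> \<psi> x = 0" "x \<notin> K \<Longrightarrow> g x = 0" for x by (fact z)+
  qed (rule that; assumption)
  have z': "x \<notin> K' \<Longrightarrow> \<psi> x = 0" "x \<notin> K' \<Longrightarrow> g x = 0" for x using \<phi>(3) z by auto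
  have i\<phi>: "integrable lebesgue (\<phi> k)" "integrable lebesgue (grad (\<phi> k))" for k
    using integrable_glue(2)[OF open_UNIV \<phi>(1) subset_UNIV test_function_continuous[OF \<phi>(4)] \<phi>(5), of k]
      integrable_glue(2)[OF open_UNIV \<phi>(1) subset_UNIV test_function_continuous_grad[OF \<phi>(4)] \<phi>(6), of k] by simp_all
  have l1: "(\<lambda>k. LINT x|lebesgue. F x \<bullet> grad (\<phi> k) x) \<longlonglongrightarrow> (LINT x|lebesgue. F x \<bullet> g x)"
    by (rule supported_inner_tendsto[OF A cF \<phi>(1,2) ig i\<phi>(2) z'(2) \<phi>(6)]) (use \<phi>(8) in simp_all)
  have l2: "(\<lambda>k. LINT x|lebesgue. ?D x \<bullet> \<phi> k x) \<longlonglongrightarrow> (LINT x|lebesgue. ?D x \<bullet> \<psi> x)"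
    by (rule supported_inner_tendsto[OF A cD \<phi>(1,2) i\<psi> i\<phi>(1) z'(1) \<phi>(5)]) (use \<phi>(7) in simp_all)
  have "(LINT x|lebesgue. F x \<bullet> grad (\<phi> k) x) = - (LINT x|lebesgue. ?D x \<bullet> \<phi> k x)" for k
  proof -
    have zA: "\<phi> k x = 0" "grad (\<phi> k) x = 0" if "x \<notin> A" for x using \<phi>(2,5,6) that by blast+
    have "(\<lambda>x. indicator A x *\<^sub>R (F x \<bullet> grad (\<phi> k) x)) = (\<lambda>x. F x \<bullet> grad (\<phi> k) x)"
      "(\<lambda>x. indicator A x *\<^sub>R (\<phi> k x * ?D x)) = (\<lambda>x. ?D x \<bullet> \<phi> k x)"
      by (auto simp: fun_eq_iff indicator_def zA)
    then show ?thesis using divergence_test_function[OF A d c \<phi>(4), of k] by simp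
  qed
  then have "(\<lambda>k. - (LINT x|lebesgue. ?D x \<bullet> \<phi> k x)) \<longlonglongrightarrow> (LINT x|lebesgue. F x \<bullet> g x)" using l1 by simp
  from LIMSEQ_unique[OF this tendsto_minus[OF l2]] show ?thesis by (simp add: inner_real_def)
qed

lemma GDERIV_radial_component:
  fixes z :: "'a::euclidean_space"
  assumes "DERIV q ((x - z) \<bullet> (x - z)) :> q'"
  shows "GDERIV (\<lambda>x. (q ((x - z) \<bullet> (x - z)) *\<^sub>R (x - z)) \<bullet> b) x :>
    q ((x - z) \<bullet> (x - z)) *\<^sub>R b + ((x - z) \<bullet> b) *\<^sub>R (q' *\<^sub>R (2 *\<^sub>R (x - z)))"
proof -
  have 1: "GDERIV (\<lambda>x. (x - z) \<bullet> (x - z)) x :> 2 *\<^sub>R (x - z)"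
    unfolding gderiv_def by (auto intro!: derivative_eq_intros simp: inner_commute)
  have 2: "GDERIV (\<lambda>x. (x - z) \<bullet> b) x :> b"
    unfolding gderiv_def by (auto intro!: derivative_eq_intros)
  show ?thesis using GDERIV_mult[OF GDERIV_DERIV_compose[OF 1 assms] 2] by simp
qed

text \<open>For the field \<open>q(|y|\<^sup>2) y\<close>, where \<open>y = x - z\<close>, the divergence is \<open>n q + 2 |y|\<^sup>2 q'\<close>.\<close>

lemma radial_divergence_weak:
  fixes z :: "'a::euclidean_space" and q q' :: "real \<Rightarrow> real"
  assumes A: "open A" and T: "\<And>x. x \<in> A \<Longrightarrow> (x - z) \<bullet> (x - z) \<in> T"
    and q: "\<And>t. t \<in> T \<Longrightarrow> DERIV q t :> q' t" and c: "continuous_on T q'"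
    and w: "has_weak_gradient A \<psi> g" and K: "compact K" "K \<subseteq> A"
    and z: "\<And>x. x \<notin> K \<Longrightarrow> \<psi> x = 0" "\<And>x. x \<notin> K \<Longrightarrow> g x = 0"
  shows "(LINT x|lebesgue. (q ((x - z) \<bullet> (x - z)) *\<^sub>R (x - z)) \<bullet> g x) =
    - (LINT x|lebesgue. (DIM('a) * q ((x - z) \<bullet> (x - z)) + 2 * ((x - z) \<bullet> (x - z)) * q' ((x - z) \<bullet> (x - z))) * \<psi> x)"
proof -
  let ?t = "\<lambda>x. (x - z) \<bullet> (x - z)"
  let ?DF = "\<lambda>b x. q (?t x) *\<^sub>R b + ((x - z) \<bullet> b) *\<^sub>R (q' (?t x) *\<^sub>R (2 *\<^sub>R (x - z)))"
  have cq: "continuous_on T q" using q DERIV_isCont continuous_at_imp_continuous_on by blast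
  have ct: "continuous_on A ?t" by (intro continuous_intros)
  have c1: "continuous_on A (\<lambda>x. q (?t x))" "continuous_on A (\<lambda>x. q' (?t x))"
    by (rule continuous_on_compose2[OF cq ct] continuous_on_compose2[OF c ct]; use T in blast)+
  have "(LINT x|lebesgue. (q (?t x) *\<^sub>R (x - z)) \<bullet> g x) = - (LINT x|lebesgue. (\<Sum>b\<in>Basis. ?DF b x \<bullet> b) * \<psi> x)"
  proof (rule divergence_weak[OF A _ _ w K z])
    show "GDERIV (\<lambda>x. (q (?t x) *\<^sub>R (x - z)) \<bullet> b) x :> ?DF b x" if "x \<in> A" for x b
      by (rule GDERIV_radial_component[OF q[OF T[OF that]]])
    show "continuous_on A (?DF b)" for b by (intro continuous_intros c1)
  qed auto
  moreover have "(\<Sum>b\<in>Basis. ?DF b x \<bullet> b) = DIM('a) * q (?t x) + 2 * ?t x * q' (?t x)" for x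
  proof -
    have "(\<Sum>b\<in>Basis. ?DF b x \<bullet> b) = (\<Sum>b\<in>(Basis::'a set). q (?t x)) + (\<Sum>b\<in>Basis. 2 * q' (?t x) * (((x - z) \<bullet> b) * ((x - z) \<bullet> b)))"
      unfolding sum.distrib[symmetric] by (rule sum.cong) (auto simp: inner_add_left)
    also have "\<dots> = DIM('a) * q (?t x) + 2 * q' (?t x) * ?t x"
      by (simp add: sum_distrib_left[symmetric] euclidean_inner[of "x - z" "x - z"])
    finally show ?thesis by simp
  qed
  ultimately show ?thesis by simp
qed

section \<open>Comparison with barriers\<close>

definition pos_sq :: "real \<Rightarrow> real" where "pos_sq t = (max 0 t)\<^sup>2"

lemma pos_sq_deriv: "DERIV pos_sq t :> 2 * max 0 t"
proof -
  consider "t > 0" | "t < 0" | "t = 0" by linarith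
  then show ?thesis
  proof cases
    case 1
    have "DERIV (\<lambda>t. t\<^sup>2) t :> 2 * max 0 t" using 1 by (auto intro!: derivative_eq_intros)
    then show ?thesis
      by (rule has_field_derivative_transform_within_open[where S="{0<..}"]) (use 1 in \<open>auto simp: pos_sq_def\<close>)
  next
    case 2
    have "DERIV (\<lambda>t. 0) t :> 2 * max 0 t" using 2 by auto
    then show ?thesis
      by (rule has_field_derivative_transform_within_open[where S="{..<0}"]) (use 2 in \<open>auto simp: pos_sq_def\<close>)
  next
    case 3
    have "max 0 h = (pos_sq (0 + h) - pos_sq 0) / h" for h :: real
      by (auto simp: pos_sq_def power2_eq_square max_def)
    then have eq: "(\<lambda>h. (pos_sq (0 + h) - pos_sq 0) / h) = max 0" by (simp add: fun_eq_iff)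
    have "isCont (max (0::real)) 0" by (intro continuous_intros)
    then show ?thesis using 3 unfolding DERIV_def by (simp only: eq) (simp add: isCont_def)
  qed
qed

text \<open>The function \<open>G\<close> of the comparison argument.  It is \<open>C\<^sup>1\<close> and nondecreasing, vanishes exactly on
  the negative half line, and stays below \<open>1\<close> while it is at least \<open>1/2\<close> from \<open>M\<close> on.  Letting \<open>M\<close>
  tend to zero it approaches an indicator function, as the point mass at the origin requires.\<close>

definition sat :: "real \<Rightarrow> real \<Rightarrow> real" where
  "sat M t = pos_sq t / (M\<^sup>2 + pos_sq t)"

definition sat_deriv :: "real \<Rightarrow> real \<Rightarrow> real" where
  "sat_deriv M t = 2 * max 0 t * M\<^sup>2 / (M\<^sup>2 + pos_sq t)\<^sup>2"

lemma pos_sq_nonneg: "0 \<le> pos_sq t" by (simp add: pos_sq_def)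

lemma sat_denom_pos: "0 < M \<Longrightarrow> 0 < M\<^sup>2 + pos_sq t"
  by (simp add: add_pos_nonneg pos_sq_nonneg)

lemma sat_has_deriv:
  assumes "0 < M" shows "DERIV (sat M) t :> sat_deriv M t"
proof -
  have "DERIV (\<lambda>t. pos_sq t / (M\<^sup>2 + pos_sq t)) t :>
      ((2 * max 0 t) * (M\<^sup>2 + pos_sq t) - pos_sq t * (0 + 2 * max 0 t)) / ((M\<^sup>2 + pos_sq t) * (M\<^sup>2 + pos_sq t))"
    by (intro DERIV_divide DERIV_add DERIV_const pos_sq_deriv) (use sat_denom_pos[OF assms, of t] in simp)
  moreover have "((2 * max 0 t) * (M\<^sup>2 + pos_sq t) - pos_sq t * (0 + 2 * max 0 t)) / ((M\<^sup>2 + pos_sq t) * (M\<^sup>2 + pos_sq t)) = sat_deriv M t"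
    unfolding sat_deriv_def power2_eq_square[of "M\<^sup>2 + pos_sq t"] by (simp add: algebra_simps)
  ultimately show ?thesis unfolding sat_def[abs_def] by simp
qed

lemma sat_deriv_continuous: "0 < M \<Longrightarrow> continuous_on UNIV (sat_deriv M)"
  unfolding sat_deriv_def pos_sq_def
  by (intro continuous_intros) (use sat_denom_pos[of M] in \<open>auto simp: pos_sq_def less_le\<close>)

lemma sat_deriv_nonneg: "0 \<le> sat_deriv M t" by (simp add: sat_deriv_def)

lemma sat_deriv_zero: "t \<le> 0 \<Longrightarrow> sat_deriv M t = 0" by (simp add: sat_deriv_def)

lemma sat_zero: "t \<le> 0 \<Longrightarrow> sat M t = 0" by (simp add: sat_def pos_sq_def)

lemma sat_nonneg: "0 \<le> sat M t" by (simp add: sat_def pos_sq_nonneg)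

lemma sat_le_1: "sat M t \<le> 1"
proof (cases "M = 0")
  case False
  then have "0 < M\<^sup>2 + pos_sq t" by (simp add: add_pos_nonneg pos_sq_nonneg)
  then show ?thesis by (simp add: sat_def divide_le_eq)
qed (simp add: sat_def)

lemma sat_pos: "0 < M \<Longrightarrow> 0 < t \<Longrightarrow> 0 < sat M t"
  using sat_denom_pos[of M t] by (simp add: sat_def pos_sq_def)

lemma sat_mono: assumes "0 < M" "s \<le> t" shows "sat M s \<le> sat M t"
proof -
  have e: "sat M t = 1 - M\<^sup>2 / (M\<^sup>2 + pos_sq t)" for t
    using sat_denom_pos[OF assms(1), of t] by (simp add: sat_def field_simps)
  have "pos_sq s \<le> pos_sq t" unfolding pos_sq_def using assms(2) by (intro power_mono) auto
  then have "M\<^sup>2 / (M\<^sup>2 + pos_sq t) \<le> M\<^sup>2 / (M\<^sup>2 + pos_sq s)"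
    using sat_denom_pos[OF assms(1)] by (intro divide_left_mono mult_pos_pos) auto
  then show ?thesis by (simp add: e)
qed

lemma sat_continuous: "0 < M \<Longrightarrow> continuous_on UNIV (sat M)"
  by (meson DERIV_continuous_on sat_has_deriv has_field_derivative_at_within)

definition p_flux :: "real \<Rightarrow> 'a::euclidean_space \<Rightarrow> 'a" where
  "p_flux p a = norm a powr (p - 2) *\<^sub>R a"

lemma powr_shift: "p > 1 \<Longrightarrow> 0 \<le> (x::real) \<Longrightarrow> x powr (p - 2) * x = x powr (p - 1)"
  using powr_mult_base[of x "p - 2"] by (simp add: mult.commute)

lemma powr_shift': "p > 1 \<Longrightarrow> 0 \<le> (x::real) \<Longrightarrow> x powr (p - 1) * x = x powr p"
  using powr_mult_base[of x "p - 1"] by (simp add: mult.commute)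

lemma norm_p_flux: "p > 1 \<Longrightarrow> norm (p_flux p a) = norm a powr (p - 1)"
  by (simp add: p_flux_def powr_shift)

text \<open>By the Cauchy-Schwarz inequality the product is at least \<open>(|a|\<^sup>p\<^sup>-\<^sup>1 - |b|\<^sup>p\<^sup>-\<^sup>1) (|a| - |b|)\<close>.\<close>

lemma p_flux_monotone:
  fixes a b :: "'a::euclidean_space"
  assumes p: "p > 1" shows "0 \<le> (p_flux p a - p_flux p b) \<bullet> (a - b)"
proof -
  let ?A = "norm a" and ?B = "norm b"
  have 1: "p_flux p a \<bullet> a = norm a powr (p - 1) * norm a" for a :: 'a
  proof -
    have "p_flux p a \<bullet> a = (norm a powr (p - 2) * norm a) * norm a"
      by (simp add: p_flux_def dot_square_norm power2_eq_square)
    then show ?thesis by (simp only: powr_shift[OF p norm_ge_zero])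
  qed
  have 2: "p_flux p a \<bullet> b \<le> norm a powr (p - 1) * norm b" for a b :: 'a
    using Cauchy_Schwarz_ineq2[of "p_flux p a" b] norm_p_flux[OF p, of a] by simp
  have "0 \<le> (?A powr (p - 1) - ?B powr (p - 1)) * (?A - ?B)"
  proof (cases "?A \<le> ?B")
    case True
    then have "?A powr (p - 1) \<le> ?B powr (p - 1)" using p by (intro powr_mono2) auto
    then show ?thesis using True by (simp add: mult_nonpos_nonpos)
  next
    case False
    then have "?B powr (p - 1) \<le> ?A powr (p - 1)" using p by (intro powr_mono2) auto
    then show ?thesis using False by simp
  qed
  also have "\<dots> = ?A powr (p - 1) * ?A + ?B powr (p - 1) * ?B - ?A powr (p - 1) * ?B - ?B powr (p - 1) * ?A"
    by (simp add: algebra_simps)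
  also have "\<dots> \<le> p_flux p a \<bullet> a + p_flux p b \<bullet> b - p_flux p a \<bullet> b - p_flux p b \<bullet> a"
    using 1[of a] 1[of b] 2[of a b] 2[of b a] by linarith
  also have "\<dots> = (p_flux p a - p_flux p b) \<bullet> (a - b)" by (simp add: inner_diff_left inner_diff_right)
  finally show ?thesis .
qed

lemma p_flux_continuous:
  assumes "p > 1" shows "continuous_on UNIV (p_flux p :: 'a::euclidean_space \<Rightarrow> 'a)"
proof (rule continuous_at_imp_continuous_on, rule ballI)
  fix a :: 'a
  show "isCont (p_flux p) a"
  proof (cases "a = 0")
    case False
    then show ?thesis unfolding p_flux_def[abs_def] by (intro continuous_intros) auto
  next
    case True
    have "((\<lambda>x::'a. norm x) \<longlongrightarrow> 0) (at 0)" by (intro tendsto_norm_zero tendsto_ident_at)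
    then have "((\<lambda>x::'a. norm x powr (p - 1)) \<longlongrightarrow> 0 powr (p - 1)) (at 0)"
      by (rule tendsto_powr') (use assms in auto)
    then have "((\<lambda>x::'a. norm (p_flux p x)) \<longlongrightarrow> 0) (at 0)" by (simp add: norm_p_flux[OF assms])
    then have "((p_flux p :: 'a \<Rightarrow> 'a) \<longlongrightarrow> 0) (at 0)" by (rule tendsto_norm_zero_cancel)
    then show ?thesis using True by (simp add: isCont_def p_flux_def)
  qed
qed

text \<open>A form of Young's inequality that makes the product of a flux and a gradient in \<open>L\<^sup>p\<close> integrable.\<close>

lemma powr_interp:
  fixes a b :: real
  assumes "p > 1" "0 \<le> a" "0 \<le> b"
  shows "a powr (p - 1) * b \<le> a powr p + b powr p"
proof -
  define m where "m = max a b"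
  have "a powr (p - 1) * b \<le> m powr (p - 1) * m"
    using assms by (intro mult_mono powr_mono2) (auto simp: m_def)
  also have "\<dots> = m powr p" using assms by (intro powr_shift') (auto simp: m_def)
  also have "\<dots> \<le> a powr p + b powr p" by (auto simp: m_def max_def)
  finally show ?thesis .
qed

lemma has_weak_gradient_cong_AE:
  fixes u :: "'a::euclidean_space \<Rightarrow> real"
  assumes \<Omega>: "open \<Omega>" and w: "has_weak_gradient \<Omega> u g" and v: "locally_integrable \<Omega> v" and eq: "AE x in lebesgue_on \<Omega>. v x = u x"
  shows "has_weak_gradient \<Omega> v g"
proof -
  have "(LINT x|lebesgue_on \<Omega>. v x *\<^sub>R grad \<phi> x) = (LINT x|lebesgue_on \<Omega>. u x *\<^sub>R grad \<phi> x)" if t: "test_function \<Omega> \<phi>" for \<phi>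
  proof (rule integral_cong_AE)
    show "(\<lambda>x. v x *\<^sub>R grad \<phi> x) \<in> borel_measurable (lebesgue_on \<Omega>)"
      using test_function_integrable(1)[OF \<Omega> t v] by auto
    show "(\<lambda>x. u x *\<^sub>R grad \<phi> x) \<in> borel_measurable (lebesgue_on \<Omega>)"
      using test_function_integrable(1)[OF \<Omega> t, of u] w by (auto simp: has_weak_gradient_def)
  qed (use eq in eventually_elim, simp)
  then show ?thesis using w v by (simp add: has_weak_gradient_def)
qed

lemma has_weak_gradient_cong:
  fixes u :: "'a::euclidean_space \<Rightarrow> real"
  assumes w: "has_weak_gradient B u g" and eq: "\<And>x. x \<in> B \<Longrightarrow> u x = u' x" "\<And>x. x \<in> B \<Longrightarrow> g x = g' x"
  shows "has_weak_gradient B u' g'"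
proof -
  have l: "locally_integrable B f'" if "locally_integrable B f" "\<And>x. x \<in> B \<Longrightarrow> f x = f' x" for f f' :: "'a \<Rightarrow> real"
    using that set_integrable_cong[OF refl refl, of _ f f'] unfolding locally_integrable_def by (metis subsetD)
  have l': "locally_integrable B f'" if "locally_integrable B f" "\<And>x. x \<in> B \<Longrightarrow> f x = f' x" for f f' :: "'a \<Rightarrow> 'a"
    using that set_integrable_cong[OF refl refl, of _ f f'] unfolding locally_integrable_def by (metis subsetD)
  have "(LINT x|lebesgue_on B. u' x *\<^sub>R grad \<phi> x) = (LINT x|lebesgue_on B. u x *\<^sub>R grad \<phi> x)"
    "(LINT x|lebesgue_on B. \<phi> x *\<^sub>R g' x) = (LINT x|lebesgue_on B. \<phi> x *\<^sub>R g x)" for \<phi>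
    by (rule Bochner_Integration.integral_cong; simp add: eq)+
  then show ?thesis using w l[of u u'] l'[of g g'] eq by (simp add: has_weak_gradient_def)
qed

text \<open>The local part of the situation of the theorem, with the continuous representative \<open>v\<close> made explicit.\<close>

locale continuous_solution =
  fixes \<Omega> :: "'a::euclidean_space set" and u v :: "'a \<Rightarrow> real" and p \<alpha> :: real
  assumes open_\<Omega>: "open \<Omega>" and p1: "1 < p" and u_W: "u \<in> sobolev_W1 p \<Omega>"
    and sol: "weak_solution p \<alpha> \<Omega> u"
    and v_cont: "continuous_on \<Omega> v" and v_AE: "AE x in lebesgue_on \<Omega>. v x = u x"
    and v_nonneg: "\<And>x. x \<in> \<Omega> \<Longrightarrow> 0 \<le> v x"
begin

definition source :: "'a \<Rightarrow> real" where
  "source x = norm x powr \<alpha> * v x powr (p - 1)"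

definition Du :: "'a \<Rightarrow> 'a" where "Du = weak_grad \<Omega> u"

lemma source_nonneg: "0 \<le> source x" by (simp add: source_def)

lemma
  shows Du_v: "has_weak_gradient \<Omega> v Du"
    and Du_measurable: "(\<lambda>x. indicator \<Omega> x *\<^sub>R Du x) \<in> borel_measurable lebesgue"
    and Du_Lp: "integrable lebesgue (\<lambda>x. norm (indicator \<Omega> x *\<^sub>R Du x) powr p)"
proof -
  obtain g where g: "g \<in> Lp_space p \<Omega>" "has_weak_gradient \<Omega> u g"
    using u_W by (auto simp: sobolev_W1_def)
  note ww = weak_grad_works[OF open_\<Omega> g(2)]
  show "has_weak_gradient \<Omega> v Du"
    unfolding Du_def by (rule has_weak_gradient_cong_AE[OF open_\<Omega> ww(1) locally_integrable_continuous[OF v_cont] v_AE])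
  show m: "(\<lambda>x. indicator \<Omega> x *\<^sub>R Du x) \<in> borel_measurable lebesgue"
    using ww(1) unfolding Du_def by (intro locally_integrable_measurable open_\<Omega>) (auto simp: has_weak_gradient_def)
  have "integrable (lebesgue_on \<Omega>) (\<lambda>x. norm (g x) powr p)" using g(1) by (auto simp: Lp_space_def)
  then have "integrable (lebesgue_on \<Omega>) (\<lambda>x. norm (Du x) powr p)"
  proof (rule Bochner_Integration.integrable_bound)
    show "(\<lambda>x. norm (Du x) powr p) \<in> borel_measurable (lebesgue_on \<Omega>)"
      using has_weak_gradient_measurable(2)[OF open_\<Omega> ww(1)] unfolding Du_def by measurable
    show "AE x in lebesgue_on \<Omega>. norm (norm (Du x) powr p) \<le> norm (norm (g x) powr p)"
      using ww(2) unfolding Du_def by eventually_elim simp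
  qed
  then have "integrable lebesgue (\<lambda>x. indicator \<Omega> x *\<^sub>R norm (Du x) powr p)"
    by (simp only: integrable_lebesgue_on_open[OF open_\<Omega>])
  moreover have "(\<lambda>x. indicator \<Omega> x *\<^sub>R norm (Du x) powr p) = (\<lambda>x. norm (indicator \<Omega> x *\<^sub>R Du x) powr p)"
    by (auto simp: fun_eq_iff indicator_def)
  ultimately show "integrable lebesgue (\<lambda>x. norm (indicator \<Omega> x *\<^sub>R Du x) powr p)" by simp
qed

text \<open>Test the equation with \<open>\<psi> = sat M (w - v)\<close>, whose gradient is \<open>g = sat' (\<nabla>w - \<nabla>u)\<close>.  The flux difference
  integrated against \<open>g\<close> is nonnegative by monotonicity, and the part that belongs to \<open>u\<close> is
  the right-hand side of the equation.  It suffices that \<open>w \<le> v\<close> off a compact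
  subset \<open>K\<close> of \<open>B\<close>, since then \<open>\<psi>\<close> and \<open>g\<close> vanish off \<open>K\<close>.\<close>

lemma comparison_inequality:
  fixes B K :: "'a set" and w :: "'a \<Rightarrow> real" and Dw :: "'a \<Rightarrow> 'a" and M :: real
  assumes B: "open B" "B \<subseteq> \<Omega>" and K: "compact K" "K \<subseteq> B" and M: "0 < M"
    and dw: "\<And>x. x \<in> B \<Longrightarrow> GDERIV w x :> Dw x" and cDw: "continuous_on B Dw"
    and out: "\<And>x. x \<in> B \<Longrightarrow> x \<notin> K \<Longrightarrow> w x \<le> v x"
  defines "\<psi> \<equiv> \<lambda>x. indicat_real B x * sat M (w x - v x)"
    and "g \<equiv> \<lambda>x. indicat_real B x *\<^sub>R (sat_deriv M (w x - v x) *\<^sub>R (Dw x - Du x))"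
  shows "has_weak_gradient B \<psi> g" and "x \<notin> K \<Longrightarrow> \<psi> x = 0" and "x \<notin> K \<Longrightarrow> g x = 0"
    and "integrable lebesgue \<psi>" and "integrable lebesgue g"
    and "integrable lebesgue (\<lambda>x. source x * \<psi> x)"
    and "0 \<le> (LINT x|lebesgue. p_flux p (Dw x) \<bullet> g x) + (LINT x|lebesgue. source x * \<psi> x)"
proof -
  have z1: "\<psi> x = 0" if "x \<notin> K" for x
    using out[of x] that by (cases "x \<in> B") (auto simp: \<psi>_def sat_zero)
  have z2: "g x = 0" if "x \<notin> K" for x
    using out[of x] that by (cases "x \<in> B") (auto simp: g_def sat_deriv_zero)
  have z\<Omega>: "\<psi> x = 0" "g x = 0" if "x \<notin> \<Omega>" for x
    using that B K z1 z2 by blast+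
  show "x \<notin> K \<Longrightarrow> \<psi> x = 0" "x \<notin> K \<Longrightarrow> g x = 0" using z1 z2 by auto
  have cv: "continuous_on B v" using v_cont B(2) by (rule continuous_on_subset)
  have cw: "continuous_on B w"
    using dw by (auto simp: gderiv_def intro!: continuous_at_imp_continuous_on has_derivative_continuous)
  have "has_weak_gradient B (\<lambda>x. w x - v x) (\<lambda>x. Dw x - Du x)"
    by (rule has_weak_gradient_diff[OF B(1) classical_weak_gradient[OF B(1) dw cDw] has_weak_gradient_subset[OF open_\<Omega> B Du_v]])
  then have "has_weak_gradient B (\<lambda>x. sat M (w x - v x)) (\<lambda>x. sat_deriv M (w x - v x) *\<^sub>R (Dw x - Du x))"
    by (rule has_weak_gradient_chain[OF B(1) _ _ sat_has_deriv[OF M] sat_deriv_continuous[OF M]])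
       (intro continuous_intros cw cv)
  then show wB: "has_weak_gradient B \<psi> g"
    by (rule has_weak_gradient_cong) (auto simp: \<psi>_def g_def)
  have w\<Omega>: "has_weak_gradient \<Omega> \<psi> g"
    by (rule has_weak_gradient_extend_zero[OF open_\<Omega> B wB K]) (use z1 z2 in auto)
  have li: "locally_integrable \<Omega> \<psi>" "locally_integrable \<Omega> g" using w\<Omega> by (auto simp: has_weak_gradient_def)
  have K\<Omega>: "K \<subseteq> \<Omega>" using K B by blast
  have eqK: "(\<lambda>x. indicat_real K x *\<^sub>R \<psi> x) = \<psi>" "(\<lambda>x. indicat_real K x *\<^sub>R g x) = g"
    using z1 z2 by (auto simp: fun_eq_iff indicator_def)
  show i\<psi>: "integrable lebesgue \<psi>" using locally_integrable_cut[OF li(1) K(1) K\<Omega>] unfolding eqK(1) .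
  show ig: "integrable lebesgue g" using locally_integrable_cut[OF li(2) K(1) K\<Omega>] unfolding eqK(2) .
  have [measurable]: "\<psi> \<in> borel_measurable lebesgue" "g \<in> borel_measurable lebesgue" using i\<psi> ig by auto
  obtain R where R: "\<And>x. x \<in> K \<Longrightarrow> norm x \<le> R" using compact_norm_bound[OF K(1)] by blast
  have \<psi>p: "integrable lebesgue (\<lambda>x. norm (\<psi> x) powr p)"
  proof (rule bounded_support_integrable[where R=R and B=1])
    show "x \<notin> cball 0 R \<Longrightarrow> norm (\<psi> x) powr p = 0" for x using R[of x] z1[of x] by auto
    have "\<bar>\<psi> x\<bar> \<le> 1" for x using sat_nonneg[of M] sat_le_1[of M] by (auto simp: \<psi>_def indicator_def)
    then show "norm (norm (\<psi> x) powr p) \<le> 1" for x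
      using powr_mono2[of p "\<bar>\<psi> x\<bar>" 1] p1 by auto
  qed measurable
  obtain C1 where C1: "0 \<le> C1" "\<And>x. x \<in> K \<Longrightarrow> norm (Dw x) \<le> C1"
    using continuous_bounded_on_compact[OF K(1) continuous_on_subset[OF cDw K(2)]] by blast
  have "continuous_on B (\<lambda>x. sat_deriv M (w x - v x))"
    by (rule continuous_on_compose2[OF sat_deriv_continuous[OF M]]) (auto intro!: continuous_intros cw cv)
  then obtain C2 where C2: "0 \<le> C2" "\<And>x. x \<in> K \<Longrightarrow> norm (sat_deriv M (w x - v x)) \<le> C2"
    using continuous_bounded_on_compact[OF K(1) continuous_on_subset[OF _ K(2)]] by blast
  let ?U = "\<lambda>x. indicator \<Omega> x *\<^sub>R Du x"
  \<comment> \<open>The gradient of \<open>w\<close> is bounded on \<open>K\<close> and that of \<open>u\<close> is in \<open>L\<^sup>p\<close>.\<close>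
  have gle: "norm (g x) \<le> norm ((C2 * C1 * indicat_real (cball 0 R) x) + C2 * norm (?U x) + 0)" for x
  proof (cases "x \<in> K")
    case True
    have x: "x \<in> B" "x \<in> \<Omega>" "x \<in> cball 0 R" using True K K\<Omega> R by auto
    have "norm (g x) = \<bar>sat_deriv M (w x - v x)\<bar> * norm (Dw x - Du x)" using x by (simp add: g_def)
    also have "\<dots> \<le> C2 * (C1 + norm (Du x))"
      using C2(2)[OF True] C1(2)[OF True] norm_triangle_ineq4[of "Dw x" "Du x"] C2(1) by (intro mult_mono) auto
    also have "\<dots> = norm ((C2 * C1 * indicat_real (cball 0 R) x) + C2 * norm (?U x) + 0)"
      using x C1 C2 by (simp add: distrib_left)
    finally show ?thesis .
  qed (use z2 in simp)
  have gp: "integrable lebesgue (\<lambda>x. norm (g x) powr p)"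
  proof (rule Bochner_Integration.integrable_bound)
    show "integrable lebesgue (\<lambda>x. 3 powr p * ((C2 * C1) powr p * indicat_real (cball 0 R) x + C2 powr p * norm (?U x) powr p))"
      by (intro integrable_mult_right Bochner_Integration.integrable_add Du_Lp integrable_indicator_cball)
    show "AE x in lebesgue. norm (norm (g x) powr p) \<le> norm (3 powr p * ((C2 * C1) powr p * indicat_real (cball 0 R) x + C2 powr p * norm (?U x) powr p))"
    proof (rule AE_I2)
      fix x
      have "norm (g x) powr p \<le> norm ((C2 * C1 * indicat_real (cball 0 R) x) + C2 * norm (?U x) + 0) powr p"
        using gle p1 by (intro powr_mono2) auto
      also have "\<dots> \<le> 3 powr p * (norm (C2 * C1 * indicat_real (cball 0 R) x) powr p + norm (C2 * norm (?U x)) powr p + norm (0::real) powr p)"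
        using p1 by (intro powr_norm_add3) auto
      also have "\<dots> = 3 powr p * ((C2 * C1) powr p * indicat_real (cball 0 R) x + C2 powr p * norm (?U x) powr p)"
        using C1 C2 by (auto simp: powr_mult indicator_def)
      finally show "norm (norm (g x) powr p) \<le> norm (3 powr p * ((C2 * C1) powr p * indicat_real (cball 0 R) x + C2 powr p * norm (?U x) powr p))"
        by simp
    qed
  qed measurable
  have W0: "\<psi> \<in> sobolev_W1_0 p \<Omega>"
    by (rule sobolev_W1_0I[OF open_\<Omega> w\<Omega> K(1) K\<Omega> z1 z2 _ \<psi>p gp]) (use p1 in auto)
  note s = sol[unfolded weak_solution_def, rule_format, OF W0]
  note wg = weak_grad_works[OF open_\<Omega> w\<Omega>]
  have Dum: "Du \<in> borel_measurable (lebesgue_on \<Omega>)"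
    using has_weak_gradient_measurable(2)[OF open_\<Omega> Du_v] .
  have gm: "g \<in> borel_measurable (lebesgue_on \<Omega>)" "\<psi> \<in> borel_measurable (lebesgue_on \<Omega>)"
    using has_weak_gradient_measurable[OF open_\<Omega> w\<Omega>] by auto
  have lhs: "(LINT x|lebesgue_on \<Omega>. (norm (weak_grad \<Omega> u x) powr (p - 2) *\<^sub>R weak_grad \<Omega> u x) \<bullet> weak_grad \<Omega> \<psi> x)
      = (LINT x|lebesgue. p_flux p (?U x) \<bullet> g x)"
  proof -
    have "(LINT x|lebesgue_on \<Omega>. (norm (Du x) powr (p - 2) *\<^sub>R Du x) \<bullet> weak_grad \<Omega> \<psi> x)
      = (LINT x|lebesgue_on \<Omega>. p_flux p (Du x) \<bullet> g x)"
    proof (rule integral_cong_AE)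
      show "(\<lambda>x. (norm (Du x) powr (p - 2) *\<^sub>R Du x) \<bullet> weak_grad \<Omega> \<psi> x) \<in> borel_measurable (lebesgue_on \<Omega>)"
        using Dum has_weak_gradient_measurable(2)[OF open_\<Omega> wg(1)] by measurable
      show "(\<lambda>x. p_flux p (Du x) \<bullet> g x) \<in> borel_measurable (lebesgue_on \<Omega>)"
        unfolding p_flux_def using Dum gm(1) by measurable
    qed (use wg(2) in eventually_elim, simp add: p_flux_def)
    also have "\<dots> = (LINT x|lebesgue. p_flux p (Du x) \<bullet> g x)"
      by (rule integral_lebesgue_on_supported[OF open_\<Omega>]) (simp add: z\<Omega>)
    also have "(\<lambda>x. p_flux p (Du x) \<bullet> g x) = (\<lambda>x. p_flux p (?U x) \<bullet> g x)"
      using z\<Omega>(2) by (auto simp: fun_eq_iff indicator_def)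
    finally show ?thesis by (simp add: Du_def)
  qed
  have vm: "v \<in> borel_measurable (lebesgue_on \<Omega>)" using has_weak_gradient_measurable(1)[OF open_\<Omega> Du_v] .
  have xm: "(\<lambda>x. norm x powr \<alpha>) \<in> borel_measurable (lebesgue_on \<Omega>)"
    by (intro measurable_restrict_space1 measurable_completion) measurable
  have srcm: "(\<lambda>x. source x * \<psi> x) \<in> borel_measurable (lebesgue_on \<Omega>)"
    unfolding source_def using vm gm(2) xm by measurable
  have AEsrc: "AE x in lebesgue_on \<Omega>. norm x powr \<alpha> * u x powr (p - 1) * \<psi> x = source x * \<psi> x"
    using v_AE by eventually_elim (simp add: source_def)
  have "integrable (lebesgue_on \<Omega>) (\<lambda>x. source x * \<psi> x)"
    by (rule integrable_cong_AE_imp[OF conjunct1[OF s] srcm AEsrc])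
  then show isrc: "integrable lebesgue (\<lambda>x. source x * \<psi> x)"
    by (subst (asm) integrable_lebesgue_on_supported[OF open_\<Omega>]) (simp_all add: z\<Omega>)
  have rhs: "(LINT x|lebesgue_on \<Omega>. norm x powr \<alpha> * u x powr (p - 1) * \<psi> x) = (LINT x|lebesgue. source x * \<psi> x)"
  proof -
    have "(LINT x|lebesgue_on \<Omega>. norm x powr \<alpha> * u x powr (p - 1) * \<psi> x) = (LINT x|lebesgue_on \<Omega>. source x * \<psi> x)"
      by (rule integral_cong_AE[OF borel_measurable_integrable[OF conjunct1[OF s]] srcm AEsrc])
    also have "\<dots> = (LINT x|lebesgue. source x * \<psi> x)"
      by (rule integral_lebesgue_on_supported[OF open_\<Omega>]) (simp add: z\<Omega>)
    finally show ?thesis .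
  qed
  have eqn: "(LINT x|lebesgue. p_flux p (?U x) \<bullet> g x) = - (LINT x|lebesgue. source x * \<psi> x)"
    using conjunct2[OF s] lhs rhs by simp
  have iU: "integrable lebesgue (\<lambda>x. p_flux p (?U x) \<bullet> g x)"
  proof (rule Bochner_Integration.integrable_bound)
    show "integrable lebesgue (\<lambda>x. norm (?U x) powr p + norm (g x) powr p)" using Du_Lp gp by simp
    show "(\<lambda>x. p_flux p (?U x) \<bullet> g x) \<in> borel_measurable lebesgue"
      unfolding p_flux_def using Du_measurable by measurable
    show "AE x in lebesgue. norm (p_flux p (?U x) \<bullet> g x) \<le> norm (norm (?U x) powr p + norm (g x) powr p)"
    proof (rule AE_I2)
      fix x
      have "\<bar>p_flux p (?U x) \<bullet> g x\<bar> \<le> norm (?U x) powr (p - 1) * norm (g x)"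
        using Cauchy_Schwarz_ineq2[of "p_flux p (?U x)" "g x"] by (simp only: norm_p_flux[OF p1])
      also have "\<dots> \<le> norm (?U x) powr p + norm (g x) powr p" by (rule powr_interp[OF p1]) auto
      finally show "norm (p_flux p (?U x) \<bullet> g x) \<le> norm (norm (?U x) powr p + norm (g x) powr p)" by simp
    qed
  qed
  have iw: "integrable lebesgue (\<lambda>x. p_flux p (Dw x) \<bullet> g x)"
  proof (rule supported_inner_integrable[OF B(1) _ K ig])
    show "continuous_on B (\<lambda>x. p_flux p (Dw x))"
      by (rule continuous_on_compose2[OF p_flux_continuous[OF p1] cDw]) auto
  qed (use z2 in auto)
  have "0 \<le> (LINT x|lebesgue. p_flux p (Dw x) \<bullet> g x - p_flux p (?U x) \<bullet> g x)"
  proof (rule Bochner_Integration.integral_nonneg)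
    fix x
    show "0 \<le> p_flux p (Dw x) \<bullet> g x - p_flux p (?U x) \<bullet> g x"
    proof (cases "x \<in> K")
      case True
      then have x: "x \<in> B" "x \<in> \<Omega>" using K K\<Omega> by auto
      have "p_flux p (Dw x) \<bullet> g x - p_flux p (?U x) \<bullet> g x = sat_deriv M (w x - v x) * ((p_flux p (Dw x) - p_flux p (Du x)) \<bullet> (Dw x - Du x))"
        using x by (simp add: g_def inner_diff_left right_diff_distrib)
      then show ?thesis by (simp only: mult_nonneg_nonneg[OF sat_deriv_nonneg p_flux_monotone[OF p1]])
    qed (simp add: z2)
  qed
  then show "0 \<le> (LINT x|lebesgue. p_flux p (Dw x) \<bullet> g x) + (LINT x|lebesgue. source x * \<psi> x)"
    using iw iU eqn by simp
qed

end

section \<open>Positivity spreads away from the origin\<close>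

text \<open>Passes from almost everywhere statements to pointwise ones for continuous functions.\<close>

lemma open_null_imp_empty:
  fixes S :: "'a::euclidean_space set"
  assumes "open S" "AE x in lebesgue. x \<notin> S" shows "S = {}"
proof -
  have "x \<in> - S" for x
    by (rule mem_closed_if_AE_lebesgue) (use assms in auto)
  then show ?thesis by auto
qed

text \<open>The integrand \<open>(h - s) \<psi>\<close> is nonnegative with integral at most zero.\<close>

lemma strict_gap_AE:
  fixes h s \<psi> :: "'a \<Rightarrow> real"
  assumes i: "integrable M (\<lambda>x. h x * \<psi> x)" "integrable M (\<lambda>x. s x * \<psi> x)"
    and le: "(LINT x|M. h x * \<psi> x) \<le> (LINT x|M. s x * \<psi> x)"
    and nn: "\<And>x. 0 \<le> \<psi> x" and gap: "AE x in M. \<psi> x \<noteq> 0 \<longrightarrow> s x < h x"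
  shows "AE x in M. \<psi> x = 0"
proof -
  have i': "integrable M (\<lambda>x. h x * \<psi> x - s x * \<psi> x)" using i by simp
  have n: "AE x in M. 0 \<le> h x * \<psi> x - s x * \<psi> x"
    using gap by eventually_elim (use nn in \<open>auto simp: left_diff_distrib[symmetric] intro: mult_right_mono\<close>)
  have "(LINT x|M. h x * \<psi> x - s x * \<psi> x) \<le> 0" using le i by simp
  moreover have "0 \<le> (LINT x|M. h x * \<psi> x - s x * \<psi> x)" using n by (rule integral_nonneg_AE)
  ultimately have "(LINT x|M. h x * \<psi> x - s x * \<psi> x) = 0" by linarith
  then have "AE x in M. h x * \<psi> x - s x * \<psi> x = 0"
    using integral_nonneg_eq_0_iff_AE[OF i' n] by simp
  with gap show ?thesis by eventually_elim (auto simp: left_diff_distrib[symmetric])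
qed

context continuous_solution
begin

lemma sat_AE_zero_imp_le:
  assumes B: "open B" "B \<subseteq> \<Omega>" and cw: "continuous_on B w" and M: "0 < M"
    and ae: "AE x in lebesgue. x \<in> B \<longrightarrow> sat M (w x - v x) = 0" and x: "x \<in> B"
  shows "w x \<le> v x"
proof -
  have cv: "continuous_on B v" using v_cont B(2) by (rule continuous_on_subset)
  let ?S = "{x \<in> B. 0 < w x - v x}"
  have "open (B \<inter> (\<lambda>x. w x - v x) -` {0<..})"
    by (intro continuous_open_preimage continuous_intros cw cv B)
  moreover have "B \<inter> (\<lambda>x. w x - v x) -` {0<..} = ?S" by auto
  ultimately have "open ?S" by (simp only:)
  moreover have "AE x in lebesgue. x \<notin> ?S"
    using ae
  proof eventually_elim
    case (elim x)
    then show ?case using sat_pos[OF M, of "w x - v x"] by auto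
  qed
  ultimately have "?S = {}" by (rule open_null_imp_empty)
  then show ?thesis using x by (auto simp: not_less)
qed

text \<open>The barrier is \<open>w = c (|x - z|\<^sup>-\<^sup>k - R1\<^sup>-\<^sup>k)\<close> on the annulus between a small ball around \<open>z\<close>, where \<open>v\<close> is
  bounded below, and the sphere of radius \<open>R\<close>.  As \<open>R1 < R\<close>, it is negative on the outer sphere, where nothing but
  \<open>v \<ge> 0\<close> is known; as \<open>|y - z| < R1\<close>, it is positive at \<open>y\<close>.  Its flux has divergence
  \<open>(c k)\<^sup>p\<^sup>-\<^sup>1 (2 s - n) |x - z|\<^sup>-\<^sup>2\<^sup>s\<close> with \<open>2 s = (k + 1) (p - 1) + 1\<close>, which for large \<open>k\<close> beats
  \<open>\<Lambda> w\<^sup>p\<^sup>-\<^sup>1\<close>.\<close>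

lemma annulus_positive:
  fixes z y :: 'a
  assumes sub: "cball z R \<subseteq> \<Omega>" and V: "\<And>x. x \<in> cball z R \<Longrightarrow> norm x powr \<alpha> \<le> \<Lambda>"
    and vz: "0 < v z" and y: "y \<in> ball z R"
  shows "0 < v y"
proof (cases "y = z")
  case False
  define d where "d = dist z y"
  have d: "0 < d" "d < R" using False y by (auto simp: d_def)
  define R1 where "R1 = (d + R) / 2"
  have R1: "d < R1" "R1 < R" using d by (auto simp: R1_def)
  have R: "0 < R" using d by simp
  have \<Lambda>: "0 \<le> \<Lambda>" using V[of z] R by (auto intro: order_trans[OF powr_ge_zero])
  have zO: "z \<in> \<Omega>" using sub R by auto
  have "isCont v z" using v_cont open_\<Omega> zO continuous_on_eq_continuous_at by blast
  then obtain \<rho>0 where \<rho>0: "0 < \<rho>0" "\<And>x. dist x z < \<rho>0 \<Longrightarrow> dist (v x) (v z) < v z / 2"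
    using vz unfolding continuous_at_eps_delta by (metis half_gt_zero)
  define \<rho> where "\<rho> = min (\<rho>0 / 2) (d / 2)"
  have \<rho>: "0 < \<rho>" "\<rho> < d" "\<rho> < \<rho>0" using \<rho>0 d by (auto simp: \<rho>_def)
  have v\<rho>: "v z / 2 < v x" if "dist z x = \<rho>" for x
  proof -
    have "dist (v x) (v z) < v z / 2" using that \<rho> by (intro \<rho>0(2)) (simp add: dist_commute)
    then show ?thesis by (simp add: dist_real_def abs_if split: if_splits)
  qed
  define n where "n = real DIM('a)"
  \<comment> \<open>The bound \<open>k (p - 1) > n + \<Lambda> R\<^sup>p\<close> makes \<open>2 s - n\<close> larger than \<open>\<Lambda> R\<^sup>p\<close>, and \<open>k \<ge> 1\<close> makes
    \<open>k\<^sup>p\<^sup>-\<^sup>1\<close> harmless.\<close>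
  define k where "k = max 1 ((n + \<Lambda> * R powr p + 1) / (p - 1))"
  have k: "1 \<le> k" "n + \<Lambda> * R powr p + 1 \<le> k * (p - 1)"
  proof -
    have "(n + \<Lambda> * R powr p + 1) / (p - 1) \<le> k" by (simp add: k_def)
    then show "n + \<Lambda> * R powr p + 1 \<le> k * (p - 1)" using p1 by (simp add: divide_le_eq)
  qed (simp add: k_def)
  \<comment> \<open>On the inner sphere \<open>w < c \<rho>\<^sup>-\<^sup>k = v z / 2 < v\<close>.\<close>
  define c where "c = v z / 2 * \<rho> powr k"
  have c: "0 < c" using vz \<rho> by (simp add: c_def)
  let ?t = "\<lambda>x. (x - z) \<bullet> (x - z)"
  have t: "?t x = (dist z x)\<^sup>2" for x by (simp add: dist_norm norm_minus_commute power2_norm_eq_inner)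
  define w where "w x = c * (?t x powr (- k / 2) - R1 powr (- k))" for x
  define Dw where "Dw x = (- (c * k) * ?t x powr (- k / 2 - 1)) *\<^sub>R (x - z)" for x
  define B where "B = ball z R - cball z \<rho>"
  have Bo: "open B" by (auto simp: B_def intro: open_Diff)
  have BO: "B \<subseteq> \<Omega>" using sub by (auto simp: B_def)
  have tpos: "0 < ?t x" if "\<rho> \<le> dist z x" for x unfolding t using that \<rho>(1) by (intro zero_less_power) linarith
  have tpr: "?t x powr a = dist z x powr (2 * a)" for x a
  proof -
    have "?t x powr a = (dist z x powr 2) powr a" unfolding t by (simp add: powr_numeral)
    then show ?thesis by (simp only: powr_powr)
  qed
  have w_eq: "w x = c * (dist z x powr (- k) - R1 powr (- k))" for x
    using tpr[of x "- k / 2"] by (simp add: w_def)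
  have dw: "GDERIV w x :> Dw x" if "x \<in> B" for x
  proof -
    have x: "0 < ?t x" using that tpos[of x] by (auto simp: B_def)
    have 1: "GDERIV ?t x :> 2 *\<^sub>R (x - z)"
      unfolding gderiv_def by (auto intro!: derivative_eq_intros simp: inner_commute)
    have 2: "DERIV (\<lambda>t. c * (t powr (- k / 2) - R1 powr (- k))) (?t x) :> c * ((- k / 2) * ?t x powr (- k / 2 - 1))"
      using x by (auto intro!: derivative_eq_intros)
    show ?thesis using GDERIV_DERIV_compose[OF 1 2] by (simp add: w_def[abs_def] Dw_def mult.assoc)
  qed
  have cDw: "continuous_on B Dw"
    unfolding Dw_def by (intro continuous_intros) (use tpos in \<open>force simp: B_def\<close>)
  define A where "A = cball z R - ball z \<rho>"
  have Ac: "compact A" by (auto simp: A_def intro: compact_diff)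
  have AO: "A \<subseteq> \<Omega>" using sub by (auto simp: A_def)
  have cwA: "continuous_on A w"
    unfolding w_def by (intro continuous_intros) (use tpos in \<open>force simp: A_def\<close>)
  have cvA: "continuous_on A v" using v_cont AO by (rule continuous_on_subset)
  define K where "K = {x \<in> A. v x \<le> w x}"
  have "closed (A \<inter> (\<lambda>x. w x - v x) -` {0..})"
    by (intro continuous_closed_preimage continuous_intros cwA cvA compact_imp_closed Ac)
  moreover have "A \<inter> (\<lambda>x. w x - v x) -` {0..} = K" by (auto simp: K_def)
  ultimately have "closed K" by (simp only:)
  then have Kc: "compact K"
  proof -
    have "K = A \<inter> K" by (auto simp: K_def)
    then show ?thesis using compact_Int_closed[OF Ac \<open>closed K\<close>] by simp
  qed
  have KB: "K \<subseteq> B"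
  proof
    fix x assume "x \<in> K"
    then have x: "x \<in> A" "v x \<le> w x" by (auto simp: K_def)
    have "dist z x \<noteq> \<rho>"
    proof
      assume e: "dist z x = \<rho>"
      have "w x \<le> c * \<rho> powr (- k)" using c by (simp add: w_eq e)
      also have "\<dots> = v z / 2" using \<rho> by (simp add: c_def powr_minus)
      finally show False using v\<rho>[OF e] x by simp
    qed
    moreover have "dist z x \<noteq> R"
    proof
      assume e: "dist z x = R"
      have "R powr (- k) < R1 powr (- k)" using R1 d k by (intro powr_less_mono2_neg) auto
      then have "w x < 0" using c by (simp add: w_eq e mult_less_0_iff)
      moreover have "0 \<le> v x" using x AO by (intro v_nonneg) auto
      ultimately show False using x by simp
    qed
    ultimately show "x \<in> B" using x by (auto simp: A_def B_def)
  qed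
  have out: "w x \<le> v x" if "x \<in> B" "x \<notin> K" for x
  proof -
    have "x \<in> A" using that by (auto simp: A_def B_def)
    then show ?thesis using that by (auto simp: K_def)
  qed
  note ci = comparison_inequality[OF Bo BO Kc KB zero_less_one dw cDw out]
  define \<psi> where "\<psi> x = indicat_real B x * sat 1 (w x - v x)" for x
  define g where "g x = indicat_real B x *\<^sub>R (sat_deriv 1 (w x - v x) *\<^sub>R (Dw x - Du x))" for x
  have \<psi>: "has_weak_gradient B \<psi> g" "\<And>x. x \<notin> K \<Longrightarrow> \<psi> x = 0" "\<And>x. x \<notin> K \<Longrightarrow> g x = 0"
    "integrable lebesgue \<psi>" "integrable lebesgue (\<lambda>x. source x * \<psi> x)"
    "0 \<le> (LINT x|lebesgue. p_flux p (Dw x) \<bullet> g x) + (LINT x|lebesgue. source x * \<psi> x)"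
    using ci unfolding \<psi>_def[abs_def] g_def[abs_def] by auto
  define s where "s = ((k + 1) * (p - 1) + 1) / 2"
  define C where "C = (c * k) powr (p - 1)"
  define q where "q t = - C * t powr (- s)" for t
  define q' where "q' t = C * s * t powr (- s - 1)" for t
  have flux: "p_flux p (Dw x) = q (?t x) *\<^sub>R (x - z)" if "x \<in> B" for x
  proof -
    let ?r = "dist z x"
    have r: "0 < ?r" using that \<rho> by (auto simp: B_def)
    have nD: "norm (Dw x) = c * k * ?r powr (- k - 1)"
    proof -
      have "norm (Dw x) = c * k * ?t x powr (- k / 2 - 1) * ?r"
        using c k by (simp add: Dw_def dist_norm norm_minus_commute)
      also have "?t x powr (- k / 2 - 1) = ?r powr (- k - 2)" using tpr[of x "- k / 2 - 1"] by (simp add: algebra_simps)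
      also have "c * k * ?r powr (- k - 2) * ?r = c * k * ?r powr (- k - 1)"
      proof -
        have "?r powr (- k - 1) = ?r powr ((- k - 2) + 1)" by (rule arg_cong[where f="\<lambda>e. ?r powr e"]) linarith
        also have "\<dots> = ?r powr (- k - 2) * ?r" unfolding powr_add using r by simp
        finally show ?thesis by simp
      qed
      finally show ?thesis .
    qed
    have fx: "norm (Dw x) powr (p - 2) * (- (c * k) * ?t x powr (- k / 2 - 1)) = q (?t x)"
    proof -
      have a1: "norm (Dw x) powr (p - 2) = (c * k) powr (p - 2) * ?r powr ((- k - 1) * (p - 2))"
        using c k r by (simp add: nD powr_mult powr_powr)
      have a2: "(c * k) powr (p - 2) * (c * k) = C" using c k p1 by (simp add: C_def powr_shift)
      have a3: "?r powr ((- k - 1) * (p - 2)) * ?r powr (- k - 2) = ?r powr (- 2 * s)"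
        unfolding powr_add[symmetric] by (rule arg_cong[where f="\<lambda>e. ?r powr e"]) (simp add: s_def algebra_simps)
      have a4: "?t x powr (- k / 2 - 1) = ?r powr (- k - 2)" using tpr[of x "- k / 2 - 1"] by (simp add: algebra_simps)
      have a5: "?t x powr (- s) = ?r powr (- 2 * s)" using tpr[of x "- s"] by simp
      have "norm (Dw x) powr (p - 2) * (- (c * k) * ?t x powr (- k / 2 - 1))
          = - (((c * k) powr (p - 2) * (c * k)) * (?r powr ((- k - 1) * (p - 2)) * ?r powr (- k - 2)))"
        unfolding a1 a4 by (simp only: mult_minus_left mult_minus_right mult_ac)
      then show ?thesis unfolding a2 a3 q_def a5 by simp
    qed
    have "p_flux p (Dw x) = (norm (Dw x) powr (p - 2) * (- (c * k) * ?t x powr (- k / 2 - 1))) *\<^sub>R (x - z)"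
      unfolding p_flux_def by (subst (2) Dw_def) (simp only: scaleR_scaleR)
    then show ?thesis unfolding fx .
  qed
  have div: "(LINT x|lebesgue. (q (?t x) *\<^sub>R (x - z)) \<bullet> g x) = - (LINT x|lebesgue. (DIM('a) * q (?t x) + 2 * ?t x * q' (?t x)) * \<psi> x)"
  proof (rule radial_divergence_weak[where A=B and T="{0<..}", OF Bo _ _ _ \<psi>(1) Kc KB])
    show "?t x \<in> {0<..}" if "x \<in> B" for x using that tpos[of x] by (auto simp: B_def)
    show "DERIV q t :> q' t" if "t \<in> {0<..}" for t
      unfolding q_def q'_def using that by (auto intro!: derivative_eq_intros)
    show "continuous_on {0<..} q'" unfolding q'_def by (intro continuous_intros) auto
  qed (use \<psi> in auto)
  define h where "h x = C * (2 * s - n) * ?t x powr (- s)" for x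
  have hB: "(DIM('a) * q (?t x) + 2 * ?t x * q' (?t x)) * \<psi> x = h x * \<psi> x" for x
  proof (cases "x \<in> B")
    case True
    then have "0 < ?t x" using tpos[of x] by (auto simp: B_def)
    then have "?t x * ?t x powr (- s - 1) = ?t x powr (- s)" by (simp add: powr_mult_base)
    then have "2 * ?t x * q' (?t x) = 2 * C * s * ?t x powr (- s)" by (simp add: q'_def mult_ac)
    then show ?thesis by (simp add: q_def h_def n_def algebra_simps)
  qed (simp add: \<psi>_def)
  have fl: "(LINT x|lebesgue. p_flux p (Dw x) \<bullet> g x) = - (LINT x|lebesgue. h x * \<psi> x)"
  proof -
    have "(\<lambda>x. p_flux p (Dw x) \<bullet> g x) = (\<lambda>x. (q (?t x) *\<^sub>R (x - z)) \<bullet> g x)"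
      using flux by (auto simp: fun_eq_iff g_def indicator_def)
    then show ?thesis using div by (simp only: hB)
  qed
  have ch: "continuous_on B h"
    unfolding h_def by (intro continuous_intros) (use tpos in \<open>force simp: B_def\<close>)
  have ih: "integrable lebesgue (\<lambda>x. h x * \<psi> x)"
    using supported_inner_integrable[OF Bo ch Kc KB \<psi>(4) \<psi>(2)] by (metis inner_real_def)
  have gap: "source x < h x" if "\<psi> x \<noteq> 0" for x
  proof -
    have xK: "x \<in> K" using \<psi>(2) that by blast
    then have x: "x \<in> B" "v x \<le> w x" using KB by (auto simp: K_def)
    let ?r = "dist z x"
    have r: "0 < ?r" "?r < R" using x \<rho> by (auto simp: B_def)
    have "w x \<le> c * ?r powr (- k)" using c by (simp add: w_eq)
    then have "v x powr (p - 1) \<le> (c * ?r powr (- k)) powr (p - 1)"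
      using x p1 BO by (intro powr_mono2 v_nonneg) auto
    also have "\<dots> = c powr (p - 1) * ?r powr (- k * (p - 1))" using c by (simp add: powr_mult powr_powr)
    finally have "source x \<le> \<Lambda> * (c powr (p - 1) * ?r powr (- k * (p - 1)))"
      unfolding source_def using r by (intro mult_mono V) (auto simp: \<Lambda>)
    also have "\<dots> < h x"
    proof -
      have 1: "?t x powr (- s) = ?r powr (- k * (p - 1)) * ?r powr (- p)"
        unfolding powr_add[symmetric] tpr
        by (rule arg_cong[where f="\<lambda>e. ?r powr e"]) (simp add: s_def field_simps)
      have 2: "\<Lambda> < (2 * s - n) * ?r powr (- p)"
      proof -
        have "\<Lambda> * R powr p < 2 * s - n" using k p1 by (simp add: s_def algebra_simps)
        moreover have "?r powr p \<le> R powr p" using r p1 by (intro powr_mono2) auto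
        ultimately have "\<Lambda> * ?r powr p < 2 * s - n" using \<Lambda> by (meson le_less_trans mult_left_mono)
        then show ?thesis using r by (simp add: powr_minus field_simps)
      qed
      have 3: "1 \<le> k powr (p - 1)" using k p1 by (intro ge_one_powr_ge_zero) auto
      have pos: "0 < c powr (p - 1) * ?r powr (- k * (p - 1))" using c r by simp
      have "\<Lambda> * (c powr (p - 1) * ?r powr (- k * (p - 1))) < ((2 * s - n) * ?r powr (- p)) * (c powr (p - 1) * ?r powr (- k * (p - 1)))"
        using 2 pos by (rule mult_strict_right_mono)
      also have "\<dots> \<le> k powr (p - 1) * (((2 * s - n) * ?r powr (- p)) * (c powr (p - 1) * ?r powr (- k * (p - 1))))"
      proof -
        have "0 \<le> (2 * s - n) * ?r powr (- p)" using 2 \<Lambda> by linarith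
        from mult_right_mono[OF 3 mult_nonneg_nonneg[OF this less_imp_le[OF pos]]]
        show ?thesis by simp
      qed
      also have "\<dots> = h x" unfolding h_def C_def 1 using c k by (simp add: powr_mult mult_ac)
      finally show ?thesis .
    qed
    finally show ?thesis .
  qed
  have "AE x in lebesgue. \<psi> x = 0"
    by (rule strict_gap_AE[OF ih \<psi>(5)]) (use \<psi>(6) fl gap in \<open>auto simp: \<psi>_def sat_nonneg\<close>)
  then have ae: "AE x in lebesgue. x \<in> B \<longrightarrow> sat 1 (w x - v x) = 0"
    by eventually_elim (auto simp: \<psi>_def)
  have yB: "y \<in> B" using \<rho> d by (simp add: B_def d_def)
  have cw: "continuous_on B w"
    using dw by (auto simp: gderiv_def intro!: continuous_at_imp_continuous_on has_derivative_continuous)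
  have "w y \<le> v y" by (rule sat_AE_zero_imp_le[OF Bo BO cw zero_less_one ae yB])
  moreover have "0 < w y"
  proof -
    have "R1 powr (- k) < d powr (- k)" using R1 d k by (intro powr_less_mono2_neg) auto
    then show ?thesis using c by (simp add: w_eq d_def[symmetric])
  qed
  ultimately show ?thesis by linarith
qed (use vz in simp)

end

section \<open>Radial barriers at the origin\<close>

text \<open>Fatou's lemma in terms of real integrals that are only known to be bounded by a convergent sequence.\<close>

lemma integrable_fatou:
  fixes f :: "nat \<Rightarrow> 'a \<Rightarrow> real"
  assumes i: "\<And>j. integrable M (f j)" and nn: "\<And>j x. 0 \<le> f j x"
    and lim: "AE x in M. (\<lambda>j. f j x) \<longlonglongrightarrow> F x" and F: "F \<in> borel_measurable M"
    and le: "\<And>j. (LINT x|M. f j x) \<le> Lj j" and L: "Lj \<longlonglongrightarrow> L"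
  shows "integrable M F" "(LINT x|M. F x) \<le> L"
proof -
  have "0 \<le> Lj j" for j using le[of j] Bochner_Integration.integral_nonneg[of M "f j"] nn by fastforce
  then have L0: "0 \<le> L" by (intro LIMSEQ_le_const[OF L]) auto
  have F0: "AE x in M. 0 \<le> F x"
    using lim by eventually_elim (rule LIMSEQ_le_const, auto simp: nn)
  have "(\<integral>\<^sup>+x. ennreal (F x) \<partial>M) = (\<integral>\<^sup>+x. liminf (\<lambda>j. ennreal (f j x)) \<partial>M)"
  proof (rule nn_integral_cong_AE)
    show "AE x in M. ennreal (F x) = liminf (\<lambda>j. ennreal (f j x))"
      using lim
    proof eventually_elim
      case (elim x)
      then have "(\<lambda>j. ennreal (f j x)) \<longlonglongrightarrow> ennreal (F x)" by (rule tendsto_ennrealI)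
      then show ?case by (rule lim_imp_Liminf[symmetric, rotated]) simp
    qed
  qed
  also have "\<dots> \<le> liminf (\<lambda>j. \<integral>\<^sup>+x. ennreal (f j x) \<partial>M)"
    using i by (intro nn_integral_liminf) auto
  also have "(\<lambda>j. \<integral>\<^sup>+x. ennreal (f j x) \<partial>M) = (\<lambda>j. ennreal (LINT x|M. f j x))"
    using i nn by (intro ext nn_integral_eq_integral) auto
  also have "liminf \<dots> \<le> liminf (\<lambda>j. ennreal (Lj j))"
    by (rule Liminf_mono) (auto intro!: always_eventually ennreal_leI le)
  also have "\<dots> = ennreal L"
    by (rule lim_imp_Liminf) (auto intro: tendsto_ennrealI L)
  finally have le: "(\<integral>\<^sup>+x. ennreal (F x) \<partial>M) \<le> ennreal L" .
  show iF: "integrable M F"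
    by (rule integrableI_nonneg[OF F F0]) (use le in \<open>auto intro: le_less_trans\<close>)
  have "ennreal (LINT x|M. F x) \<le> ennreal L" using nn_integral_eq_integral[OF iF F0] le by simp
  then show "(LINT x|M. F x) \<le> L" using L0 by simp
qed

text \<open>The sign of the divergence of the doubly regularised radial field in \<open>origin_barrier\<close>, with \<open>t = r\<^sup>2\<close>.
  Positivity is visible only after regrouping.\<close>

lemma regularised_divergence_nonneg:
  fixes t \<epsilon> \<delta> n \<beta> p :: real
  assumes t: "0 \<le> t" and d: "0 < \<delta>" "\<delta> \<le> \<epsilon>" and n: "1 \<le> n" and \<beta>: "- n \<le> \<beta>" and p: "1 < p"
  shows "0 \<le> n * (t + \<epsilon>\<^sup>2) * (t + \<delta>\<^sup>2) + (\<beta> - p + 2) * t * (t + \<delta>\<^sup>2) + (p - 2) * t * (t + \<epsilon>\<^sup>2)"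
proof -
  have e: "\<delta>\<^sup>2 \<le> \<epsilon>\<^sup>2" using d by (intro power_mono) auto
  have e0: "0 \<le> \<delta>\<^sup>2" "0 \<le> \<epsilon>\<^sup>2" by auto
  have "n * (t + \<epsilon>\<^sup>2) * (t + \<delta>\<^sup>2) + (\<beta> - p + 2) * t * (t + \<delta>\<^sup>2) + (p - 2) * t * (t + \<epsilon>\<^sup>2)
     = (n + \<beta>) * (t * (t + \<delta>\<^sup>2)) + (p - 1) * (t * (\<epsilon>\<^sup>2 - \<delta>\<^sup>2)) + (n - 1) * (\<epsilon>\<^sup>2 * (t + \<delta>\<^sup>2)) + (\<epsilon>\<^sup>2 + t) * \<delta>\<^sup>2"
    by (simp add: algebra_simps)
  also have "0 \<le> \<dots>"
  proof -
    have "0 \<le> (n + \<beta>) * (t * (t + \<delta>\<^sup>2))" using t e0 \<beta> by (intro mult_nonneg_nonneg) linarith+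
    moreover have "0 \<le> (p - 1) * (t * (\<epsilon>\<^sup>2 - \<delta>\<^sup>2))" using t e p by (intro mult_nonneg_nonneg) linarith+
    moreover have "0 \<le> (n - 1) * (\<epsilon>\<^sup>2 * (t + \<delta>\<^sup>2))" using t e0 n by (intro mult_nonneg_nonneg) linarith+
    moreover have "0 \<le> (\<epsilon>\<^sup>2 + t) * \<delta>\<^sup>2" using t e0 by (intro mult_nonneg_nonneg) linarith+
    ultimately show ?thesis by linarith
  qed
  finally show ?thesis .
qed

context continuous_solution
begin

text \<open>Comparison on a ball around the origin with \<open>w = C + c (r\<^sup>2 + \<epsilon>\<^sup>2)\<^sup>\<gamma>\<^sup>/\<^sup>2\<close>.  The flux of \<open>w\<close> is a multiple of
  \<open>(r\<^sup>2 + \<epsilon>\<^sup>2)\<^sup>a r\<^sup>p\<^sup>-\<^sup>2 x\<close> with \<open>2 a = \<beta> - p + 2\<close>, and \<open>h\<close> is its divergence.  For \<open>\<epsilon> \<rightarrow> 0\<close> it tends to a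
  multiple of \<open>(n + \<beta>) r\<^sup>\<beta>\<close> if \<open>\<beta> > - n\<close> and to a point mass if \<open>\<beta> = - n\<close>.  Because of the factor
  \<open>r\<^sup>p\<^sup>-\<^sup>2\<close> the flux need not be \<open>C\<^sup>1\<close> at the origin; replacing this factor by
  \<open>(r\<^sup>2 + \<delta>\<^sup>2)\<^sup>(\<^sup>p\<^sup>-\<^sup>2\<^sup>)\<^sup>/\<^sup>2\<close> gives smooth fields with nonnegative divergence, and Fatou's lemma for \<open>\<delta> \<rightarrow> 0\<close>
  leaves the inequality that is needed.\<close>

lemma origin_barrier:
  fixes \<beta> c C \<epsilon> M R :: real
  assumes \<beta>: "- real DIM('a) \<le> \<beta>" "- p < \<beta>" and c: "0 < c" and \<epsilon>: "0 < \<epsilon>" and M: "0 < M" and R: "0 < R"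
    and sub: "cball 0 R \<subseteq> \<Omega>"
  defines "\<gamma> \<equiv> (\<beta> + p) / (p - 1)"
  assumes bdry: "\<And>x. norm x = R \<Longrightarrow> C + c * (R\<^sup>2 + \<epsilon>\<^sup>2) powr (\<gamma> / 2) < v x"
  defines "w \<equiv> \<lambda>x::'a. C + c * (x \<bullet> x + \<epsilon>\<^sup>2) powr (\<gamma> / 2)"
    and "h \<equiv> \<lambda>x::'a. (c * \<gamma>) powr (p - 1) * (x \<bullet> x + \<epsilon>\<^sup>2) powr ((\<gamma> / 2 - 1) * (p - 1) - 1) * norm x powr (p - 2)
       * ((DIM('a) + \<beta>) * (x \<bullet> x) + (DIM('a) + p - 2) * \<epsilon>\<^sup>2)"
  defines "\<psi> \<equiv> \<lambda>x. indicat_real (ball 0 R) x * sat M (w x - v x)"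
  shows "integrable lebesgue (\<lambda>x. source x * \<psi> x)" "integrable lebesgue (\<lambda>x. h x * \<psi> x)"
    "(LINT x|lebesgue. h x * \<psi> x) \<le> (LINT x|lebesgue. source x * \<psi> x)"
proof -
  define n where "n = real DIM('a)"
  have n: "1 \<le> n" using DIM_positive[where 'a='a] by (simp add: n_def Suc_le_eq)
  have \<gamma>: "0 < \<gamma>" using \<beta> p1 by (simp add: \<gamma>_def)
  define a where "a = (\<gamma> / 2 - 1) * (p - 1)"
  have a2: "2 * a = \<beta> - p + 2" using p1 by (simp add: a_def \<gamma>_def field_simps)
  define b where "b = (p - 2) / 2"
  define \<kappa> where "\<kappa> = (c * \<gamma>) powr (p - 1)"
  have \<kappa>: "0 \<le> \<kappa>" by (simp add: \<kappa>_def)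
  let ?t = "\<lambda>x::'a. x \<bullet> x"
  let ?S = "\<lambda>x::'a. x \<bullet> x + \<epsilon>\<^sup>2"
  have S: "0 < ?S x" for x using \<epsilon> by (simp add: add_nonneg_pos)
  define Dw where "Dw x = (c * \<gamma> * ?S x powr (\<gamma> / 2 - 1)) *\<^sub>R x" for x
  define B where "B = ball (0::'a) R"
  have Bo: "open B" and BO: "B \<subseteq> \<Omega>" using sub by (auto simp: B_def)
  have dw: "GDERIV w x :> Dw x" for x
  proof -
    have 1: "GDERIV ?t x :> 2 *\<^sub>R x"
      unfolding gderiv_def by (auto intro!: derivative_eq_intros simp: inner_commute)
    have 2: "DERIV (\<lambda>t. C + c * (t + \<epsilon>\<^sup>2) powr (\<gamma> / 2)) (?t x) :> c * ((\<gamma> / 2) * ?S x powr (\<gamma> / 2 - 1))"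
      using S[of x] by (auto intro!: derivative_eq_intros)
    show ?thesis using GDERIV_DERIV_compose[OF 1 2] by (simp add: w_def Dw_def mult.assoc)
  qed
  have cS: "continuous_on X (\<lambda>x. ?S x powr e)" for X e
    by (intro continuous_intros) (use S in \<open>auto simp: less_le\<close>)
  have cDw: "continuous_on B Dw" unfolding Dw_def by (intro continuous_intros cS)
  define A where "A = cball (0::'a) R"
  have cw: "continuous_on X w" for X unfolding w_def by (intro continuous_intros cS)
  have cvA: "continuous_on A v" using v_cont sub unfolding A_def by (rule continuous_on_subset)
  define K where "K = {x \<in> A. v x \<le> w x}"
  have "closed (A \<inter> (\<lambda>x. w x - v x) -` {0..})"
    by (intro continuous_closed_preimage continuous_intros cw cvA) (simp add: A_def)
  moreover have KA: "A \<inter> (\<lambda>x. w x - v x) -` {0..} = K" by (auto simp: K_def)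
  ultimately have "closed K" by (simp only:)
  moreover have "K = A \<inter> K" by (auto simp: K_def)
  ultimately have Kc: "compact K" using compact_Int_closed[of A K] by (simp add: A_def)
  have KB: "K \<subseteq> B"
  proof
    fix x assume x: "x \<in> K"
    have "norm x \<noteq> R"
    proof
      assume e: "norm x = R"
      have "x \<bullet> x = R\<^sup>2" by (simp add: e[symmetric] power2_norm_eq_inner)
      then have "w x < v x" using bdry[OF e] by (simp add: w_def)
      then show False using x by (simp add: K_def)
    qed
    then show "x \<in> B" using x by (auto simp: K_def A_def B_def)
  qed
  have out: "w x \<le> v x" if "x \<in> B" "x \<notin> K" for x
    using that by (auto simp: K_def A_def B_def)
  define g where "g x = indicat_real B x *\<^sub>R (sat_deriv M (w x - v x) *\<^sub>R (Dw x - Du x))" for x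
  have \<psi>B: "\<psi> = (\<lambda>x. indicat_real B x * sat M (w x - v x))" by (simp add: \<psi>_def B_def)
  note ci = comparison_inequality[OF Bo BO Kc KB M dw cDw out]
  have \<psi>: "has_weak_gradient B \<psi> g" "\<And>x. x \<notin> K \<Longrightarrow> \<psi> x = 0" "\<And>x. x \<notin> K \<Longrightarrow> g x = 0"
    "integrable lebesgue \<psi>" "integrable lebesgue g" "integrable lebesgue (\<lambda>x. source x * \<psi> x)"
    "0 \<le> (LINT x|lebesgue. p_flux p (Dw x) \<bullet> g x) + (LINT x|lebesgue. source x * \<psi> x)"
    using ci unfolding \<psi>B g_def[abs_def] by auto
  show "integrable lebesgue (\<lambda>x. source x * \<psi> x)" by (rule \<psi>(6))
  have flux: "p_flux p (Dw x) = (\<kappa> * ?S x powr a * norm x powr (p - 2)) *\<^sub>R x" for x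
  proof -
    let ?e = "c * \<gamma> * ?S x powr (\<gamma> / 2 - 1)"
    have e: "0 < ?e" using c \<gamma> S[of x] by simp
    have nD: "norm (Dw x) = ?e * norm x" using e by (simp add: Dw_def)
    have "norm (Dw x) powr (p - 2) * ?e = (?e powr (p - 2) * ?e) * norm x powr (p - 2)"
      unfolding nD using e by (subst powr_mult) (auto simp: mult_ac)
    also have "?e powr (p - 2) * ?e = ?e powr (p - 1)" using e p1 by (intro powr_shift) auto
    also have "\<dots> = \<kappa> * ?S x powr a"
      using c \<gamma> S[of x] by (simp add: powr_mult powr_powr \<kappa>_def a_def)
    finally have fx: "norm (Dw x) powr (p - 2) * ?e = \<kappa> * ?S x powr a * norm x powr (p - 2)" .
    have "p_flux p (Dw x) = (norm (Dw x) powr (p - 2) * ?e) *\<^sub>R x"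
      unfolding p_flux_def by (subst (2) Dw_def) (simp only: scaleR_scaleR)
    then show ?thesis unfolding fx .
  qed
  define \<delta> where "\<delta> j = \<epsilon> / real (Suc j)" for j
  have \<delta>: "0 < \<delta> j" "\<delta> j \<le> \<epsilon>" for j using \<epsilon> by (auto simp: \<delta>_def field_simps)
  have \<delta>0: "\<delta> \<longlonglongrightarrow> 0"
    unfolding \<delta>_def using tendsto_mult_right_zero[OF LIMSEQ_inverse_real_of_nat, of \<epsilon>] by (simp add: divide_inverse)
  have \<delta>sq: "0 < (\<delta> j)\<^sup>2" for j using \<delta>(1)[of j] by simp
  define q where "q j t = \<kappa> * (t + \<epsilon>\<^sup>2) powr a * (t + (\<delta> j)\<^sup>2) powr b" for j t
  define q' where "q' j t = \<kappa> * (a * (t + \<epsilon>\<^sup>2) powr (a - 1)) * (t + (\<delta> j)\<^sup>2) powr b + \<kappa> * (t + \<epsilon>\<^sup>2) powr a * (b * (t + (\<delta> j)\<^sup>2) powr (b - 1))" for j t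
  define E where "E j t = \<kappa> * (t + \<epsilon>\<^sup>2) powr (a - 1) * (t + (\<delta> j)\<^sup>2) powr (b - 1)
    * (n * (t + \<epsilon>\<^sup>2) * (t + (\<delta> j)\<^sup>2) + (\<beta> - p + 2) * t * (t + (\<delta> j)\<^sup>2) + (p - 2) * t * (t + \<epsilon>\<^sup>2))" for j t
  have tp: "0 < t + \<epsilon>\<^sup>2" "0 < t + (\<delta> j)\<^sup>2" if "0 \<le> t" for t j
    using that \<epsilon> \<delta>sq[of j] by (auto intro: add_nonneg_pos)
  have E_eq: "n * q j t + 2 * t * q' j t = E j t" if t: "0 \<le> t" for j t
  proof -
    have 1: "(t + \<epsilon>\<^sup>2) powr a = (t + \<epsilon>\<^sup>2) powr (a - 1) * (t + \<epsilon>\<^sup>2)"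
      using powr_mult_base[of "t + \<epsilon>\<^sup>2" "a - 1"] tp(1)[OF t] by (simp add: mult.commute)
    have 2: "(t + (\<delta> j)\<^sup>2) powr b = (t + (\<delta> j)\<^sup>2) powr (b - 1) * (t + (\<delta> j)\<^sup>2)"
      using powr_mult_base[of "t + (\<delta> j)\<^sup>2" "b - 1"] tp(2)[OF t, of j] by (simp add: mult.commute)
    have "n * q j t + 2 * t * q' j t = \<kappa> * (t + \<epsilon>\<^sup>2) powr (a - 1) * (t + (\<delta> j)\<^sup>2) powr (b - 1)
      * (n * (t + \<epsilon>\<^sup>2) * (t + (\<delta> j)\<^sup>2) + (2 * a) * t * (t + (\<delta> j)\<^sup>2) + (2 * b) * t * (t + \<epsilon>\<^sup>2))"
      unfolding q_def q'_def 1 2 by (simp only: algebra_simps)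
    also have "2 * b = p - 2" by (simp add: b_def)
    finally show ?thesis unfolding E_def a2 .
  qed
  have E0: "0 \<le> E j t" if "0 \<le> t" for j t
    unfolding E_def
    by (intro mult_nonneg_nonneg[OF mult_nonneg_nonneg[OF mult_nonneg_nonneg[OF \<kappa>]]] regularised_divergence_nonneg that \<delta> n p1)
       (use \<beta> in \<open>auto simp: n_def\<close>)
  have div: "(LINT x|lebesgue. (q j (?t x) *\<^sub>R x) \<bullet> g x) = - (LINT x|lebesgue. E j (?t x) * \<psi> x)" for j
  proof -
    have "(LINT x|lebesgue. (q j ((x - 0) \<bullet> (x - 0)) *\<^sub>R (x - 0)) \<bullet> g x) =
      - (LINT x|lebesgue. (DIM('a) * q j ((x - 0) \<bullet> (x - 0)) + 2 * ((x - 0) \<bullet> (x - 0)) * q' j ((x - 0) \<bullet> (x - 0))) * \<psi> x)"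
    proof (rule radial_divergence_weak[where A=B and T="{0..}", OF Bo _ _ _ \<psi>(1) Kc KB])
      show "DERIV (q j) t :> q' j t" if "t \<in> {0..}" for t
        unfolding q_def[abs_def] q'_def using tp(1)[of t] tp(2)[of t j] that by (auto intro!: derivative_eq_intros)
      show "continuous_on {0..} (q' j)"
        unfolding q'_def by (intro continuous_intros) (use tp in \<open>force simp: less_le\<close>)+
    qed (use \<psi> in auto)
    moreover have "DIM('a) * q j (?t x) + 2 * ?t x * q' j (?t x) = E j (?t x)" for x
      using E_eq[of "?t x" j] by (simp add: n_def)
    ultimately show ?thesis by (simp only: diff_zero)
  qed
  have cE: "continuous_on B (\<lambda>x. E j (?t x))" for j
    unfolding E_def by (intro continuous_intros) (use tp[OF inner_ge_zero] in \<open>force simp: less_le\<close>)+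
  have iE: "integrable lebesgue (\<lambda>x. E j (?t x) * \<psi> x)" for j
    using supported_inner_integrable[OF Bo cE Kc KB \<psi>(4) \<psi>(2)] by (metis inner_real_def)
  have \<delta>lim: "(\<lambda>j. ?t x + (\<delta> j)\<^sup>2) \<longlonglongrightarrow> ?t x" for x :: 'a
    using tendsto_add[OF tendsto_const tendsto_power[OF \<delta>0, of 2]] by simp
  have tb: "?t x powr b = norm x powr (p - 2)" for x :: 'a
  proof (cases "x = 0")
    case False
    have "?t x = norm x powr 2" using False by (simp add: powr_numeral power2_norm_eq_inner)
    then have "?t x powr b = norm x powr (2 * b)" by (simp only: powr_powr)
    moreover have "2 * b = p - 2" by (simp add: b_def)
    ultimately show ?thesis by (simp only:)
  qed simp
  have limq: "(\<lambda>j. (q j (?t x) *\<^sub>R x) \<bullet> g x) \<longlonglongrightarrow> p_flux p (Dw x) \<bullet> g x" for x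
  proof (cases "x = 0")
    case False
    have "(\<lambda>j. (?t x + (\<delta> j)\<^sup>2) powr b) \<longlonglongrightarrow> ?t x powr b"
      by (rule tendsto_powr[OF \<delta>lim tendsto_const]) (use False in simp)
    then have "(\<lambda>j. ((\<kappa> * ?S x powr a * (?t x + (\<delta> j)\<^sup>2) powr b) *\<^sub>R x) \<bullet> g x) \<longlonglongrightarrow> ((\<kappa> * ?S x powr a * ?t x powr b) *\<^sub>R x) \<bullet> g x"
      by (intro tendsto_inner tendsto_scaleR tendsto_mult tendsto_const)
    then show ?thesis unfolding q_def flux tb .
  qed (simp add: flux)
  \<comment> \<open>A bound for the fields \<open>q j (r\<^sup>2) x\<close> that is uniform in \<open>j\<close>, from \<open>r \<le> (r\<^sup>2 + \<delta>\<^sup>2)\<^sup>1\<^sup>/\<^sup>2\<close>.\<close>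
  define F where "F x = \<kappa> * ?S x powr (a + (p - 1) / 2)" for x
  have F0: "0 \<le> F x" for x using \<kappa> by (simp add: F_def)
  have cF: "continuous_on B F" unfolding F_def by (intro continuous_intros cS)
  have bq: "\<bar>(q j (?t x) *\<^sub>R x) \<bullet> g x\<bar> \<le> F x * norm (g x)" for j x
  proof -
    let ?T = "?t x + (\<delta> j)\<^sup>2"
    have T: "0 < ?T" using tp(2)[OF inner_ge_zero] .
    have "norm x powr 1 \<le> ?T powr (1 / 2)"
    proof -
      have "norm x = sqrt (?t x)" by (simp add: norm_eq_sqrt_inner)
      also have "\<dots> \<le> sqrt ?T" by simp
      finally show ?thesis using T by (simp add: powr_half_sqrt)
    qed
    then have "?T powr b * norm x \<le> ?T powr b * ?T powr (1 / 2)" by (intro mult_left_mono) auto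
    also have "\<dots> = ?T powr ((p - 1) / 2)"
      unfolding powr_add[symmetric] by (rule arg_cong[where f="\<lambda>e. ?T powr e"]) (simp add: b_def field_simps)
    also have "\<dots> \<le> ?S x powr ((p - 1) / 2)"
      using T p1 \<delta>[of j] by (intro powr_mono2) (auto intro: power_mono)
    finally have "?T powr b * norm x \<le> ?S x powr ((p - 1) / 2)" .
    then have "(\<kappa> * ?S x powr a) * (?T powr b * norm x) \<le> (\<kappa> * ?S x powr a) * ?S x powr ((p - 1) / 2)"
      using \<kappa> by (intro mult_left_mono) auto
    then have "norm (q j (?t x) *\<^sub>R x) \<le> F x"
      using \<kappa> by (simp add: q_def F_def powr_add mult.assoc abs_mult)
    then have "norm (q j (?t x) *\<^sub>R x) * norm (g x) \<le> F x * norm (g x)" by (intro mult_right_mono) auto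
    then show ?thesis using Cauchy_Schwarz_ineq2[of "q j (?t x) *\<^sub>R x" "g x"] by linarith
  qed
  have "(\<lambda>j. LINT x|lebesgue. (q j (?t x) *\<^sub>R x) \<bullet> g x) \<longlonglongrightarrow> (LINT x|lebesgue. p_flux p (Dw x) \<bullet> g x)"
  proof (rule integral_dominated_convergence[where w="\<lambda>x. F x * norm (g x)"])
    have "integrable lebesgue (\<lambda>x. norm (g x))" using \<psi>(5) by simp
    moreover have "\<And>x. x \<notin> K \<Longrightarrow> norm (g x) = 0" using \<psi>(3) by simp
    ultimately show "integrable lebesgue (\<lambda>x. F x * norm (g x))"
      using supported_inner_integrable[OF Bo cF Kc KB] by (metis inner_real_def)
    have cq: "continuous_on B (\<lambda>x. q j (?t x) *\<^sub>R x)" for j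
      unfolding q_def by (intro continuous_intros) (use tp[OF inner_ge_zero] in \<open>force simp: less_le\<close>)+
    show "(\<lambda>x. (q j (?t x) *\<^sub>R x) \<bullet> g x) \<in> borel_measurable lebesgue" for j
      using supported_inner_integrable[OF Bo cq Kc KB \<psi>(5) \<psi>(3)] by (metis borel_measurable_integrable)
    then show "(\<lambda>x. p_flux p (Dw x) \<bullet> g x) \<in> borel_measurable lebesgue"
      by (rule borel_measurable_LIMSEQ_metric) (rule limq)
  qed (use limq bq in \<open>auto intro!: AE_I2\<close>)
  from tendsto_minus[OF this]
  have EL: "(\<lambda>j. LINT x|lebesgue. E j (?t x) * \<psi> x) \<longlonglongrightarrow> - (LINT x|lebesgue. p_flux p (Dw x) \<bullet> g x)"
    by (simp only: div minus_minus)
  have \<psi>0: "0 \<le> \<psi> x" for x by (simp add: \<psi>_def sat_nonneg)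
  have hm: "(\<lambda>x. h x * \<psi> x) \<in> borel_measurable lebesgue"
  proof (rule borel_measurable_times[OF measurable_completion borel_measurable_integrable[OF \<psi>(4)]])
    show "h \<in> borel_measurable lborel" unfolding h_def by measurable
  qed
  have lim: "AE x in lebesgue. (\<lambda>j. E j (?t x) * \<psi> x) \<longlonglongrightarrow> h x * \<psi> x"
  proof -
    have "AE x in lebesgue. x \<noteq> (0::'a)" using AE_lborel_singleton by (rule AE_completion)
    then show ?thesis
    proof eventually_elim
      case (elim x)
      then have t0: "?t x \<noteq> 0" by simp
      have "(\<lambda>j. E j (?t x)) \<longlonglongrightarrow> \<kappa> * ?S x powr (a - 1) * ?t x powr (b - 1)
        * (n * ?S x * ?t x + (\<beta> - p + 2) * ?t x * ?t x + (p - 2) * ?t x * ?S x)"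
        unfolding E_def by (intro tendsto_intros \<delta>lim) (use t0 in auto)
      also have "\<kappa> * ?S x powr (a - 1) * ?t x powr (b - 1) * (n * ?S x * ?t x + (\<beta> - p + 2) * ?t x * ?t x + (p - 2) * ?t x * ?S x)
        = \<kappa> * ?S x powr (a - 1) * (?t x powr (b - 1) * ?t x) * ((n + \<beta>) * ?t x + (n + p - 2) * \<epsilon>\<^sup>2)"
        by (simp add: algebra_simps)
      also have "?t x powr (b - 1) * ?t x = ?t x powr b"
        using powr_mult_base[of "?t x" "b - 1"] by (simp add: mult.commute)
      also have "\<kappa> * ?S x powr (a - 1) * ?t x powr b * ((n + \<beta>) * ?t x + (n + p - 2) * \<epsilon>\<^sup>2) = h x"
        unfolding tb by (simp add: h_def \<kappa>_def a_def n_def)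
      finally show ?case by (intro tendsto_mult tendsto_const)
    qed
  qed
  note F = integrable_fatou[OF iE mult_nonneg_nonneg[OF E0[OF inner_ge_zero] \<psi>0] lim hm order_refl EL]
  show "integrable lebesgue (\<lambda>x. h x * \<psi> x)" by (rule F(1))
  show "(LINT x|lebesgue. h x * \<psi> x) \<le> (LINT x|lebesgue. source x * \<psi> x)"
    using F(2) \<psi>(7) by linarith
qed

end

section \<open>The origin when \<open>\<alpha> > - n\<close>\<close>

lemma sphere_lower_bound:
  fixes v :: "'a::euclidean_space \<Rightarrow> real"
  assumes "0 < R" "continuous_on (sphere 0 R) v" "\<And>x. norm x = R \<Longrightarrow> 0 < v x"
  obtains m where "0 < m" "\<And>x. norm x = R \<Longrightarrow> m \<le> v x"
proof -
  obtain b :: 'a where b: "b \<in> Basis" using nonempty_Basis by blast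
  have "R *\<^sub>R b \<in> sphere 0 R" using b assms(1) by simp
  then have "sphere (0::'a) R \<noteq> {}" by blast
  then obtain x0 where x0: "x0 \<in> sphere 0 R" "\<forall>y\<in>sphere 0 R. v x0 \<le> v y"
    using continuous_attains_inf[OF compact_sphere _ assms(2)] by blast
  then show ?thesis using that[of "v x0"] assms(3)[of x0] by auto
qed

lemma inner_self_powr: "(x \<bullet> x) powr e = norm (x::'a::euclidean_space) powr (2 * e)"
proof (cases "x = 0")
  case False
  have "x \<bullet> x = norm x powr 2" using False by (simp add: powr_numeral power2_norm_eq_inner)
  then show ?thesis by (simp only: powr_powr)
qed simp

context continuous_solution
begin

text \<open>With \<open>\<beta> = \<alpha>\<close> the barrier \<open>w = c (N + r\<^sup>\<gamma>)\<close> satisfies \<open>h = (c \<gamma>)\<^sup>p\<^sup>-\<^sup>1 (n + \<alpha>) r\<^sup>\<alpha>\<close> in the limit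
  \<open>\<epsilon> \<rightarrow> 0\<close>.  The factor \<open>c\<close> cancels in the condition \<open>h > r\<^sup>\<alpha> w\<^sup>p\<^sup>-\<^sup>1\<close>, which therefore only asks for small
  \<open>N\<close> and \<open>R\<close>; then \<open>c\<close> is chosen to stay below \<open>v\<close> on the sphere of radius \<open>R\<close>.\<close>

lemma positive_at_origin_subcritical:
  assumes \<alpha>: "- real DIM('a) < \<alpha>" "- p < \<alpha>" and 0: "0 \<in> \<Omega>"
    and pos: "\<And>x. x \<in> \<Omega> \<Longrightarrow> x \<noteq> 0 \<Longrightarrow> 0 < v x"
  shows "0 < v 0"
proof -
  define n where "n = real DIM('a)"
  define \<gamma> where "\<gamma> = (\<alpha> + p) / (p - 1)"
  have \<gamma>: "0 < \<gamma>" using \<alpha> p1 by (simp add: \<gamma>_def)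
  have n\<alpha>: "0 < n + \<alpha>" using \<alpha> by (simp add: n_def)
  \<comment> \<open>The strict subsolution condition reads \<open>N + r\<^sup>\<gamma> < \<eta>\<close>.\<close>
  define \<eta> where "\<eta> = \<gamma> * (n + \<alpha>) powr (1 / (p - 1))"
  have \<eta>: "0 < \<eta>" using \<gamma> n\<alpha> by (simp add: \<eta>_def)
  have \<eta>p: "\<eta> powr (p - 1) = \<gamma> powr (p - 1) * (n + \<alpha>)"
    using \<gamma> n\<alpha> p1 by (simp add: \<eta>_def powr_mult powr_powr)
  obtain R0 where R0: "0 < R0" "cball 0 R0 \<subseteq> \<Omega>" using open_\<Omega> 0 open_contains_cball by blast
  define R where "R = min R0 ((\<eta> / 4) powr (1 / \<gamma>))"
  have R: "0 < R" using R0 \<eta> by (simp add: R_def)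
  have sub: "cball 0 R \<subseteq> \<Omega>" using R0(2) by (auto simp: R_def)
  have R\<gamma>: "r powr \<gamma> \<le> \<eta> / 4" if "0 \<le> r" "r \<le> R" for r
  proof -
    have "r powr \<gamma> \<le> ((\<eta> / 4) powr (1 / \<gamma>)) powr \<gamma>" using that \<gamma> by (intro powr_mono2) (auto simp: R_def)
    also have "\<dots> = \<eta> / 4" using \<eta> \<gamma> by (simp add: powr_powr)
    finally show ?thesis .
  qed
  have "continuous_on (sphere 0 R) v" by (rule continuous_on_subset[OF v_cont]) (use sub in auto)
  moreover have "0 < v x" if "norm x = R" for x using that R sub by (intro pos) auto
  ultimately obtain m where m: "0 < m" "\<And>x. norm x = R \<Longrightarrow> m \<le> v x"
    using sphere_lower_bound[OF R] by blast
  define N where "N = \<eta> / 4"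
  define Q where "Q = N + (R\<^sup>2 + 1) powr (\<gamma> / 2)"
  have Q: "0 < Q" using \<eta> by (simp add: Q_def N_def add_pos_nonneg)
  define c where "c = m / (2 * Q)"
  have c: "0 < c" "c * Q < m" using m Q by (auto simp: c_def)
  define \<epsilon> where "\<epsilon> j = 1 / real (Suc j)" for j
  have \<epsilon>: "0 < \<epsilon> j" "\<epsilon> j \<le> 1" for j by (auto simp: \<epsilon>_def)
  have \<epsilon>0: "\<epsilon> \<longlonglongrightarrow> 0" unfolding \<epsilon>_def using LIMSEQ_inverse_real_of_nat by (simp add: inverse_eq_divide)
  define w where "w = (\<lambda>j x::'a. c * N + c * (x \<bullet> x + (\<epsilon> j)\<^sup>2) powr (\<gamma> / 2))"
  define h where "h = (\<lambda>j x::'a. (c * \<gamma>) powr (p - 1) * (x \<bullet> x + (\<epsilon> j)\<^sup>2) powr ((\<gamma> / 2 - 1) * (p - 1) - 1) * norm x powr (p - 2)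
       * ((DIM('a) + \<alpha>) * (x \<bullet> x) + (DIM('a) + p - 2) * (\<epsilon> j)\<^sup>2))"
  define \<psi> where "\<psi> = (\<lambda>j x. indicat_real (ball 0 R) x * sat 1 (w j x - v x))"
  have ob: "integrable lebesgue (\<lambda>x. source x * \<psi> j x)" "integrable lebesgue (\<lambda>x. h j x * \<psi> j x)"
    "(LINT x|lebesgue. h j x * \<psi> j x) \<le> (LINT x|lebesgue. source x * \<psi> j x)" for j
  proof -
    have "c * N + c * (R\<^sup>2 + (\<epsilon> j)\<^sup>2) powr (\<gamma> / 2) < v x" if "norm x = R" for x
    proof -
      have "(\<epsilon> j)\<^sup>2 \<le> 1" using \<epsilon>[of j] by (simp add: power_le_one)
      then have "(R\<^sup>2 + (\<epsilon> j)\<^sup>2) powr (\<gamma> / 2) \<le> (R\<^sup>2 + 1) powr (\<gamma> / 2)"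
        using \<gamma> by (intro powr_mono2) auto
      then have "c * N + c * (R\<^sup>2 + (\<epsilon> j)\<^sup>2) powr (\<gamma> / 2) \<le> c * Q" using c by (simp add: Q_def distrib_left)
      also have "\<dots> < v x" using c(2) m(2)[OF that] by simp
      finally show ?thesis .
    qed
    note ob = origin_barrier[OF less_imp_le[OF \<alpha>(1)] \<alpha>(2) c(1) \<epsilon>(1)[of j] zero_less_one R sub this[unfolded \<gamma>_def]]
    show "integrable lebesgue (\<lambda>x. source x * \<psi> j x)" "integrable lebesgue (\<lambda>x. h j x * \<psi> j x)"
      "(LINT x|lebesgue. h j x * \<psi> j x) \<le> (LINT x|lebesgue. source x * \<psi> j x)"
      using ob unfolding \<psi>_def w_def h_def \<gamma>_def by auto
  qed
  define w' where "w' x = c * N + c * (x \<bullet> x) powr (\<gamma> / 2)" for x :: 'a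
  define h' where "h' x = (c * \<gamma>) powr (p - 1) * (x \<bullet> x) powr ((\<gamma> / 2 - 1) * (p - 1) - 1) * norm x powr (p - 2)
       * ((DIM('a) + \<alpha>) * (x \<bullet> x))" for x :: 'a
  define \<psi>' where "\<psi>' x = indicat_real (ball 0 R) x * sat 1 (w' x - v x)" for x
  have \<epsilon>lim: "(\<lambda>j. x \<bullet> x + (\<epsilon> j)\<^sup>2) \<longlonglongrightarrow> x \<bullet> x" for x :: 'a
    using tendsto_add[OF tendsto_const tendsto_power[OF \<epsilon>0, of 2]] by simp
  have wlim: "(\<lambda>j. w j x) \<longlonglongrightarrow> w' x" for x
  proof -
    have "(\<lambda>j. (x \<bullet> x + (\<epsilon> j)\<^sup>2) powr (\<gamma> / 2)) \<longlonglongrightarrow> (x \<bullet> x) powr (\<gamma> / 2)"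
      by (rule tendsto_powr'[OF \<epsilon>lim tendsto_const]) (use \<gamma> in auto)
    then show ?thesis unfolding w_def w'_def by (intro tendsto_add tendsto_mult tendsto_const)
  qed
  have \<psi>lim: "(\<lambda>j. \<psi> j x) \<longlonglongrightarrow> \<psi>' x" for x
  proof -
    have "(\<lambda>j. sat 1 (w j x - v x)) \<longlonglongrightarrow> sat 1 (w' x - v x)"
      by (rule continuous_on_tendsto_compose[OF sat_continuous[OF zero_less_one]]) (auto intro!: tendsto_diff wlim)
    then show ?thesis unfolding \<psi>_def \<psi>'_def by (intro tendsto_mult tendsto_const)
  qed
  have \<psi>0: "0 \<le> \<psi> j x" "0 \<le> \<psi>' x" for j x by (simp_all add: \<psi>_def \<psi>'_def sat_nonneg)
  have \<psi>le: "\<psi> j x \<le> \<psi> 0 x" for j x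
  proof -
    have "(\<epsilon> j)\<^sup>2 \<le> (\<epsilon> 0)\<^sup>2" using \<epsilon>[of j] by (intro power_mono) (auto simp: \<epsilon>_def)
    then have "(x \<bullet> x + (\<epsilon> j)\<^sup>2) powr (\<gamma> / 2) \<le> (x \<bullet> x + (\<epsilon> 0)\<^sup>2) powr (\<gamma> / 2)"
      using \<gamma> by (intro powr_mono2) auto
    then have "w j x \<le> w 0 x" using c unfolding w_def by (intro add_left_mono mult_left_mono) auto
    then show ?thesis unfolding \<psi>_def by (intro mult_left_mono sat_mono) auto
  qed
  have sm: "(\<lambda>x. source x * \<psi>' x) \<in> borel_measurable lebesgue"
    by (rule borel_measurable_LIMSEQ_metric[where f="\<lambda>j x. source x * \<psi> j x", OF borel_measurable_integrable[OF ob(1)]])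
       (intro tendsto_mult tendsto_const \<psi>lim)
  have dom: "AE x in lebesgue. norm (source x * \<psi> j x) \<le> source x * \<psi> 0 x" for j
    by (rule AE_I2) (simp add: source_nonneg \<psi>0 mult_left_mono[OF \<psi>le])
  have sl: "AE x in lebesgue. (\<lambda>j. source x * \<psi> j x) \<longlonglongrightarrow> source x * \<psi>' x"
    by (rule AE_I2) (intro tendsto_mult tendsto_const \<psi>lim)
  have is': "integrable lebesgue (\<lambda>x. source x * \<psi>' x)"
    by (rule integrable_dominated_convergence[OF sm borel_measurable_integrable[OF ob(1)] ob(1) sl dom])
  have Ls: "(\<lambda>j. LINT x|lebesgue. source x * \<psi> j x) \<longlonglongrightarrow> (LINT x|lebesgue. source x * \<psi>' x)"
    by (rule integral_dominated_convergence[OF sm borel_measurable_integrable[OF ob(1)] ob(1) sl dom])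
  have h0: "0 \<le> h j x" for j x
  proof -
    have "0 \<le> (DIM('a) + \<alpha>) * (x \<bullet> x) + (DIM('a) + p - 2) * (\<epsilon> j)\<^sup>2"
    proof -
      have "1 \<le> real DIM('a)" using DIM_positive[where 'a='a] by (simp add: Suc_le_eq)
      then have "0 \<le> DIM('a) + \<alpha>" "0 \<le> DIM('a) + p - 2" using \<alpha> p1 by linarith+
      from add_nonneg_nonneg[OF mult_nonneg_nonneg[OF this(1) inner_ge_zero] mult_nonneg_nonneg[OF this(2) zero_le_power2]]
      show ?thesis .
    qed
    then show ?thesis unfolding h_def by (intro mult_nonneg_nonneg) auto
  qed
  have AE0: "AE x in lebesgue. x \<noteq> (0::'a)" using AE_lborel_singleton by (rule AE_completion)
  have hl: "AE x in lebesgue. (\<lambda>j. h j x * \<psi> j x) \<longlonglongrightarrow> h' x * \<psi>' x"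
    using AE0
  proof eventually_elim
    case (elim x)
    have "(\<lambda>j. h j x) \<longlonglongrightarrow> (c * \<gamma>) powr (p - 1) * (x \<bullet> x) powr ((\<gamma> / 2 - 1) * (p - 1) - 1) * norm x powr (p - 2)
       * ((DIM('a) + \<alpha>) * (x \<bullet> x) + (DIM('a) + p - 2) * 0\<^sup>2)"
      unfolding h_def by (intro tendsto_intros \<epsilon>lim \<epsilon>0) (use elim in auto)
    then have "(\<lambda>j. h j x) \<longlonglongrightarrow> h' x" by (simp add: h'_def)
    then show ?case by (intro tendsto_mult \<psi>lim)
  qed
  have hm: "(\<lambda>x. h' x * \<psi>' x) \<in> borel_measurable lebesgue"
  proof (rule borel_measurable_times)
    have "h' \<in> borel_measurable borel" unfolding h'_def by measurable
    then show "h' \<in> borel_measurable lebesgue" by (intro measurable_completion) simp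
    have "continuous_on (ball 0 R) (\<lambda>x. sat 1 (w' x - v x))"
    proof (rule continuous_on_compose2[OF sat_continuous[OF zero_less_one]])
      show "continuous_on (ball 0 R) (\<lambda>x. w' x - v x)"
        unfolding w'_def using \<gamma> sub
        by (intro continuous_intros continuous_on_powr' continuous_on_subset[OF v_cont]) auto
    qed auto
    then show "\<psi>' \<in> borel_measurable lebesgue"
      using locally_integrable_measurable[OF open_ball locally_integrable_continuous] by (fastforce simp: \<psi>'_def[abs_def])
  qed
  note fat = integrable_fatou[OF ob(2) mult_nonneg_nonneg[OF h0 \<psi>0(1)] hl hm ob(3) Ls]
  have gap: "AE x in lebesgue. \<psi>' x \<noteq> 0 \<longrightarrow> source x < h' x"
    using AE0
  proof eventually_elim
    case (elim x)
    show ?case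
    proof
      assume n0: "\<psi>' x \<noteq> 0"
      then have x: "x \<in> ball 0 R" "v x < w' x"
        using sat_zero[of "w' x - v x" 1] by (auto simp: \<psi>'_def indicator_def not_le[symmetric] split: if_splits)
      have xO: "x \<in> \<Omega>" using x sub by auto
      have r: "0 < norm x" "norm x \<le> R" using elim x by auto
      have "w' x = c * (N + norm x powr \<gamma>)" by (simp add: w'_def inner_self_powr distrib_left)
      also have "\<dots> \<le> c * (\<eta> / 2)" using R\<gamma>[of "norm x"] r c by (intro mult_left_mono) (auto simp: N_def)
      also have "\<dots> < c * \<eta>" using c \<eta> by simp
      finally have "v x < c * \<eta>" using x by simp
      then have "v x powr (p - 1) < (c * \<eta>) powr (p - 1)"
        using v_nonneg[OF xO] p1 by (intro powr_less_mono2) auto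
      also have "\<dots> = (c * \<gamma>) powr (p - 1) * (n + \<alpha>)" using c \<eta> \<gamma> by (simp add: powr_mult \<eta>p)
      finally have "norm x powr \<alpha> * v x powr (p - 1) < norm x powr \<alpha> * ((c * \<gamma>) powr (p - 1) * (n + \<alpha>))"
        using r by (intro mult_strict_left_mono) auto
      also have "\<dots> = h' x"
      proof -
        have e: "(x \<bullet> x) powr ((\<gamma> / 2 - 1) * (p - 1) - 1) * norm x powr (p - 2) * (x \<bullet> x) = norm x powr \<alpha>"
        proof -
          have xx: "x \<bullet> x = norm x powr 2" using r by (simp add: powr_numeral power2_norm_eq_inner)
          have "(x \<bullet> x) powr ((\<gamma> / 2 - 1) * (p - 1) - 1) * norm x powr (p - 2) * (x \<bullet> x)
            = norm x powr (2 * ((\<gamma> / 2 - 1) * (p - 1) - 1) + (p - 2) + 2)"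
            unfolding powr_add inner_self_powr xx[symmetric] ..
          also have "2 * ((\<gamma> / 2 - 1) * (p - 1) - 1) + (p - 2) + 2 = \<alpha>"
            using p1 by (simp add: \<gamma>_def field_simps)
          finally show ?thesis .
        qed
        have "h' x = (c * \<gamma>) powr (p - 1) * ((x \<bullet> x) powr ((\<gamma> / 2 - 1) * (p - 1) - 1) * norm x powr (p - 2) * (x \<bullet> x)) * (n + \<alpha>)"
          unfolding h'_def n_def by (simp only: mult_ac)
        then show ?thesis unfolding e by (simp only: mult_ac)
      qed
      finally show "source x < h' x" by (simp add: source_def)
    qed
  qed
  have "AE x in lebesgue. \<psi>' x = 0"
    by (rule strict_gap_AE[OF fat(1) is' fat(2) \<psi>0(2) gap])
  then have ae: "AE x in lebesgue. x \<in> ball 0 R \<longrightarrow> sat 1 (w' x - v x) = 0"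
    by eventually_elim (auto simp: \<psi>'_def)
  have cw: "continuous_on (ball 0 R) w'"
    unfolding w'_def using \<gamma> by (intro continuous_intros continuous_on_powr') auto
  have "w' 0 \<le> v 0"
    by (rule sat_AE_zero_imp_le[OF open_ball _ cw zero_less_one ae]) (use sub R in auto)
  moreover have "0 < w' 0" using c \<eta> by (simp add: w'_def N_def)
  ultimately show ?thesis by linarith
qed

end

section \<open>The origin when \<open>\<alpha> \<le> - n\<close>\<close>

lemma norm_powr_cut_measurable:
  "(\<lambda>x::'a::euclidean_space. indicat_real (ball 0 R) x * norm x powr \<theta>) \<in> borel_measurable borel"
proof -
  have [measurable]: "ball (0::'a) R \<in> sets borel" by simp
  show ?thesis by measurable
qed

text \<open>Compare with a constant on each dyadic shell; the resulting series is geometric with ratio \<open>2\<^sup>-\<^sup>(\<^sup>\<theta>\<^sup>+\<^sup>n\<^sup>)\<close>.\<close>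

lemma norm_powr_integrable:
  assumes \<theta>: "- real DIM('a::euclidean_space) < \<theta>"
  shows "integrable lebesgue (\<lambda>x::'a. indicat_real (ball 0 1) x * norm x powr \<theta>)"
proof -
  define n where "n = DIM('a)"
  define a where "a k = 2 powr \<bar>\<theta>\<bar> * (1 / 2) powr (real k * \<theta>)" for k
  define s where "s k = (1 / 2 :: real) ^ k" for k
  have bound: "norm x powr \<theta> \<le> a k" if "s (Suc k) \<le> norm x" "norm x \<le> s k" for x :: 'a and k
  proof -
    have sk: "s k powr \<theta> = (1 / 2) powr (real k * \<theta>)"
      by (simp add: s_def powr_realpow[symmetric] powr_powr)
    show ?thesis
    proof (cases "0 \<le> \<theta>")
      case True
      have "norm x powr \<theta> \<le> s k powr \<theta>" using that True by (intro powr_mono2) auto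
      also have "\<dots> \<le> 2 powr \<bar>\<theta>\<bar> * s k powr \<theta>"
        using mult_right_mono[of 1 "2 powr \<bar>\<theta>\<bar>" "s k powr \<theta>"] by (simp add: ge_one_powr_ge_zero)
      finally show ?thesis by (simp add: a_def sk)
    next
      case False
      have "norm x powr \<theta> \<le> s (Suc k) powr \<theta>"
        using that False by (intro powr_mono2') (auto simp: s_def)
      also have "s (Suc k) = s k * (1 / 2)" by (simp add: s_def)
      also have "(s k * (1 / 2)) powr \<theta> = s k powr \<theta> * (1 / 2) powr \<theta>" by (subst powr_mult) (auto simp: s_def)
      also have "(1 / 2 :: real) powr \<theta> = 2 powr \<bar>\<theta>\<bar>" using False by (simp add: powr_divide powr_minus_divide[symmetric])
      finally show ?thesis by (simp add: a_def sk mult.commute)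
    qed
  qed
  have pw: "ennreal (indicat_real (ball 0 1) x * norm x powr \<theta>) \<le> (\<Sum>k. ennreal (a k) * indicator (cball 0 (s k)) x)" for x :: 'a
  proof (cases "x \<noteq> 0 \<and> x \<in> ball 0 1")
    case True
    have "\<exists>k. s (Suc k) \<le> norm x"
    proof -
      obtain k where "(1 / 2 :: real) ^ k < norm x" using real_arch_pow_inv[of "norm x" "1/2"] True by auto
      moreover have "s (Suc k) \<le> (1 / 2) ^ k" by (simp add: s_def)
      ultimately show ?thesis by (meson less_imp_le order_trans)
    qed
    define k where "k = (LEAST k. s (Suc k) \<le> norm x)"
    have k1: "s (Suc k) \<le> norm x" unfolding k_def by (rule LeastI_ex) fact
    have k2: "norm x \<le> s k"
    proof (cases k)
      case 0
      then show ?thesis using True by (simp add: s_def)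
    next
      case (Suc j)
      then have "\<not> s (Suc j) \<le> norm x" unfolding k_def by (metis lessI not_less_Least)
      then show ?thesis using Suc by simp
    qed
    have "ennreal (indicat_real (ball 0 1) x * norm x powr \<theta>) \<le> ennreal (a k) * indicator (cball 0 (s k)) x"
      using True k2 bound[OF k1 k2] by (auto intro: ennreal_leI)
    also have "\<dots> \<le> (\<Sum>k. ennreal (a k) * indicator (cball 0 (s k)) x)"
    proof -
      define G where "G k = ennreal (a k) * indicator (cball 0 (s k)) x" for k
      have "sum G {k} \<le> suminf G" by (rule sum_le_suminf) auto
      then have "G k \<le> suminf G" by simp
      then show ?thesis unfolding G_def .
    qed
    finally show ?thesis .
  qed auto
  have "(\<integral>\<^sup>+x. ennreal (indicat_real (ball 0 1) x * norm (x::'a) powr \<theta>) \<partial>lborel)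
      \<le> (\<integral>\<^sup>+x. (\<Sum>k. ennreal (a k) * indicator (cball 0 (s k)) (x::'a)) \<partial>lborel)"
    by (intro nn_integral_mono pw)
  also have "\<dots> = (\<Sum>k. \<integral>\<^sup>+x. ennreal (a k) * indicator (cball 0 (s k)) (x::'a) \<partial>lborel)"
  proof (rule nn_integral_suminf)
    fix k
    have [measurable]: "cball (0::'a) (s k) \<in> sets borel" by simp
    show "(\<lambda>x::'a. ennreal (a k) * indicator (cball 0 (s k)) x) \<in> borel_measurable lborel" by measurable
  qed
  also have "\<dots> = (\<Sum>k. ennreal (2 powr \<bar>\<theta>\<bar> * unit_ball_vol (real n) * ((1 / 2) powr (\<theta> + n)) ^ k))"
  proof (rule suminf_cong)
    fix k
    have "(\<integral>\<^sup>+x. ennreal (a k) * indicator (cball 0 (s k)) (x::'a) \<partial>lborel) = ennreal (a k) * emeasure lborel (cball (0::'a) (s k))"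
      by (rule nn_integral_cmult_indicator) simp
    also have "\<dots> = ennreal (a k * (unit_ball_vol (real n) * s k ^ n))"
      by (subst emeasure_cball) (auto simp: s_def n_def ennreal_mult' a_def)
    also have "a k * (unit_ball_vol (real n) * s k ^ n) = 2 powr \<bar>\<theta>\<bar> * unit_ball_vol (real n) * ((1 / 2) powr (\<theta> + n)) ^ k"
    proof -
      have 1: "s k ^ n = (1 / 2) powr (real k * real n)"
        by (simp add: s_def powr_realpow[symmetric] powr_powr power_mult[symmetric])
      have "((1 / 2 :: real) powr (\<theta> + n)) ^ k = (1 / 2) powr ((\<theta> + n) * real k)"
        by (simp add: powr_realpow[symmetric] powr_powr)
      also have "(\<theta> + n) * real k = real k * \<theta> + real k * real n" by (simp add: algebra_simps)
      also have "(1 / 2 :: real) powr \<dots> = (1 / 2) powr (real k * \<theta>) * s k ^ n" unfolding 1 by (rule powr_add)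
      finally show ?thesis by (simp add: a_def mult_ac)
    qed
    finally show "(\<integral>\<^sup>+x. ennreal (a k) * indicator (cball 0 (s k)) (x::'a) \<partial>lborel)
      = ennreal (2 powr \<bar>\<theta>\<bar> * unit_ball_vol (real n) * ((1 / 2) powr (\<theta> + n)) ^ k)" .
  qed
  also have "\<dots> < \<infinity>"
  proof -
    have "(1 / 2 :: real) powr (\<theta> + n) < (1 / 2) powr 0"
      using \<theta> by (intro powr_less_mono') (auto simp: n_def)
    then have "summable (\<lambda>k. 2 powr \<bar>\<theta>\<bar> * unit_ball_vol (real n) * ((1 / 2) powr (\<theta> + n)) ^ k)"
      by (intro summable_mult summable_geometric) simp
    then show ?thesis by (subst suminf_ennreal2) auto
  qed
  finally have "integrable lborel (\<lambda>x::'a. indicat_real (ball 0 1) x * norm x powr \<theta>)"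
    using norm_powr_cut_measurable[of 1 \<theta>] by (intro integrableI_nonneg) auto
  then show ?thesis using norm_powr_cut_measurable[of 1 \<theta>] by (subst integrable_completion) auto
qed

lemma norm_powr_integral_small:
  assumes \<theta>: "- real DIM('a::euclidean_space) < \<theta>" and e: "0 < e" and R0: "0 < R0"
  obtains R where "0 < R" "R \<le> R0" "integrable lebesgue (\<lambda>x::'a. indicat_real (ball 0 R) x * norm x powr \<theta>)"
    "(LINT x::'a|lebesgue. indicat_real (ball 0 R) x * norm x powr \<theta>) < e"
proof -
  define R1 where "R1 = min R0 1"
  have R1: "0 < R1" "R1 \<le> R0" "R1 \<le> 1" using R0 by (auto simp: R1_def)
  define r where "r j = R1 / real (Suc j)" for j
  have r: "0 < r j" "r j \<le> R1" for j using R1 by (auto simp: r_def field_simps)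
  have r0: "r \<longlonglongrightarrow> 0"
    unfolding r_def using tendsto_mult_right_zero[OF LIMSEQ_inverse_real_of_nat, of R1] by (simp add: divide_inverse)
  define f where "f j x = indicat_real (ball 0 (r j)) x * norm x powr \<theta>" for j and x :: 'a
  define w where "w x = indicat_real (ball 0 1) x * norm x powr \<theta>" for x :: 'a
  have wi: "integrable lebesgue w" unfolding w_def by (rule norm_powr_integrable[OF \<theta>])
  have fm: "f j \<in> borel_measurable lebesgue" for j
  proof -
    have "f j \<in> borel_measurable borel" unfolding f_def by (rule norm_powr_cut_measurable)
    then show ?thesis by (intro measurable_completion) simp
  qed
  have dom: "AE x in lebesgue. norm (f j x) \<le> w x" for j
    using r[of j] R1 by (intro AE_I2) (auto simp: f_def w_def indicator_def)
  have "AE x in lebesgue. x \<noteq> (0::'a)" using AE_lborel_singleton by (rule AE_completion)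
  then have lim: "AE x in lebesgue. (\<lambda>j. f j x) \<longlonglongrightarrow> 0"
  proof eventually_elim
    case (elim x)
    then have "\<forall>\<^sub>F j in sequentially. r j < norm x" using r0 by (intro order_tendstoD(2)[OF r0]) auto
    then have "\<forall>\<^sub>F j in sequentially. 0 = f j x" by eventually_elim (auto simp: f_def)
    then show ?case by (rule Lim_transform_eventually[OF tendsto_const])
  qed
  have "(\<lambda>j. LINT x|lebesgue. f j x) \<longlonglongrightarrow> (LINT x|(lebesgue :: 'a measure). (0::real))"
    by (rule integral_dominated_convergence[OF _ fm wi lim dom]) simp
  then have "\<forall>\<^sub>F j in sequentially. (LINT x|lebesgue. f j x) < e"
    using e by (intro order_tendstoD(2)) auto
  then obtain j where "(LINT x|lebesgue. f j x) < e" using eventually_happens by fastforce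
  moreover have "integrable lebesgue (f j)"
    by (rule Bochner_Integration.integrable_bound[OF wi fm]) (use dom[of j] in eventually_elim, auto)
  ultimately show ?thesis using that[of "r j"] r[of j] R1 by (auto simp: f_def[abs_def])
qed

context continuous_solution
begin

text \<open>Here \<open>\<alpha> > - p\<close> forces \<open>p > n\<close>.  With \<open>\<beta> = - n\<close> the divergence \<open>h\<close> has a mass of at least a fixed multiple of
  \<open>(c \<gamma>)\<^sup>p\<^sup>-\<^sup>1\<close> in the ball of radius \<open>\<epsilon>\<close>, where \<open>\<psi>\<close> is at least \<open>1/5\<close> if \<open>v(0) = 0\<close> and \<open>\<epsilon>\<close> is
  small relative to \<open>M\<close>.  On the other side \<open>\<psi> \<le> 1\<close> is supported where \<open>v < w\<close>; in the limit \<open>M, \<epsilon> \<rightarrow> 0\<close> this leaves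
  the integral of \<open>r\<^sup>\<alpha> v\<^sup>p\<^sup>-\<^sup>1 \<le> c\<^sup>p\<^sup>-\<^sup>1 r\<^sup>\<alpha>\<^sup>+\<^sup>p\<^sup>-\<^sup>n\<close>.  The factor \<open>c\<^sup>p\<^sup>-\<^sup>1\<close> cancels, so the contradiction depends on
  the choice of \<open>R\<close> only, which can be made before \<open>c\<close> is known.\<close>

lemma nonzero_at_origin_supercritical:
  assumes dim: "2 \<le> DIM('a)" and \<alpha>: "\<alpha> \<le> - real DIM('a)" "- p < \<alpha>" and 0: "0 \<in> \<Omega>"
    and pos: "\<And>x. x \<in> \<Omega> \<Longrightarrow> x \<noteq> 0 \<Longrightarrow> 0 < v x"
  shows "v 0 \<noteq> 0"
proof
  assume v0: "v 0 = 0"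
  define n where "n = real DIM('a)"
  have n2: "2 \<le> n" using dim by (simp add: n_def)
  have pn: "n < p" using \<alpha> by (simp add: n_def)
  define \<gamma> where "\<gamma> = (- n + p) / (p - 1)"
  have \<gamma>: "0 < \<gamma>" using pn p1 by (simp add: \<gamma>_def)
  define a where "a = (\<gamma> / 2 - 1) * (p - 1)"
  have a2: "2 * a = - n - p + 2" using p1 by (simp add: a_def \<gamma>_def field_simps)
  define \<theta> where "\<theta> = \<alpha> + p - n"
  \<comment> \<open>The lower bound for \<open>\<integral> h \<psi>\<close> without its factor \<open>(c \<gamma>)\<^sup>p\<^sup>-\<^sup>1\<close>.  It is read off on a ball of radius \<open>\<epsilon> / 4\<close>
    centred at distance \<open>3 \<epsilon> / 4\<close> from the origin, where \<open>\<epsilon> / 2 \<le> r \<le> \<epsilon>\<close>; all powers of \<open>\<epsilon>\<close> cancel.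
    The final \<open>1/5\<close> is the value of \<open>sat M\<close> at \<open>M / 2\<close>.\<close>
  define C1 where "C1 = 2 powr (a - 1) * (1 / 2) powr (p - 2) * (n + p - 2) * unit_ball_vol n * (1 / 4) ^ DIM('a) / 5"
  have C1: "0 < C1" using n2 p1 by (simp add: C1_def)
  obtain R0 where R0: "0 < R0" "cball 0 R0 \<subseteq> \<Omega>" using open_\<Omega> 0 open_contains_cball by blast
  obtain R where R: "0 < R" "R \<le> R0" and iR: "integrable lebesgue (\<lambda>x::'a. indicat_real (ball 0 R) x * norm x powr \<theta>)"
    and small: "(LINT x::'a|lebesgue. indicat_real (ball 0 R) x * norm x powr \<theta>) < \<gamma> powr (p - 1) * C1"
  proof (rule norm_powr_integral_small[where 'a='a])
    show "- real DIM('a) < \<theta>" using \<alpha> by (simp add: \<theta>_def n_def)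
    show "0 < \<gamma> powr (p - 1) * C1" using \<gamma> C1 by simp
  qed (use R0 in auto)
  have sub: "cball 0 R \<subseteq> \<Omega>" using R0(2) R by auto
  have "continuous_on (sphere 0 R) v" by (rule continuous_on_subset[OF v_cont]) (use sub in auto)
  moreover have "0 < v x" if "norm x = R" for x using that R sub by (intro pos) auto
  ultimately obtain m where m: "0 < m" "\<And>x. norm x = R \<Longrightarrow> m \<le> v x"
    using sphere_lower_bound[OF R(1)] by blast
  define Q where "Q = (R\<^sup>2 + 1) powr (\<gamma> / 2)"
  have "0 < R\<^sup>2 + 1" by (simp add: add_nonneg_pos)
  then have Q: "0 < Q" by (simp add: Q_def)
  define c where "c = m / 4 / Q"
  have c: "0 < c" "c * Q = m / 4" using m Q by (auto simp: c_def)
  have Qe: "c * (R\<^sup>2 + e\<^sup>2) powr (\<gamma> / 2) \<le> m / 4" if "0 < e" "e \<le> 1" for e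
  proof -
    have "e\<^sup>2 \<le> 1" using that by (simp add: power_le_one)
    then have "(R\<^sup>2 + e\<^sup>2) powr (\<gamma> / 2) \<le> Q" unfolding Q_def using \<gamma> by (intro powr_mono2) auto
    then have "c * (R\<^sup>2 + e\<^sup>2) powr (\<gamma> / 2) \<le> c * Q" using c by (intro mult_left_mono) auto
    then show ?thesis using c by simp
  qed
  define w where "w = (\<lambda>C e x::'a. C + c * (x \<bullet> x + e\<^sup>2) powr (\<gamma> / 2))"
  define h where "h = (\<lambda>e x::'a. (c * \<gamma>) powr (p - 1) * (x \<bullet> x + e\<^sup>2) powr (a - 1) * norm x powr (p - 2)
       * ((DIM('a) + - n) * (x \<bullet> x) + (DIM('a) + p - 2) * e\<^sup>2))"
  define \<psi> where "\<psi> = (\<lambda>C e M x. indicat_real (ball 0 R) x * sat M (w C e x - v x))"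
  have ob: "integrable lebesgue (\<lambda>x. source x * \<psi> C e M x)" "integrable lebesgue (\<lambda>x. h e x * \<psi> C e M x)"
    "(LINT x|lebesgue. h e x * \<psi> C e M x) \<le> (LINT x|lebesgue. source x * \<psi> C e M x)"
    if C: "C \<le> m / 2" and e: "0 < e" "e \<le> 1" and M: "0 < M" for C e M
  proof -
    have "C + c * (R\<^sup>2 + e\<^sup>2) powr (((- n + p) / (p - 1)) / 2) < v x" if "norm x = R" for x
      using Qe[OF e] C m(1) m(2)[OF that] unfolding \<gamma>_def by linarith
    note ob = origin_barrier[OF _ _ c(1) e(1) M R(1) sub this]
    show "integrable lebesgue (\<lambda>x. source x * \<psi> C e M x)" "integrable lebesgue (\<lambda>x. h e x * \<psi> C e M x)"
      "(LINT x|lebesgue. h e x * \<psi> C e M x) \<le> (LINT x|lebesgue. source x * \<psi> C e M x)"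
      using ob pn unfolding \<psi>_def w_def h_def a_def \<gamma>_def n_def by auto
  qed
  define M where "M j = m / 4 / real (Suc j)" for j
  have M: "0 < M j" "M j \<le> m / 4" for j using m by (auto simp: M_def field_simps)
  have M0: "M \<longlonglongrightarrow> 0"
    unfolding M_def using tendsto_mult_right_zero[OF LIMSEQ_inverse_real_of_nat, of "m / 4"] unfolding divide_inverse .
  have "\<exists>e. 0 < e \<and> e \<le> 1 / real (Suc j) \<and> e < R \<and> (\<forall>x. norm x \<le> e \<longrightarrow> v x \<le> M j / 2)" for j
  proof -
    have "isCont v 0" using v_cont open_\<Omega> 0 continuous_on_eq_continuous_at by blast
    then obtain d where d: "0 < d" "\<And>x. dist x 0 < d \<Longrightarrow> dist (v x) (v 0) < M j / 2"
      using half_gt_zero[OF M(1)[of j]] unfolding continuous_at_eps_delta by blast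
    define e where "e = min (1 / real (Suc j)) (min (R / 2) (d / 2))"
    have e: "0 < e" "e \<le> 1 / real (Suc j)" "e < R" "e < d" using R d by (auto simp: e_def)
    have "v x \<le> M j / 2" if "norm x \<le> e" for x
    proof -
      have "dist (v x) (v 0) < M j / 2" using that e by (intro d(2)) simp
      then show ?thesis using v0 by (simp add: dist_real_def)
    qed
    then show ?thesis using e by blast
  qed
  then obtain e where e: "\<And>j. 0 < e j" "\<And>j. e j \<le> 1 / real (Suc j)" "\<And>j. e j < R"
    and ve: "\<And>j x. norm x \<le> e j \<Longrightarrow> v x \<le> M j / 2" by metis
  have e1: "e j \<le> 1" for j
    using e(2)[of j] by (rule order_trans) simp
  have e0: "e \<longlonglongrightarrow> 0"
  proof (rule tendsto_sandwich[OF _ _ tendsto_const])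
    show "(\<lambda>j. 1 / real (Suc j)) \<longlonglongrightarrow> 0" using LIMSEQ_inverse_real_of_nat by (simp add: inverse_eq_divide)
    show "\<forall>\<^sub>F j in sequentially. 0 \<le> e j" using e(1) by (auto intro!: always_eventually less_imp_le)
    show "\<forall>\<^sub>F j in sequentially. e j \<le> 1 / real (Suc j)" using e(2) by (auto intro!: always_eventually)
  qed
  have Mj: "M j \<le> m / 2" for j using M(2)[of j] m by linarith
  note obj = ob[OF Mj e(1) e1 M(1)]
  define \<kappa> where "\<kappa> = (c * \<gamma>) powr (p - 1)"
  have \<kappa>: "0 < \<kappa>" using c \<gamma> by (simp add: \<kappa>_def)
  have nn: "0 \<le> \<psi> C e' M' x" for C e' M' x by (simp add: \<psi>_def sat_nonneg)
  have h0: "0 \<le> h e' x" for e' x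
  proof -
    have "0 \<le> DIM('a) + p - 2" using p1 n2 unfolding n_def by linarith
    then have "0 \<le> (DIM('a) + - n) * (x \<bullet> x) + (DIM('a) + p - 2) * e'\<^sup>2" by (simp add: n_def)
    then show ?thesis unfolding h_def by (intro mult_nonneg_nonneg) auto
  qed
  have lower: "\<kappa> * C1 \<le> (LINT x|lebesgue. h (e j) x * \<psi> (M j) (e j) (M j) x)" for j
  proof -
    let ?e = "e j"
    obtain b :: 'a where b: "b \<in> Basis" using nonempty_Basis by blast
    define z where "z = (3 * ?e / 4) *\<^sub>R b"
    have nz: "norm z = 3 * ?e / 4" using b e(1)[of j] by (simp add: z_def)
    let ?D = "cball z (?e / 4)"
    have D: "?e / 2 \<le> norm x" "norm x \<le> ?e" if "x \<in> ?D" for x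
    proof -
      have "norm (z - x) \<le> ?e / 4" using that by (simp add: dist_norm)
      then show "?e / 2 \<le> norm x" "norm x \<le> ?e"
        using nz norm_triangle_ineq3[of z x] by (auto simp: abs_le_iff)
    qed
    define L where "L = \<kappa> * (2 powr (a - 1) * ?e powr (2 * a - 2)) * ((1 / 2) powr (p - 2) * ?e powr (p - 2)) * ((n + p - 2) * ?e\<^sup>2) / 5"
    have hl: "L * indicat_real ?D x \<le> h ?e x * \<psi> (M j) ?e (M j) x" for x
    proof (cases "x \<in> ?D")
      case True
      note Dx = D[OF True]
      have xR: "x \<in> ball 0 R" using Dx e(3)[of j] by simp
      have xx: "x \<bullet> x = (norm x)\<^sup>2" by (simp add: power2_norm_eq_inner)
      have nx: "0 < norm x" using Dx e(1)[of j] by linarith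
      have 1: "2 powr (a - 1) * ?e powr (2 * a - 2) \<le> (x \<bullet> x + ?e\<^sup>2) powr (a - 1)"
      proof -
        have "?e powr (2 * a - 2) = (?e powr 2) powr (a - 1)" unfolding powr_powr by (simp add: algebra_simps)
        also have "?e powr 2 = ?e\<^sup>2" using e(1)[of j] by (simp add: powr_numeral)
        finally have "2 powr (a - 1) * ?e powr (2 * a - 2) = (2 * ?e\<^sup>2) powr (a - 1)"
          using e(1)[of j] by (simp add: powr_mult)
        also have "\<dots> \<le> (x \<bullet> x + ?e\<^sup>2) powr (a - 1)"
        proof (rule powr_mono2')
          show "a - 1 \<le> 0" using a2 n2 p1 by linarith
          show "0 < x \<bullet> x + ?e\<^sup>2" using nx by (simp add: xx add_pos_nonneg)
          show "x \<bullet> x + ?e\<^sup>2 \<le> 2 * ?e\<^sup>2" using Dx power_mono[of "norm x" ?e 2] by (simp add: xx)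
        qed
        finally show ?thesis .
      qed
      have 2: "(1 / 2) powr (p - 2) * ?e powr (p - 2) \<le> norm x powr (p - 2)"
      proof -
        have "(1 / 2) powr (p - 2) * ?e powr (p - 2) = (1 / 2 * ?e) powr (p - 2)"
          using e(1)[of j] by (subst powr_mult) auto
        also have "\<dots> \<le> norm x powr (p - 2)" using Dx e(1)[of j] pn n2 by (intro powr_mono2) auto
        finally show ?thesis .
      qed
      have "\<kappa> * (2 powr (a - 1) * ?e powr (2 * a - 2)) * ((1 / 2) powr (p - 2) * ?e powr (p - 2)) * ((n + p - 2) * ?e\<^sup>2)
          \<le> \<kappa> * (x \<bullet> x + ?e\<^sup>2) powr (a - 1) * norm x powr (p - 2) * ((n + p - 2) * ?e\<^sup>2)"
        using 1 2 \<kappa> n2 p1 by (intro mult_right_mono mult_mono mult_left_mono) auto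
      also have "\<dots> = h ?e x" by (simp add: h_def \<kappa>_def n_def)
      finally have 3: "5 * L \<le> h ?e x" by (simp add: L_def)
      have "M j / 2 \<le> w (M j) ?e x - v x"
      proof -
        have "0 \<le> c * (x \<bullet> x + ?e\<^sup>2) powr (\<gamma> / 2)" using c by simp
        then show ?thesis using ve[OF Dx(2)] by (simp add: w_def)
      qed
      then have "sat (M j) (M j / 2) \<le> sat (M j) (w (M j) ?e x - v x)" by (rule sat_mono[OF M(1)])
      moreover have "sat (M j) (M j / 2) = 1 / 5"
        using M(1)[of j] by (simp add: sat_def pos_sq_def field_simps power2_eq_square)
      ultimately have "1 / 5 \<le> \<psi> (M j) ?e (M j) x" using xR by (simp add: \<psi>_def)
      then have "h ?e x * (1 / 5) \<le> h ?e x * \<psi> (M j) ?e (M j) x" using h0 by (intro mult_left_mono)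
      then show ?thesis using True 3 by simp
    qed (use h0 nn in simp)
    have "\<kappa> * C1 = L * measure lebesgue ?D"
    proof -
      have "measure lebesgue ?D = unit_ball_vol n * (?e / 4) ^ DIM('a)"
        using e(1)[of j] by (simp add: content_cball n_def)
      also have "(?e / 4) ^ DIM('a) = (1 / 4) ^ DIM('a) * ?e powr n"
        using e(1)[of j] by (simp add: power_divide n_def powr_realpow)
      finally have "L * measure lebesgue ?D = \<kappa> * C1 * (?e powr (2 * a - 2) * ?e powr (p - 2) * ?e\<^sup>2 * ?e powr n)"
        by (simp add: L_def C1_def)
      also have "?e powr (2 * a - 2) * ?e powr (p - 2) * ?e\<^sup>2 * ?e powr n = ?e powr ((2 * a - 2) + (p - 2) + 2 + n)"
        using e(1)[of j] unfolding powr_add by (simp add: powr_numeral)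
      also have "(2 * a - 2) + (p - 2) + 2 + n = 0" using a2 by simp
      also have "?e powr 0 = 1" using e(1)[of j] by simp
      finally show ?thesis by simp
    qed
    also have "\<dots> = (LINT x|lebesgue. L * indicat_real ?D x)" by simp
    also have "\<dots> \<le> (LINT x|lebesgue. h ?e x * \<psi> (M j) ?e (M j) x)"
      by (rule integral_mono[OF _ obj(2) hl]) (intro integrable_mult_right integrable_indicator_cball)
    finally show ?thesis .
  qed
  define V where "V x = indicator \<Omega> x *\<^sub>R v x" for x
  have Vm: "V \<in> borel_measurable lebesgue"
    unfolding V_def by (rule locally_integrable_measurable[OF open_\<Omega> locally_integrable_continuous[OF v_cont]])
  have VB: "V x = v x" if "x \<in> ball 0 R" for x 
  proof -
    have "x \<in> \<Omega>" using that sub by auto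
    then show ?thesis by (simp add: V_def)
  qed
  define w' where "w' x = c * norm x powr \<gamma>" for x :: 'a
  define F where "F j x = (if x \<in> ball 0 R \<and> V x < w (M j) (e j) x then norm x powr \<alpha> * V x powr (p - 1) else 0)" for j x
  define F' where "F' x = (if x \<in> ball 0 R \<and> V x \<le> w' x then norm x powr \<alpha> * V x powr (p - 1) else 0)" for x
  have bm: "f \<in> borel_measurable lebesgue" if "f \<in> borel_measurable borel" for f :: "'a \<Rightarrow> real"
    using that by (intro measurable_completion) simp
  have [measurable]: "V \<in> borel_measurable lebesgue" by (rule Vm)
  have [measurable]: "(\<lambda>x::'a. norm x powr \<alpha>) \<in> borel_measurable lebesgue" "w' \<in> borel_measurable lebesgue"
    "w C e' \<in> borel_measurable lebesgue" for C e'
    unfolding w'_def w_def by (intro bm; measurable)+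
  have [measurable]: "ball (0::'a) R \<in> sets lebesgue" by simp
  have Fm: "F j \<in> borel_measurable lebesgue" "F' \<in> borel_measurable lebesgue" for j
    unfolding F_def F'_def by measurable
  \<comment> \<open>A dominating function: the barrier with \<open>C = m / 2\<close> and \<open>\<epsilon> = 1\<close> exceeds all the others by at least
    \<open>m / 4\<close>, so that \<open>sat (m / 4)\<close> is at least \<open>1/2\<close> wherever one of them exceeds \<open>v\<close>.\<close>
  let ?\<Psi> = "\<lambda>x. source x * \<psi> (m / 2) 1 (m / 4) x"
  have idom: "integrable lebesgue (\<lambda>x. 2 * ?\<Psi> x)"
    using ob(1)[of "m / 2" 1 "m / 4"] m by simp
  have Fdom: "AE x in lebesgue. norm (F j x) \<le> 2 * ?\<Psi> x" for j
  proof (rule AE_I2)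
    fix x
    show "norm (F j x) \<le> 2 * ?\<Psi> x"
    proof (cases "x \<in> ball 0 R \<and> V x < w (M j) (e j) x")
      case True
      then have vx: "v x < w (M j) (e j) x" using VB[of x] by simp
      have "(x \<bullet> x + (e j)\<^sup>2) powr (\<gamma> / 2) \<le> (x \<bullet> x + 1\<^sup>2) powr (\<gamma> / 2)"
        using e1[of j] e(1)[of j] \<gamma> by (intro powr_mono2 add_left_mono power_mono) auto
      then have "w (M j) (e j) x \<le> m / 4 + c * (x \<bullet> x + 1\<^sup>2) powr (\<gamma> / 2)"
        using M(2)[of j] c unfolding w_def by (intro add_mono mult_left_mono) auto
      then have "m / 4 \<le> w (m / 2) 1 x - v x" using vx unfolding w_def by linarith
      then have "sat (m / 4) (m / 4) \<le> sat (m / 4) (w (m / 2) 1 x - v x)" using m by (intro sat_mono) auto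
      moreover have "sat (m / 4) (m / 4) = 1 / 2" using m by (simp add: sat_def pos_sq_def field_simps power2_eq_square)
      ultimately have "1 / 2 \<le> \<psi> (m / 2) 1 (m / 4) x" using True by (simp add: \<psi>_def)
      then have "source x * (1 / 2) \<le> ?\<Psi> x" by (intro mult_left_mono source_nonneg)
      then show ?thesis using True VB[of x] by (simp add: F_def source_def)
    next
      case False
      then have "F j x = 0" unfolding F_def by (rule if_not_P)
      then show ?thesis using source_nonneg nn by simp
    qed
  qed
  have wlim: "(\<lambda>j. w (M j) (e j) x) \<longlonglongrightarrow> w' x" for x
  proof -
    have "(\<lambda>j. x \<bullet> x + (e j)\<^sup>2) \<longlonglongrightarrow> x \<bullet> x"
      using tendsto_add[OF tendsto_const tendsto_power[OF e0, of 2]] by simp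
    then have "(\<lambda>j. (x \<bullet> x + (e j)\<^sup>2) powr (\<gamma> / 2)) \<longlonglongrightarrow> (x \<bullet> x) powr (\<gamma> / 2)"
      by (rule tendsto_powr'[OF _ tendsto_const]) (use \<gamma> in auto)
    then have "(\<lambda>j. w (M j) (e j) x) \<longlonglongrightarrow> 0 + c * (x \<bullet> x) powr (\<gamma> / 2)"
      unfolding w_def by (intro tendsto_add M0 tendsto_mult tendsto_const)
    then show ?thesis by (simp add: w'_def inner_self_powr)
  qed
  have wgt: "w' x < w (M j) (e j) x" for j x
  proof -
    have "(x \<bullet> x) powr (\<gamma> / 2) \<le> (x \<bullet> x + (e j)\<^sup>2) powr (\<gamma> / 2)" using \<gamma> by (intro powr_mono2) auto
    then have "c * (x \<bullet> x) powr (\<gamma> / 2) \<le> c * (x \<bullet> x + (e j)\<^sup>2) powr (\<gamma> / 2)" using c by (intro mult_left_mono) auto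
    then show ?thesis using M(1)[of j] by (simp add: w_def w'_def inner_self_powr)
  qed
  have Flim: "AE x in lebesgue. (\<lambda>j. F j x) \<longlonglongrightarrow> F' x"
  proof (rule AE_I2)
    fix x
    show "(\<lambda>j. F j x) \<longlonglongrightarrow> F' x"
    proof (cases "V x \<le> w' x")
      case True
      then have "V x < w (M j) (e j) x" for j using wgt[of x j] by linarith
      then have "F j x = F' x" for j using True by (simp add: F_def F'_def)
      then show ?thesis by simp
    next
      case False
      then have "\<forall>\<^sub>F j in sequentially. w (M j) (e j) x < V x" by (intro order_tendstoD(2)[OF wlim]) auto
      then have "\<forall>\<^sub>F j in sequentially. F' x = F j x"
        by eventually_elim (use False in \<open>auto simp: F_def F'_def\<close>)
      then show ?thesis by (rule Lim_transform_eventually[OF tendsto_const])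
    qed
  qed
  have FL: "(\<lambda>j. LINT x|lebesgue. F j x) \<longlonglongrightarrow> (LINT x|lebesgue. F' x)"
    by (rule integral_dominated_convergence[OF Fm(2) Fm(1) idom Flim Fdom])
  have iF: "integrable lebesgue (F j)" for j
    by (rule integrable_dominated_convergence2[OF Fm(2) Fm(1) idom Flim Fdom])
  have iF': "integrable lebesgue F'"
    by (rule integrable_dominated_convergence[OF Fm(2) Fm(1) idom Flim Fdom])
  have "\<kappa> * C1 \<le> (LINT x|lebesgue. F j x)" for j
  proof -
    have "(LINT x|lebesgue. source x * \<psi> (M j) (e j) (M j) x) \<le> (LINT x|lebesgue. F j x)"
    proof (rule integral_mono[OF obj(1) iF])
      fix x
      show "source x * \<psi> (M j) (e j) (M j) x \<le> F j x"
      proof (cases "x \<in> ball 0 R \<and> V x < w (M j) (e j) x")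
        case True
        have "source x * \<psi> (M j) (e j) (M j) x \<le> source x * 1"
          using True by (intro mult_left_mono source_nonneg) (simp add: \<psi>_def sat_le_1)
        then show ?thesis using True VB[of x] by (simp add: F_def source_def)
      next
        case False
        then have "\<psi> (M j) (e j) (M j) x = 0"
          using VB[of x] sat_zero[of "w (M j) (e j) x - v x" "M j"] by (cases "x \<in> ball 0 R") (auto simp: \<psi>_def)
        moreover have "F j x = 0" using False unfolding F_def by (rule if_not_P)
        ultimately show ?thesis by simp
      qed
    qed
    then show ?thesis
      using lower[of j] ob(3)[OF Mj[of j] e(1)[of j] e1[of j] M(1)[of j]] by linarith
  qed
  then have "\<kappa> * C1 \<le> (LINT x|lebesgue. F' x)" by (intro LIMSEQ_le_const[OF FL]) auto
  also have "\<dots> \<le> (LINT x|lebesgue. c powr (p - 1) * (indicat_real (ball 0 R) x * norm (x::'a) powr \<theta>))"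
  proof (rule integral_mono[OF iF'])
    show "integrable lebesgue (\<lambda>x::'a. c powr (p - 1) * (indicat_real (ball 0 R) x * norm x powr \<theta>))"
      using iR by (rule integrable_mult_right)
    fix x :: 'a
    show "F' x \<le> c powr (p - 1) * (indicat_real (ball 0 R) x * norm x powr \<theta>)"
    proof (cases "x \<in> ball 0 R \<and> V x \<le> w' x")
      case True
      then have x: "x \<in> ball 0 R" "v x \<le> w' x" using VB[of x] by auto
      have "v x powr (p - 1) \<le> w' x powr (p - 1)" using x p1 sub by (intro powr_mono2 v_nonneg) auto
      also have "\<dots> = c powr (p - 1) * norm x powr (p - n)"
        using c p1 by (simp add: w'_def powr_mult powr_powr \<gamma>_def)
      finally have "norm x powr \<alpha> * v x powr (p - 1) \<le> norm x powr \<alpha> * (c powr (p - 1) * norm x powr (p - n))"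
        by (intro mult_left_mono) auto
      also have "\<dots> = c powr (p - 1) * (norm x powr \<alpha> * norm x powr (p - n))" by (simp only: mult_ac)
      also have "norm x powr \<alpha> * norm x powr (p - n) = norm x powr \<theta>"
        unfolding powr_add[symmetric] \<theta>_def by (simp only: add_diff_eq)
      finally show ?thesis using True VB[of x] x by (simp add: F'_def)
    next
      case False
      then have "F' x = 0" unfolding F'_def by (rule if_not_P)
      then show ?thesis by simp
    qed
  qed
  also have "\<dots> = c powr (p - 1) * (LINT x|lebesgue. indicat_real (ball 0 R) x * norm (x::'a) powr \<theta>)" by simp
  also have "\<dots> < c powr (p - 1) * (\<gamma> powr (p - 1) * C1)"
    using small c by (intro mult_strict_left_mono) auto
  also have "\<dots> = \<kappa> * C1" using c \<gamma> by (simp add: \<kappa>_def powr_mult)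
  finally show False by simp
qed

end

section \<open>The strong maximum principle\<close>

context continuous_solution
begin

text \<open>If \<open>v\<close> were positive at a point closer to \<open>y\<close> than to the complement of \<open>\<Omega> - {0}\<close>, positivity would spread
  to \<open>y\<close>.\<close>

lemma zero_set_open_away_from_origin:
  assumes y: "y \<in> \<Omega>" "y \<noteq> 0" "v y = 0"
  obtains r where "0 < r" "\<And>z. z \<in> ball y r \<Longrightarrow> v z = 0"
proof -
  have "open (\<Omega> - {0})" using open_\<Omega> by (rule open_delete)
  then obtain d where d: "0 < d" "cball y d \<subseteq> \<Omega> - {0}" using y open_contains_cball by blast
  have "v z = 0" if z: "z \<in> ball y (d / 2)" for z
  proof (rule ccontr)
    assume "v z \<noteq> 0"
    have zd: "cball z (d / 2) \<subseteq> cball y d"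
    proof
      fix x assume "x \<in> cball z (d / 2)"
      then show "x \<in> cball y d" using z dist_triangle[of y x z] by auto
    qed
    then have sub: "cball z (d / 2) \<subseteq> \<Omega> - {0}" using d by blast
    moreover have "z \<in> cball z (d / 2)" using d by simp
    ultimately have "z \<in> \<Omega>" by blast
    then have vz: "0 < v z" using v_nonneg[of z] \<open>v z \<noteq> 0\<close> by simp
    have "continuous_on (cball z (d / 2)) (\<lambda>x. norm x powr \<alpha>)"
      by (intro continuous_intros) (use sub in auto)
    then obtain L where L: "\<And>x. x \<in> cball z (d / 2) \<Longrightarrow> norm (norm x powr \<alpha>) \<le> L"
      using continuous_bounded_on_compact[OF compact_cball] by blast
    have "0 < v y"
    proof (rule annulus_positive[OF _ _ vz])
      show "cball z (d / 2) \<subseteq> \<Omega>" using sub by blast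
      show "norm x powr \<alpha> \<le> L" if "x \<in> cball z (d / 2)" for x using L[OF that] by simp
      show "y \<in> ball z (d / 2)" using z by (simp add: dist_commute)
    qed
    then show False using y by simp
  qed
  then show ?thesis using that[of "d / 2"] d by simp
qed

lemma dichotomy_away_from_origin:
  assumes conn: "connected \<Omega>" and dim: "2 \<le> DIM('a)"
  shows "(\<forall>x\<in>\<Omega> - {0}. v x = 0) \<or> (\<forall>x\<in>\<Omega> - {0}. 0 < v x)"
proof -
  let ?U = "\<Omega> - {0}"
  define Z where "Z = {x \<in> ?U. v x = 0}"
  define P where "P = {x \<in> ?U. 0 < v x}"
  have U: "open ?U" using open_\<Omega> by (rule open_delete)
  have "connected ?U" by (rule connected_open_delete[OF open_\<Omega> conn dim])
  moreover have "open Z"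
    unfolding open_contains_ball
  proof
    fix y assume y: "y \<in> Z"
    then obtain r where r: "0 < r" "\<And>z. z \<in> ball y r \<Longrightarrow> v z = 0"
      using zero_set_open_away_from_origin[of y] by (auto simp: Z_def)
    obtain s where s: "0 < s" "ball y s \<subseteq> ?U" using U y open_contains_ball unfolding Z_def by blast
    have "ball y (min r s) \<subseteq> Z"
    proof
      fix x assume "x \<in> ball y (min r s)"
      then have x: "x \<in> ball y r" "x \<in> ball y s" by auto
      have "x \<in> ?U" using s(2) x(2) by blast
      then show "x \<in> Z" using r(2)[OF x(1)] by (simp add: Z_def)
    qed
    then show "\<exists>e>0. ball y e \<subseteq> Z" using r s by (intro exI[of _ "min r s"]) auto
  qed
  moreover have "open P"
  proof -
    have "open (?U \<inter> v -` {0<..})"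
      by (rule continuous_open_preimage[OF continuous_on_subset[OF v_cont] U]) auto
    moreover have "?U \<inter> v -` {0<..} = P" by (auto simp: P_def)
    ultimately show ?thesis by (simp only:)
  qed
  moreover have "Z \<inter> P \<inter> ?U = {}" "?U \<subseteq> Z \<union> P"
    using v_nonneg by (auto simp: Z_def P_def less_le)
  ultimately have "Z \<inter> ?U = {} \<or> P \<inter> ?U = {}" by (rule connectedD)
  then show ?thesis using \<open>?U \<subseteq> Z \<union> P\<close> by (auto simp: Z_def P_def)
qed

lemma vanishing_point_imp_zero:
  assumes conn: "connected \<Omega>" and dim: "2 \<le> DIM('a)" and \<alpha>: "- p < \<alpha>"
    and x0: "x0 \<in> \<Omega>" "v x0 = 0"
  shows "\<forall>x\<in>\<Omega> - {0}. v x = 0"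
proof (rule ccontr)
  assume "\<not> ?thesis"
  then have pos: "0 < v x" if "x \<in> \<Omega>" "x \<noteq> 0" for x
    using dichotomy_away_from_origin[OF conn dim] that by blast
  then have "x0 = 0" using x0 by force
  then have 0: "0 \<in> \<Omega>" "v 0 = 0" using x0 by auto
  show False
  proof (cases "- real DIM('a) < \<alpha>")
    case True
    then show False using positive_at_origin_subcritical[OF True \<alpha> 0(1) pos] 0(2) by simp
  next
    case False
    then show False using nonzero_at_origin_supercritical[OF dim _ \<alpha> 0(1) pos] 0(2) by simp
  qed
qed

end

theorem theorem1p20:
  fixes \<Omega> :: "(real ^ 'n) set" and u :: "real ^ 'n \<Rightarrow> real"
    and p \<alpha> :: real and x0 :: "real ^ 'n"
  assumes "CARD('n) \<ge> 2"
    and "open \<Omega>" and "connected \<Omega>" and "bounded \<Omega>"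
    and "1 < p" and "\<alpha> > - p"
    and "u \<in> sobolev_W1 p \<Omega>"
    and "AE x in lebesgue_on \<Omega>. 0 \<le> u x"
    and "weak_solution p \<alpha> \<Omega> u"
    and "x0 \<in> \<Omega>" and "vanishes_at \<Omega> u x0"
  shows "AE x in lebesgue_on \<Omega>. u x = 0"
proof -
  obtain v where v: "continuous_on \<Omega> v" "AE x in lebesgue_on \<Omega>. v x = u x" "v x0 = 0"
    using assms(11) by (auto simp: vanishes_at_def continuous_representative_def)
  have v_nonneg: "0 \<le> v x" if "x \<in> \<Omega>" for x
  proof -
    let ?S = "{x \<in> \<Omega>. v x < 0}"
    have "open (\<Omega> \<inter> v -` {..<0})" by (rule continuous_open_preimage[OF v(1) assms(2)]) auto
    moreover have "\<Omega> \<inter> v -` {..<0} = ?S" by auto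
    ultimately have "open ?S" by (simp only:)
    moreover have "AE x in lebesgue. x \<notin> ?S"
    proof -
      have "AE x in lebesgue_on \<Omega>. 0 \<le> v x" using v(2) assms(8) by eventually_elim simp
      then show ?thesis unfolding AE_lebesgue_on_open[OF assms(2)] by eventually_elim auto
    qed
    ultimately have "?S = {}" by (rule open_null_imp_empty)
    then show ?thesis using that by (auto simp: not_less)
  qed
  interpret continuous_solution \<Omega> u v p \<alpha>
    by unfold_locales (use assms v v_nonneg in auto)
  have "2 \<le> DIM(real ^ 'n)" using assms(1) by simp
  then have z: "\<forall>x\<in>\<Omega> - {0}. v x = 0"
    using vanishing_point_imp_zero[OF assms(3) _ _ assms(10) v(3)] assms(6) by simp
  have "AE x in lebesgue. x \<noteq> (0 :: real ^ 'n)" using AE_lborel_singleton by (rule AE_completion)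
  then have "AE x in lebesgue_on \<Omega>. v x = 0"
    unfolding AE_lebesgue_on_open[OF assms(2)] by eventually_elim (use z in auto)
  with v(2) show ?thesis by eventually_elim simp
qed

end
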